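(* Let $f:X\to X$ be a map with a single orbit. Then $(X,f)$ is unary FA-presentable if and only if its graph can be obtained in one of the following ways: (1) Start with a finite directed cycle; attach finitely many inward rooted finite trees (at their roots) to the cycle; then to any vertices of the resulting finite graph attach finitely many inwardly oriented periodic paths (at their bases) and finitely many inwardly oriented shallow stars (at their centres). (2) Start with an inward rooted finite tree; to the root attach one outwardly oriented periodic path (at its base); then to any vertices of the resulting graph attach finitely many inwardly oriented periodic paths (at their bases) and finitely many inwardly oriented shallow stars (at their centres).
   Context: The graph of a (partial) map $f:X\to X$ is the directed graph with vertex set $X$ and edges $(x,(x)f)$ for $x$ where $(x)f$ is defined; $x,y$ lie in the same orbit if $(x)f^m=(y)f^n$ for some $m,n\ge0$, i.e. orbits are connected components of the graph. $(X,f)$ is unary FA-presentable if there exist a regular language $L\subseteq a^*$ and a surjection $\phi:L\to X$ such that $\{(u,v)\in L^2:u\phi=v\phi\}$ and $\{(u,v)\in L^2:(u\phi)f=v\phi\}$ are regular relations (words $\mathrm{conv}(u,v)$ over $\{a,\$\}^2$, reading $u,v$ in parallel with the shorter padded by $\$$, form regular languages). Attaching $(T,\eta)$ at $t$ to a vertex $g$ of $(G,\gamma)$: take the disjoint union and identify $g$ with $t$. An inward rooted tree is a directed tree (tree with directed edges) with a distinguished root such that every edge points towards the root (its head lies on the path from its tail to the root). A template is $(T,\eta,t_0,t_1)$, $(T,\eta)$ a finite directed tree, $t_0,t_1\in T$, $t_0$ a leaf; $\mathcal{S}(T,\eta,t_0,t_1)$ is obtained from disjoint copies $(T^{(j)},\eta^{(j)},t^{(j)}_0,t^{(j)}_1)$,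 $j\ge0$, by identifying according to the equivalence relation generated by $\{(t_1^{(j)},t_0^{(j+1)})\}$. If $t_0=t_1$ it is a shallow star with centre the amalgamated vertex; it is inwardly oriented if every edge of the template is oriented towards $t_0$. If $t_0\neq t_1$ it is a periodic path with base $t_0^{(0)}$; it is inwardly oriented if every edge of the template is oriented towards $t_0$, and outwardly oriented if every edge of the template is oriented towards $t_1$. *)

theory Defs
  imports Main
begin

definition regular :: "'a list set \<Rightarrow> bool" where
  "regular L \<longleftrightarrow> (\<exists>(N::nat) (\<delta>::nat \<Rightarrow> 'a \<Rightarrow> nat) (F::nat set).
      0 < N \<and> (\<forall>q<N. \<forall>x. \<delta> q x < N) \<and> L = {w. foldl \<delta> 0 w \<in> F})"

text \<open>Words over the one-letter alphabet {a} are lists over unit.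
Convolution: the padding symbol dollar is represented by None.\<close>
type_synonym uword = "unit list"

definition conv :: "'a list \<Rightarrow> 'a list \<Rightarrow> ('a option \<times> 'a option) list" where
  "conv u v = map (\<lambda>i. (if i < length u then Some (u ! i) else None,
                         if i < length v then Some (v ! i) else None))
                  [0..<max (length u) (length v)]"

definition regular_rel :: "('a list \<times> 'a list) set \<Rightarrow> bool" where
  "regular_rel R \<longleftrightarrow> regular ((\<lambda>(u, v). conv u v) ` R)"

definition unary_FA_presentable :: "'x set \<Rightarrow> ('x \<Rightarrow> 'x) \<Rightarrow> bool" where
  "unary_FA_presentable X f \<longleftrightarrow>
     (\<exists>(L::uword set) (\<phi>::uword \<Rightarrow> 'x).
        regular L \<and> \<phi> ` L = X \<and>
        regular_rel {(u, v). u \<in> L \<and> v \<in> L \<and> \<phi> u = \<phi> v} \<and>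
        regular_rel {(u, v). u \<in> L \<and> v \<in> L \<and> f (\<phi> u) = \<phi> v})"

definition single_orbit :: "'x set \<Rightarrow> ('x \<Rightarrow> 'x) \<Rightarrow> bool" where
  "single_orbit X f \<longleftrightarrow> X \<noteq> {} \<and>
     (\<forall>x\<in>X. \<forall>y\<in>X. \<exists>m n. (f ^^ m) x = (f ^^ n) y)"

type_synonym 'v digraph = "'v set \<times> ('v \<times> 'v) set"

definition map_graph :: "'x set \<Rightarrow> ('x \<Rightarrow> 'x) \<Rightarrow> 'x digraph" where
  "map_graph X f = (X, {(x, f x) | x. x \<in> X})"

definition graph_iso :: "'v digraph \<Rightarrow> 'w digraph \<Rightarrow> bool" where
  "graph_iso G H \<longleftrightarrow> (\<exists>h. bij_betw h (fst G) (fst H) \<and>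
      (\<forall>x\<in>fst G. \<forall>y\<in>fst G. (x, y) \<in> snd G \<longleftrightarrow> (h x, h y) \<in> snd H))"

definition upath :: "('v \<times> 'v) set \<Rightarrow> 'v \<Rightarrow> 'v \<Rightarrow> 'v list \<Rightarrow> bool" where
  "upath S u w p \<longleftrightarrow> p \<noteq> [] \<and> hd p = u \<and> last p = w \<and> distinct p \<and>
     (\<forall>i. Suc i < length p \<longrightarrow> (p ! i, p ! Suc i) \<in> S)"

definition dtree :: "'v set \<Rightarrow> ('v \<times> 'v) set \<Rightarrow> bool" where
  "dtree T \<eta> \<longleftrightarrow> T \<noteq> {} \<and> \<eta> \<subseteq> T \<times> T \<and>
     (\<forall>(u, v)\<in>\<eta>. u \<noteq> v \<and> (v, u) \<notin> \<eta>) \<and>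
     (\<forall>u\<in>T. \<forall>v\<in>T. \<exists>!p. upath (\<eta> \<union> \<eta>\<inverse>) u v p)"

definition oriented_towards :: "('v \<times> 'v) set \<Rightarrow> 'v \<Rightarrow> bool" where
  "oriented_towards \<eta> r \<longleftrightarrow>
     (\<forall>(u, v)\<in>\<eta>. \<exists>p. upath (\<eta> \<union> \<eta>\<inverse>) u r p \<and> v \<in> set p)"

definition inward_rooted_finite_tree :: "'v set \<Rightarrow> ('v \<times> 'v) set \<Rightarrow> 'v \<Rightarrow> bool" where
  "inward_rooted_finite_tree T \<eta> r \<longleftrightarrow>
     finite T \<and> dtree T \<eta> \<and> r \<in> T \<and> oriented_towards \<eta> r"

definition leaf :: "('v \<times> 'v) set \<Rightarrow> 'v \<Rightarrow> bool" where
  "leaf \<eta> v \<longleftrightarrow> card {w. (v, w) \<in> \<eta> \<union> \<eta>\<inverse>} = 1"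

definition template :: "'v set \<Rightarrow> ('v \<times> 'v) set \<Rightarrow> 'v \<Rightarrow> 'v \<Rightarrow> bool" where
  "template T \<eta> t0 t1 \<longleftrightarrow> finite T \<and> dtree T \<eta> \<and> t0 \<in> T \<and> t1 \<in> T \<and> leaf \<eta> t0"

text \<open>The structure S(T,eta,t0,t1): copies indexed by j, vertex (j,v) is v in copy j.
The equivalence relation generated by (t1^(j), t0^(j+1)) is represented by the canonical
representative srep: if t0 = t1 all copies of t0 are identified with (0,t0); otherwise
(j+1,t0) is identified with (j,t1).\<close>
definition srep :: "'v \<Rightarrow> 'v \<Rightarrow> nat \<times> 'v \<Rightarrow> nat \<times> 'v" where
  "srep t0 t1 x = (let (j, v) = x in
      if v = t0 \<and> t0 = t1 then (0, t0)
      else if v = t0 \<and> 0 < j then (j - 1, t1)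
      else (j, v))"

definition S_graph :: "'v set \<Rightarrow> ('v \<times> 'v) set \<Rightarrow> 'v \<Rightarrow> 'v \<Rightarrow> (nat \<times> 'v) digraph" where
  "S_graph T \<eta> t0 t1 =
     ({srep t0 t1 (j, v) | j v. v \<in> T},
      {(srep t0 t1 (j, u), srep t0 t1 (j, v)) | j u v. (u, v) \<in> \<eta>})"

text \<open>The amalgamated vertex (0,t0): base of a periodic path / centre of a shallow star.\<close>

definition inwardly_oriented :: "'v set \<Rightarrow> ('v \<times> 'v) set \<Rightarrow> 'v \<Rightarrow> 'v \<Rightarrow> bool" where
  "inwardly_oriented T \<eta> t0 t1 \<longleftrightarrow> oriented_towards \<eta> t0"

definition outwardly_oriented :: "'v set \<Rightarrow> ('v \<times> 'v) set \<Rightarrow> 'v \<Rightarrow> 'v \<Rightarrow> bool" where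
  "outwardly_oriented T \<eta> t0 t1 \<longleftrightarrow> oriented_towards \<eta> t1"

text \<open>Attach, for each i in I, the graph (VC i, EC i) at vertex t i to the vertex g i of the
base graph (VB, EB): disjoint union (Inl for the base, Inr (i,_) for component i), then
identify Inr (i, t i) with Inl (g i) (canonical representative grep).\<close>
definition grep :: "(nat \<Rightarrow> 'c) \<Rightarrow> (nat \<Rightarrow> 'b) \<Rightarrow> 'b + nat \<times> 'c \<Rightarrow> 'b + nat \<times> 'c" where
  "grep t g x = (case x of Inl b \<Rightarrow> Inl b
                   | Inr (i, v) \<Rightarrow> (if v = t i then Inl (g i) else Inr (i, v)))"

definition attach_all :: "'b digraph \<Rightarrow> nat set \<Rightarrow> (nat \<Rightarrow> 'c digraph) \<Rightarrow> (nat \<Rightarrow> 'c)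
    \<Rightarrow> (nat \<Rightarrow> 'b) \<Rightarrow> ('b + nat \<times> 'c) digraph" where
  "attach_all B I C t g =
     (Inl ` fst B \<union> {grep t g (Inr (i, v)) | i v. i \<in> I \<and> v \<in> fst (C i)},
      {(Inl u, Inl v) | u v. (u, v) \<in> snd B} \<union>
      {(grep t g (Inr (i, u)), grep t g (Inr (i, v))) | i u v. i \<in> I \<and> (u, v) \<in> snd (C i)})"

definition cycle_graph :: "nat \<Rightarrow> nat digraph" where
  "cycle_graph n = ({..<n}, {(i, Suc i mod n) | i. i < n})"

text \<open>Attach finitely many inwardly oriented periodic paths (at their bases) and inwardly
oriented shallow stars (at their centres) to vertices of the graph B. Both kinds are
S(T,eta,t0,t1) with all template edges oriented towards t0 (t0 \<noteq> t1: periodic path,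
t0 = t1: shallow star), attached at (0,t0).\<close>
definition attach_inward_comps :: "'b digraph \<Rightarrow> ('b + nat \<times> (nat \<times> nat)) digraph \<Rightarrow> bool" where
  "attach_inward_comps B G \<longleftrightarrow>
     (\<exists>(I::nat set) (CT::nat \<Rightarrow> nat set) (C\<eta>::nat \<Rightarrow> (nat \<times> nat) set) (c0::nat \<Rightarrow> nat)
        (c1::nat \<Rightarrow> nat) (p::nat \<Rightarrow> 'b).
        finite I \<and>
        (\<forall>i\<in>I. template (CT i) (C\<eta> i) (c0 i) (c1 i) \<and>
                inwardly_oriented (CT i) (C\<eta> i) (c0 i) (c1 i) \<and> p i \<in> fst B) \<and>
        G = attach_all B I (\<lambda>i. S_graph (CT i) (C\<eta> i) (c0 i) (c1 i)) (\<lambda>i. (0, c0 i)) p)"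

definition shape1 :: "'x set \<Rightarrow> ('x \<Rightarrow> 'x) \<Rightarrow> bool" where
  "shape1 X f \<longleftrightarrow>
     (\<exists>(n::nat) (I::nat set) (TV::nat \<Rightarrow> nat set) (TE::nat \<Rightarrow> (nat \<times> nat) set)
        (root::nat \<Rightarrow> nat) (at::nat \<Rightarrow> nat) G.
        1 \<le> n \<and> finite I \<and>
        (\<forall>i\<in>I. inward_rooted_finite_tree (TV i) (TE i) (root i) \<and> at i < n) \<and>
        attach_inward_comps (attach_all (cycle_graph n) I (\<lambda>i. (TV i, TE i)) root at) G \<and>
        graph_iso (map_graph X f) G)"

definition shape2 :: "'x set \<Rightarrow> ('x \<Rightarrow> 'x) \<Rightarrow> bool" where
  "shape2 X f \<longleftrightarrow>
     (\<exists>(V::nat set) (E::(nat \<times> nat) set) (r::nat) (T::nat set) (\<eta>::(nat \<times> nat) set)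
        (t0::nat) (t1::nat) G.
        inward_rooted_finite_tree V E r \<and>
        template T \<eta> t0 t1 \<and> t0 \<noteq> t1 \<and> outwardly_oriented T \<eta> t0 t1 \<and>
        attach_inward_comps
          (attach_all (V, E) {0} (\<lambda>_. S_graph T \<eta> t0 t1) (\<lambda>_. (0, t0)) (\<lambda>_. r)) G \<and>
        graph_iso (map_graph X f) G)"

end

theory Submission
  imports Defs
begin

text \<open>
  Over a one-letter alphabet a relation is regular iff membership of a pair of lengths depends, up to
  a period \<open>q\<close>, only on the smaller length and on the difference. Choosing shortest representatives,
  a presentable map becomes a map \<open>g\<close> on a periodic set \<open>L\<close> of naturals which on every column
  \<open>u, u + q, u + 2q, \<dots>\<close> far out is either constant or commutes with the shift by \<open>q\<close>. Following \<open>g\<close>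
  through the finitely many columns one runs into a constant column or returns to a column already
  visited; since there is one orbit, the return is a nonzero shift, and with the period \<open>P = q! * q\<close>
  all such shifts become \<open>+P\<close> or \<open>-P\<close>. For a far-out column \<open>d, d + P, \<dots>\<close> that is constant or is shifted
  inwards, the sets of points flowing into \<open>d + jP\<close> but not into \<open>d + (j + 1)P\<close> are translates of one
  finite set, and this gives a shallow star or an inward periodic path at \<open>g d\<close>. What remains is finite
  and contains the cycle, or it is a finite tree together with one outward periodic path.

  Conversely, in a graph of one of the two forms the vertices are a finite set and finitely many
  columns along which the edges are uniform, and numbering the columns in parallel gives a presentation.
\<close>

section \<open>Regular relations on unary words\<close>

text \<open>The obstacle is that translation by \<open>P\<close> commutes with \<open>g\<close> only
  along orbits that stay away from the finitely many small vertices and from constant columns. So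
  the columns to be cut off start beyond a threshold \<open>N\<close>, from which on they contain no
  point reached from a small vertex and no point of a cycle; whatever flows into them then
  translates freely. Far-out columns may also flow through one another, which is why a branch is cut
  at the last such column that an orbit passes, with one representative per residue modulo
  \<open>P\<close>. The template starts at \<open>g d\<close> and not at \<open>d\<close>, because
  its leaf \<open>t0\<close> has to be a vertex of what remains. Finiteness of the templates is
  quantitative: far out on a non-constant column \<open>g\<close> moves a point by less than
  \<open>q\<close>, and a special column is met within \<open>q\<close> steps, so an orbit drops by
  at most \<open>q * q\<close> before that. The same bounds explain the factor \<open>q!\<close>: a
  return to a residue class after at most \<open>q\<close> steps is a shift by \<open>k * q\<close>
  with \<open>k\<close> at most \<open>q\<close>, and such a \<open>k\<close> divides
  \<open>q!\<close>.\<close>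

lemma regularI_finite_automaton:
  fixes \<delta> :: "'q \<Rightarrow> 'a \<Rightarrow> 'q"
  assumes "finite Q" "q0 \<in> Q" "\<And>q x. q \<in> Q \<Longrightarrow> \<delta> q x \<in> Q"
    and L: "\<And>w. w \<in> L \<longleftrightarrow> foldl \<delta> q0 w \<in> F"
  shows "regular L"
proof -
  obtain e0 :: "'q \<Rightarrow> nat" where e0: "bij_betw e0 Q {0..<card Q}"
    using ex_bij_betw_finite_nat[OF \<open>finite Q\<close>] by blast
  have pos: "0 < card Q" using assms card_gt_0_iff by blast
  \<comment> \<open>Transposes the numbers \<open>0\<close> and \<open>e0 q0\<close>, because
    \<open>regular\<close> fixes the initial state to be 0.\<close>
  define e where "e = (\<lambda>q. if q = q0 then 0 else if e0 q = 0 then e0 q0 else e0 q)"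
  have "e ` Q \<subseteq> {0..<card Q}" using e0 assms(2) pos by (auto simp: e_def bij_betw_def)
  moreover have "inj_on e Q" using e0 assms(2) by (auto simp: inj_on_def e_def bij_betw_def)
  ultimately have e: "bij_betw e Q {0..<card Q}"
    by (simp add: bij_betw_def card_image card_subset_eq)
  have eq0: "e q0 = 0" by (simp add: e_def)
  define d where "d = inv_into Q e"
  have de: "d (e q) = q" if "q \<in> Q" for q
    using e that by (simp add: d_def bij_betw_inv_into_left)
  have dQ: "d n \<in> Q" if "n < card Q" for n
    using e that unfolding d_def by (metis atLeast0LessThan bij_betw_imp_surj_on inv_into_into lessThan_iff)
  have eQ: "e q < card Q" if "q \<in> Q" for q using e that by (auto simp: bij_betw_def)
  define \<delta>' where "\<delta>' = (\<lambda>n x. e (\<delta> (d n) x))"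
  have run: "foldl \<delta> q0 w \<in> Q \<and> foldl \<delta>' 0 w = e (foldl \<delta> q0 w)" for w
    by (induction w rule: rev_induct) (use assms de in \<open>auto simp: \<delta>'_def eq0\<close>)
  have "L = {w. foldl \<delta>' 0 w \<in> e ` (F \<inter> Q)}"
  proof -
    have "w \<in> L \<longleftrightarrow> foldl \<delta>' 0 w \<in> e ` (F \<inter> Q)" for w
      using run[of w] L[of w] de by (metis IntE IntI image_iff)
    then show ?thesis by blast
  qed
  moreover have "\<forall>q<card Q. \<forall>x. \<delta>' q x < card Q"
    using dQ eQ assms(3) by (simp add: \<delta>'_def)
  ultimately show ?thesis unfolding regular_def using pos by blast
qed

text \<open>By pigeonhole the orbit of \<open>q\<close> repeats within its first
  \<open>N + 1\<close> members. The length of the repetition depends on \<open>q\<close> and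
  \<open>h\<close> but is at most \<open>N\<close>, so \<open>fact N\<close> is a period for all
  states and all letters at once.\<close>

lemma funpow_eventually_periodic:
  fixes h :: "nat \<Rightarrow> nat"
  assumes h: "\<And>q. q < N \<Longrightarrow> h q < N" and q: "q < N" and n: "n \<ge> N"
  shows "(h ^^ (n + fact N)) q = (h ^^ n) q"
proof -
  have lt: "(h ^^ i) q < N" for i by (induction i) (auto simp: q h)
  have "\<not> inj_on (\<lambda>i. (h ^^ i) q) {..N}"
  proof
    assume "inj_on (\<lambda>i. (h ^^ i) q) {..N}"
    then have "card {..N} \<le> card {..<N}"
      by (rule card_inj_on_le) (use lt in auto)
    then show False by simp
  qed
  then obtain i j where ij: "i < j" "j \<le> N" "(h ^^ i) q = (h ^^ j) q"
    unfolding inj_on_def by (metis atMost_iff linorder_neqE_nat)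
  have per: "(h ^^ (m + (j - i))) q = (h ^^ m) q" if "m \<ge> i" for m
  proof -
    have "(h ^^ (m + (j - i))) q = (h ^^ (m - i)) ((h ^^ j) q)"
      using that ij(1) by (simp flip: funpow_add o_apply[of "h ^^ _"])
    also have "\<dots> = (h ^^ (m - i)) ((h ^^ i) q)" using ij by simp
    also have "\<dots> = (h ^^ m) q" using that by (simp flip: funpow_add o_apply[of "h ^^ _"])
    finally show ?thesis .
  qed
  have mult: "(h ^^ (m + l * (j - i))) q = (h ^^ m) q" if "m \<ge> i" for m l
  proof (induction l)
    case (Suc l)
    have "(h ^^ (m + Suc l * (j - i))) q = (h ^^ ((m + l * (j - i)) + (j - i))) q"
      by (simp add: add_ac)
    also have "\<dots> = (h ^^ m) q" using per[of "m + l * (j - i)"] that Suc by simp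
    finally show ?case .
  qed simp
  have "(j - i) dvd fact N" using ij by (intro dvd_fact) auto
  then obtain l where "fact N = l * (j - i)" by (metis dvd_def mult.commute)
  then show ?thesis using mult[of n l] n ij by simp
qed

text \<open>For a relation between the lengths of unary words, this is regularity with explicit period:
  membership depends on the shorter length and on the difference only modulo \<open>k\<close> once they are
  at least \<open>k\<close>.\<close>
definition periodic_rel :: "nat \<Rightarrow> (nat \<Rightarrow> nat \<Rightarrow> bool) \<Rightarrow> bool" where
  "periodic_rel k R \<longleftrightarrow>
     (\<forall>m d. k \<le> m \<longrightarrow> R (m + k) (m + d + k) = R m (m + d) \<and> R (m + d + k) (m + k) = R (m + d) m) \<and>
     (\<forall>m d. k \<le> d \<longrightarrow> R m (m + d + k) = R m (m + d) \<and> R (m + d + k) m = R (m + d) m)"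

definition periodic_set :: "nat \<Rightarrow> nat set \<Rightarrow> bool" where
  "periodic_set k A \<longleftrightarrow> (\<forall>n\<ge>k. n + k \<in> A \<longleftrightarrow> n \<in> A)"

text \<open>\<open>k\<close> is threshold and period at the same time, and a multiple enlarges both.
  This is how several relations are brought to one common \<open>k\<close>.\<close>

lemma periodic_rel_mult:
  assumes "periodic_rel k R" "0 < l"
  shows "periodic_rel (k * l) R"
proof -
  have a: "R (m + k * i) (m + d + k * i) = R m (m + d) \<and> R (m + d + k * i) (m + k * i) = R (m + d) m"
    if "k \<le> m" for m d i
  proof (induction i)
    case (Suc i)
    have "k \<le> m + k * i" using that by simp
    then have "R (m + k * i + k) (m + k * i + d + k) = R (m + k * i) (m + k * i + d) \<and>
       R (m + k * i + d + k) (m + k * i + k) = R (m + k * i + d) (m + k * i)"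
      using assms(1) unfolding periodic_rel_def by blast
    then show ?case using Suc by (simp add: algebra_simps)
  qed simp
  have b: "R m (m + d + k * i) = R m (m + d) \<and> R (m + d + k * i) m = R (m + d) m"
    if "k \<le> d" for m d i
  proof (induction i)
    case (Suc i)
    have "k \<le> d + k * i" using that by simp
    then have "R m (m + (d + k * i) + k) = R m (m + (d + k * i)) \<and>
       R (m + (d + k * i) + k) m = R (m + (d + k * i)) m"
      using assms(1) unfolding periodic_rel_def by blast
    then show ?case using Suc by (simp add: algebra_simps)
  qed simp
  have "k \<le> k * l" using assms by simp
  then have "m \<ge> k" if "m \<ge> k * l" for m using that by (rule order_trans)
  then show ?thesis unfolding periodic_rel_def using a b by meson
qed

lemma periodic_set_mult:
  assumes "periodic_set k A" "0 < l"
  shows "periodic_set (k * l) A"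
proof -
  have a: "n + k * i \<in> A \<longleftrightarrow> n \<in> A" if "k \<le> n" for n i
  proof (induction i)
    case (Suc i)
    have "k \<le> n + k * i" using that by simp
    then have "n + k * i + k \<in> A \<longleftrightarrow> n + k * i \<in> A" using assms(1) unfolding periodic_set_def by blast
    then show ?case using Suc by (simp add: algebra_simps)
  qed simp
  have "k \<le> k * l" using assms by simp
  then show ?thesis unfolding periodic_set_def using a order_trans by meson
qed

section \<open>Unary words as lengths\<close>

lemma unit_list_eq: "(w :: unit list) = replicate (length w) ()"
  by (simp add: list_eq_iff_nth_eq)

lemma foldl_replicate: "foldl \<delta> q (replicate n x) = ((\<lambda>q. \<delta> q x) ^^ n) q"
  by (induction n arbitrary: q) (auto simp: funpow_swap1[of "\<lambda>q. \<delta> q x"])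

text \<open>The successor on a lasso with tail \<open>0, ..., k - 1\<close> and loop
  \<open>k, ..., 2 * k - 1\<close>. A counter running on it retains exactly what a condition with
  threshold and period \<open>k\<close> can see.\<close>

definition periodic_succ :: "nat \<Rightarrow> nat \<Rightarrow> nat" where
  "periodic_succ k a = (if Suc a < 2 * k then Suc a else k)"

definition periodic_rep :: "nat \<Rightarrow> nat \<Rightarrow> nat" where
  "periodic_rep k n = (periodic_succ k ^^ n) 0"

lemma periodic_rep_0 [simp]: "periodic_rep k 0 = 0"
  and periodic_rep_Suc: "periodic_rep k (Suc n) = periodic_succ k (periodic_rep k n)"
  by (simp_all add: periodic_rep_def)

lemma periodic_rep_less:
  assumes "0 < k"
  shows "periodic_rep k n < 2 * k"
  using assms by (induction n) (auto simp: periodic_rep_Suc periodic_succ_def)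

lemma periodic_rep_cases:
  assumes "0 < k"
  shows "n = periodic_rep k n \<or> (\<exists>i. k \<le> periodic_rep k n \<and> n = periodic_rep k n + k * i)"
proof (induction n)
  case (Suc n)
  consider "Suc (periodic_rep k n) < 2 * k" | "Suc (periodic_rep k n) = 2 * k"
    using periodic_rep_less[OF assms, of n] by linarith
  then show ?case
  proof cases
    case 1
    then show ?thesis using Suc by (auto simp: periodic_rep_Suc periodic_succ_def)
  next
    case 2
    then have r: "periodic_rep k (Suc n) = k" by (simp add: periodic_rep_Suc periodic_succ_def)
    from Suc obtain i where "n = periodic_rep k n + k * i" by (metis add_0_right mult_0_right)
    then have "Suc n = k + k * Suc i" using 2 by simp
    then show ?thesis using r by (metis order_refl)
  qed
qed simp

lemma periodic_setD:
  assumes "periodic_set k A" "0 < k"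
  shows "n \<in> A \<longleftrightarrow> periodic_rep k n \<in> A"
proof -
  have "a + k * i \<in> A \<longleftrightarrow> a \<in> A" if "k \<le> a" for a i
    using periodic_set_mult[OF assms(1), of "Suc i"] that
  proof (induction i)
    case (Suc i)
    have "a + k * i + k \<in> A \<longleftrightarrow> a + k * i \<in> A"
      using assms(1) that unfolding periodic_set_def by (simp add: trans_le_add1)
    then show ?case using Suc periodic_set_mult[OF assms(1), of "Suc i"] by (simp add: algebra_simps)
  qed simp
  then show ?thesis using periodic_rep_cases[OF assms(2), of n] by metis
qed

lemma regular_unary_iff:
  "regular (L :: uword set) \<longleftrightarrow> (\<exists>k>0. periodic_set k {n. replicate n () \<in> L})"
proof
  assume "regular L"
  then obtain N F and \<delta> :: "nat \<Rightarrow> unit \<Rightarrow> nat"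
    where N: "0 < N" "\<forall>q<N. \<forall>x. \<delta> q x < N" and L: "L = {w. foldl \<delta> 0 w \<in> F}"
    unfolding regular_def by blast
  \<comment> \<open>The period \<open>fact N\<close> also has to serve as the threshold, while the
    iterates are only known to be periodic from \<open>N\<close> on.\<close>
  have "N \<le> fact N" by (rule fact_ge_self)
  then have "periodic_set (fact N) {n. replicate n () \<in> L}"
    unfolding periodic_set_def L
    using funpow_eventually_periodic[of N "\<lambda>q. \<delta> q ()" 0] N by (auto simp: foldl_replicate)
  then show "\<exists>k>0. periodic_set k {n. replicate n () \<in> L}" by (meson fact_gt_zero)
next
  assume "\<exists>k>0. periodic_set k {n. replicate n () \<in> L}"
  then obtain k where k: "0 < k" "periodic_set k {n. replicate n () \<in> L}" by blast
  show "regular L"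
  proof (rule regularI_finite_automaton[of "{..<2*k}" 0 "\<lambda>q _. periodic_succ k q" _
        "{n. replicate n () \<in> L}"])
    fix w :: uword
    have "foldl (\<lambda>q _. periodic_succ k q) 0 w = periodic_rep k (length w)"
      by (subst unit_list_eq) (simp add: foldl_replicate periodic_rep_def)
    then show "w \<in> L \<longleftrightarrow> foldl (\<lambda>q _. periodic_succ k q) 0 w \<in> {n. replicate n () \<in> L}"
      using periodic_setD[OF k(2,1), of "length w"] unit_list_eq[of w] by simp
  qed (use k in \<open>auto simp: periodic_succ_def\<close>)
qed

section \<open>Convolutions of unary words and the automaton of a periodic relation\<close>

abbreviation both :: "unit option \<times> unit option" where "both \<equiv> (Some (), Some ())"
abbreviation left :: "unit option \<times> unit option" where "left \<equiv> (Some (), None)"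
abbreviation right :: "unit option \<times> unit option" where "right \<equiv> (None, Some ())"

lemma conv_unary_le:
  "conv (replicate m ()) (replicate (m + d) ()) = replicate m both @ replicate d right"
  by (rule nth_equalityI) (auto simp: conv_def nth_append)

lemma conv_unary_ge:
  "conv (replicate (m + d) ()) (replicate m ()) = replicate m both @ replicate d left"
  by (rule nth_equalityI) (auto simp: conv_def nth_append)

lemma conv_unary_cases:
  fixes u v :: uword
  obtains d where "length v = length u + d" "conv u v = replicate (length u) both @ replicate d right"
  | d where "length u = length v + d" "conv u v = replicate (length v) both @ replicate d left"
proof (cases "length u" "length v" rule: le_cases)
  case le
  then obtain d where d: "length v = length u + d" by (auto simp: le_iff_add)
  then show thesis
    using that(1) conv_unary_le[of "length u" d] unit_list_eq[of u] unit_list_eq[of v] by simp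
next
  case ge
  then obtain d where d: "length u = length v + d" by (auto simp: le_iff_add)
  then show thesis
    using that(2) conv_unary_ge[of "length v" d] unit_list_eq[of u] unit_list_eq[of v] by simp
qed

text \<open>Both lengths can be read off by counting the letters with a genuine first or second
  component. So passing to convolutions loses nothing.\<close>

lemma conv_unary_inj:
  fixes u v u' v' :: uword
  assumes "conv u v = conv u' v'"
  shows "u = u' \<and> v = v'"
proof -
  have l: "length (filter (\<lambda>x. fst x \<noteq> None) (conv u v)) = length u" for u v :: uword
    by (rule conv_unary_cases[where u = u and v = v]) auto
  have r: "length (filter (\<lambda>x. snd x \<noteq> None) (conv u v)) = length v" for u v :: uword
    by (rule conv_unary_cases[where u = u and v = v]) auto
  have "length u = length u'" "length v = length v'"
    using l[of u v] l[of u' v'] r[of u v] r[of u' v'] assms by simp_all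
  then show ?thesis using unit_list_eq[of u] unit_list_eq[of u'] unit_list_eq[of v] unit_list_eq[of v'] by simp
qed

definition length_rel :: "(uword \<times> uword) set \<Rightarrow> nat \<Rightarrow> nat \<Rightarrow> bool" where
  "length_rel S m n \<longleftrightarrow> (replicate m (), replicate n ()) \<in> S"

lemma length_relI: "(u, v) \<in> S \<longleftrightarrow> length_rel S (length u) (length v)"
  unfolding length_rel_def using unit_list_eq[of u] unit_list_eq[of v] by simp

text \<open>With the difference fixed, membership is a periodic condition on the shorter length, and
  with the shorter length fixed it is one on the difference. The two can therefore be replaced by
  lasso values independently.\<close>

lemma periodic_relD:
  assumes "periodic_rel k R" "0 < k"
  shows "R m (m + d) \<longleftrightarrow> R (periodic_rep k m) (periodic_rep k m + periodic_rep k d)"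
    and "R (m + d) m \<longleftrightarrow> R (periodic_rep k m + periodic_rep k d) (periodic_rep k m)"
proof -
  have "periodic_set k {m. R m (m + d)}" for d
    using assms unfolding periodic_set_def periodic_rel_def by (simp add: add.assoc add.commute[of k])
  then have 1: "R m (m + d) \<longleftrightarrow> R (periodic_rep k m) (periodic_rep k m + d)" for m d
    using periodic_setD[of k "{m. R m (m + d)}" m] assms by simp
  have "periodic_set k {d. R m (m + d)}" for m
    using assms unfolding periodic_set_def periodic_rel_def by (simp add: add.assoc[symmetric] add.commute[of k])
  then have 2: "R m (m + d) \<longleftrightarrow> R m (m + periodic_rep k d)" for m d
    using periodic_setD[of k "{d. R m (m + d)}" d] assms by simp
  show "R m (m + d) \<longleftrightarrow> R (periodic_rep k m) (periodic_rep k m + periodic_rep k d)" using 1 2 by metis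
  have "periodic_set k {m. R (m + d) m}" for d
    using assms unfolding periodic_set_def periodic_rel_def by (simp add: add.assoc add.commute[of k])
  then have 3: "R (m + d) m \<longleftrightarrow> R (periodic_rep k m + d) (periodic_rep k m)" for m d
    using periodic_setD[of k "{m. R (m + d) m}" m] assms by simp
  have "periodic_set k {d. R (m + d) m}" for m
    using assms unfolding periodic_set_def periodic_rel_def by (simp add: add.assoc[symmetric] add.commute[of k])
  then have 4: "R (m + d) m \<longleftrightarrow> R (m + periodic_rep k d) m" for m d
    using periodic_setD[of k "{d. R (m + d) m}" d] assms by simp
  show "R (m + d) m \<longleftrightarrow> R (periodic_rep k m + periodic_rep k d) (periodic_rep k m)" using 3 4 by metis
qed

datatype conv_mode = Both | Left | Right | Dead

text \<open>One lasso counter for the common part and one for the excess; the mode records which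
  word is longer. Letters in an impossible order lead to \<open>Dead\<close>, with counters reset so
  that the sink is a single state.\<close>

fun conv_step :: "nat \<Rightarrow> conv_mode \<times> nat \<times> nat \<Rightarrow> unit option \<times> unit option \<Rightarrow> conv_mode \<times> nat \<times> nat" where
  "conv_step k (Both, a, b) (Some _, Some _) = (Both, periodic_succ k a, b)"
| "conv_step k (Both, a, b) (Some _, None) = (Left, a, periodic_succ k b)"
| "conv_step k (Left, a, b) (Some _, None) = (Left, a, periodic_succ k b)"
| "conv_step k (Both, a, b) (None, Some _) = (Right, a, periodic_succ k b)"
| "conv_step k (Right, a, b) (None, Some _) = (Right, a, periodic_succ k b)"
| "conv_step k _ _ = (Dead, 0, 0)"

fun conv_accept :: "(nat \<Rightarrow> nat \<Rightarrow> bool) \<Rightarrow> conv_mode \<times> nat \<times> nat \<Rightarrow> bool" where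
  "conv_accept R (Both, a, b) \<longleftrightarrow> R a a"
| "conv_accept R (Left, a, b) \<longleftrightarrow> R (a + b) a"
| "conv_accept R (Right, a, b) \<longleftrightarrow> R a (a + b)"
| "conv_accept R (Dead, a, b) \<longleftrightarrow> False"

lemma conv_step_less:
  assumes "0 < k" "q \<in> UNIV \<times> {..<2 * k} \<times> {..<2 * k}"
  shows "conv_step k q x \<in> UNIV \<times> {..<2 * k} \<times> {..<2 * k}"
  using assms by (cases "(k, q, x)" rule: conv_step.cases) (auto simp: periodic_succ_def)

lemma conv_step_both: "foldl (conv_step k) (Both, 0, 0) (replicate m both) = (Both, periodic_rep k m, 0)"
proof (induction m)
  case (Suc m)
  have "replicate (Suc m) both = replicate m both @ [both]" by (simp add: replicate_append_same)
  then show ?case using Suc by (simp add: periodic_rep_Suc del: replicate_Suc)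
qed simp

text \<open>The excess is \<open>Suc d\<close> because \<open>Left\<close> is entered only with the
  first padded letter; without excess the run stays in \<open>Both\<close>.\<close>

lemma conv_step_left:
  "foldl (conv_step k) (Both, 0, 0) (replicate m both @ replicate (Suc d) left) =
     (Left, periodic_rep k m, periodic_rep k (Suc d))"
proof (induction d)
  case 0
  then show ?case by (simp add: conv_step_both periodic_rep_Suc)
next
  case (Suc d)
  have "replicate (Suc (Suc d)) left = replicate (Suc d) left @ [left]"
    by (simp add: replicate_append_same)
  then show ?case using Suc by (simp add: periodic_rep_Suc del: replicate_Suc)
qed

lemma conv_step_right:
  "foldl (conv_step k) (Both, 0, 0) (replicate m both @ replicate (Suc d) right) =
     (Right, periodic_rep k m, periodic_rep k (Suc d))"
proof (induction d)
  case 0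
  then show ?case by (simp add: conv_step_both periodic_rep_Suc)
next
  case (Suc d)
  have "replicate (Suc (Suc d)) right = replicate (Suc d) right @ [right]"
    by (simp add: replicate_append_same)
  then show ?case using Suc by (simp add: periodic_rep_Suc del: replicate_Suc)
qed

text \<open>Words that are not convolutions have fallen into the sink, so acceptance has to be
  checked on three explicit kinds of words only.\<close>

lemma conv_step_run_cases:
  "(\<exists>m. w = replicate m both) \<or> (\<exists>m d. w = replicate m both @ replicate (Suc d) left) \<or>
   (\<exists>m d. w = replicate m both @ replicate (Suc d) right) \<or>
   foldl (conv_step k) (Both, 0, 0) w = (Dead, 0, 0)"
proof (induction w rule: rev_induct)
  case Nil
  then show ?case by (metis replicate_0)
next
  case (snoc x w)
  have x: "x = both \<or> x = left \<or> x = right \<or> x = (None, None)" by (cases x) (metis option.exhaust old.unit.exhaust)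
  consider (a) m where "w = replicate m both" | (b) m d where "w = replicate m both @ replicate (Suc d) left"
    | (c) m d where "w = replicate m both @ replicate (Suc d) right"
    | (d) "foldl (conv_step k) (Both, 0, 0) w = (Dead, 0, 0)"
    using snoc by blast
  then show ?case
  proof cases
    case a
    have "x = both \<Longrightarrow> w @ [x] = replicate (Suc m) both"
      "x = left \<Longrightarrow> w @ [x] = replicate m both @ replicate (Suc 0) left"
      "x = right \<Longrightarrow> w @ [x] = replicate m both @ replicate (Suc 0) right"
      using a by (simp_all add: replicate_append_same)
    moreover have "x = (None, None) \<Longrightarrow> foldl (conv_step k) (Both, 0, 0) (w @ [x]) = (Dead, 0, 0)"
      using a by (simp add: conv_step_both)
    ultimately show ?thesis using x by blast
  next
    case b
    have "x = left \<Longrightarrow> w @ [x] = replicate m both @ replicate (Suc (Suc d)) left"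
      using b by (simp add: replicate_append_same)
    moreover have "x \<noteq> left \<Longrightarrow> foldl (conv_step k) (Both, 0, 0) (w @ [x]) = (Dead, 0, 0)"
      unfolding b foldl_append[of _ _ _ "[x]"] conv_step_left using x by auto
    ultimately show ?thesis by blast
  next
    case c
    have "x = right \<Longrightarrow> w @ [x] = replicate m both @ replicate (Suc (Suc d)) right"
      using c by (simp add: replicate_append_same)
    moreover have "x \<noteq> right \<Longrightarrow> foldl (conv_step k) (Both, 0, 0) (w @ [x]) = (Dead, 0, 0)"
      unfolding c foldl_append[of _ _ _ "[x]"] conv_step_right using x by auto
    ultimately show ?thesis by blast
  next
    case d
    then show ?thesis by simp
  qed
qed

text \<open>An automaton reads a convolution in two blocks, each iterating a single letter. Both
  iterations are periodic with period \<open>fact N\<close>, which yields the two clauses of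
  \<open>periodic_rel\<close>. The converse is the automaton with two lasso counters.\<close>

lemma regular_rel_unary_iff:
  "regular_rel S \<longleftrightarrow> (\<exists>k>0. periodic_rel k (length_rel S))"
proof -
  have mem: "conv u v \<in> (\<lambda>(u, v). conv u v) ` S \<longleftrightarrow> length_rel S (length u) (length v)" for u v
    using conv_unary_inj length_relI[of u v S] by fastforce
  have le: "replicate m both @ replicate d right \<in> (\<lambda>(u, v). conv u v) ` S \<longleftrightarrow> length_rel S m (m + d)" for m d
    using mem[of "replicate m ()" "replicate (m + d) ()"] unfolding conv_unary_le by simp
  have ge: "replicate m both @ replicate d left \<in> (\<lambda>(u, v). conv u v) ` S \<longleftrightarrow> length_rel S (m + d) m" for m d
    using mem[of "replicate (m + d) ()" "replicate m ()"] unfolding conv_unary_ge by simp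
  show ?thesis
  proof
    assume "regular_rel S"
    then obtain N F and \<delta> :: "nat \<Rightarrow> unit option \<times> unit option \<Rightarrow> nat"
      where N: "0 < N" "\<forall>q<N. \<forall>x. \<delta> q x < N" and S: "(\<lambda>(u, v). conv u v) ` S = {w. foldl \<delta> 0 w \<in> F}"
      unfolding regular_rel_def regular_def by blast
    let ?D = "\<lambda>x q. \<delta> q x"
    have lt: "(?D x ^^ n) q < N" if "q < N" for x n q using that N(2) by (induction n) (auto simp del: split_paired_All)
    have le': "length_rel S m (m + d) \<longleftrightarrow> (?D right ^^ d) ((?D both ^^ m) 0) \<in> F" for m d
      unfolding le[symmetric] S by (simp add: foldl_replicate)
    have ge': "length_rel S (m + d) m \<longleftrightarrow> (?D left ^^ d) ((?D both ^^ m) 0) \<in> F" for m d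
      unfolding ge[symmetric] S by (simp add: foldl_replicate)
    have per: "(?D x ^^ (n + fact N)) q = (?D x ^^ n) q" if "q < N" "n \<ge> fact N" for x n q
      using funpow_eventually_periodic[of N "?D x" q n] N that fact_ge_self[of N] by simp
    have "periodic_rel (fact N) (length_rel S)"
      unfolding periodic_rel_def
    proof (intro conjI allI impI)
      fix m d :: nat assume m: "fact N \<le> m"
      have a: "m + d + fact N = m + fact N + d" by simp
      show "length_rel S (m + fact N) (m + d + fact N) = length_rel S m (m + d)"
        "length_rel S (m + d + fact N) (m + fact N) = length_rel S (m + d) m"
        unfolding a le' ge' using per[of 0 m both] m N by simp_all
    next
      fix m d :: nat assume d: "fact N \<le> d"
      show "length_rel S m (m + d + fact N) = length_rel S m (m + d)"
        "length_rel S (m + d + fact N) m = length_rel S (m + d) m"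
        unfolding add.assoc le' ge' using per[of "(?D both ^^ m) 0" d] d N lt by simp_all
    qed
    then show "\<exists>k>0. periodic_rel k (length_rel S)" by (meson fact_gt_zero)
  next
    assume "\<exists>k>0. periodic_rel k (length_rel S)"
    then obtain k where k: "0 < k" "periodic_rel k (length_rel S)" by blast
    note D = periodic_relD[OF k(2,1)]
    show "regular_rel S"
      unfolding regular_rel_def
    proof (rule regularI_finite_automaton[of "UNIV \<times> {..<2 * k} \<times> {..<2 * k}" "(Both, 0, 0)" "conv_step k" _
          "{q. conv_accept (length_rel S) q}"])
      have "(UNIV :: conv_mode set) = {Both, Left, Right, Dead}"
        using conv_mode.exhaust by blast
      then have "finite (UNIV :: conv_mode set)" by (metis finite.emptyI finite_insert)
      then show "finite ((UNIV :: conv_mode set) \<times> {..<2 * k} \<times> {..<2 * k})" by blast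
      show "conv_step k q x \<in> UNIV \<times> {..<2 * k} \<times> {..<2 * k}"
        if "q \<in> UNIV \<times> {..<2 * k} \<times> {..<2 * k}" for q x
        using conv_step_less[OF k(1) that] .
      fix w
      show "w \<in> (\<lambda>(u, v). conv u v) ` S \<longleftrightarrow>
          foldl (conv_step k) (Both, 0, 0) w \<in> {q. conv_accept (length_rel S) q}"
      proof (cases "foldl (conv_step k) (Both, 0, 0) w = (Dead, 0, 0)")
        case True
        have "w \<notin> (\<lambda>(u, v). conv u v) ` S"
        proof
          assume "w \<in> (\<lambda>(u, v). conv u v) ` S"
          then obtain u v where w: "w = conv u v" by auto
          obtain m d where "w = replicate m both @ replicate d left \<or> w = replicate m both @ replicate d right"
            unfolding w using conv_unary_cases[where u = u and v = v] by metis
          then show False using True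
            by (cases d) (auto simp: conv_step_both conv_step_left conv_step_right simp del: replicate_Suc foldl_append)
        qed
        then show ?thesis using True by simp
      next
        case False
        then consider m where "w = replicate m both" | m d where "w = replicate m both @ replicate (Suc d) left"
          | m d where "w = replicate m both @ replicate (Suc d) right"
          using conv_step_run_cases[of w k] by blast
        then show ?thesis
        proof cases
          case (1 m)
          then show ?thesis using le[of m 0] D(1)[of m 0] by (simp add: conv_step_both)
        next
          case (2 m d)
          then show ?thesis using ge[of m "Suc d"] D(2)[of m "Suc d"]
            by (simp add: conv_step_left del: replicate_Suc foldl_append)
        next
          case (3 m d)
          then show ?thesis using le[of m "Suc d"] D(1)[of m "Suc d"]
            by (simp add: conv_step_right del: replicate_Suc foldl_append)
        qed
      qed
    qed (use k in auto)
  qed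
qed


section \<open>Presentations and periodic maps on the naturals\<close>

definition periodic_map :: "nat set \<Rightarrow> (nat \<Rightarrow> nat) \<Rightarrow> nat \<Rightarrow> nat \<Rightarrow> bool" where
  "periodic_map L g p M \<longleftrightarrow> 0 < p \<and> (\<forall>u\<in>L. g u \<in> L) \<and> (\<forall>u\<ge>M. u + p \<in> L \<longleftrightarrow> u \<in> L) \<and>
     (\<forall>u\<in>L. M \<le> u \<longrightarrow> (\<forall>j. g (u + j * p) = g u + j * p) \<or> (\<forall>j. g (u + j * p) = g u))"

text \<open>The period \<open>K\<close> is a multiple of \<open>p\<close> that exceeds every
  displacement along a shift column and every value on a constant one. Pairs in the graph of
  \<open>g\<close> whose difference is at least \<open>K\<close> then come from constant columns
  only, where enlarging the larger coordinate by \<open>K\<close> changes nothing.\<close>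

lemma presentable_if_periodic_map:
  assumes pm: "periodic_map L g p M" and \<phi>: "bij_betw \<phi> L X" and f: "\<And>u. u \<in> L \<Longrightarrow> f (\<phi> u) = \<phi> (g u)"
  shows "unary_FA_presentable X f"
proof -
  have p: "0 < p" and gL: "\<And>u. u \<in> L \<Longrightarrow> g u \<in> L"
    and Lp: "\<And>u. M \<le> u \<Longrightarrow> u + p \<in> L \<longleftrightarrow> u \<in> L"
    and SK: "\<And>u. u \<in> L \<Longrightarrow> M \<le> u \<Longrightarrow> (\<forall>j. g (u + j * p) = g u + j * p) \<or> (\<forall>j. g (u + j * p) = g u)"
    using pm unfolding periodic_map_def by auto
  have Lj: "u + j * p \<in> L \<longleftrightarrow> u \<in> L" if "M \<le> u" for u j
  proof (induction j)
    case (Suc j)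
    then show ?case using Lp[of "u + j * p"] that by (simp add: add_ac)
  qed simp
  \<comment> \<open>The sum dominates \<open>g\<close> below \<open>M + p\<close>, that is, on the
    irregular points and on the first period of every column.\<close>
  define c where "c = Suc (M + p + (\<Sum>u<M + p. g u))"
  define K where "K = c * p"
  have cK: "c \<le> K" using p by (simp add: K_def)
  have gK: "g u < K" if "u < M + p" for u
  proof -
    have "g u \<le> (\<Sum>u<M + p. g u)" using that by (intro member_le_sum) auto
    then show ?thesis using cK by (simp add: c_def)
  qed
  have K0: "0 < K" and KM: "M + p < K" using cK by (auto simp: c_def)
  have SK': "(g (u + K) = g u + K \<and> u < g u + K \<and> g u < u + K) \<or> (g (u + K) = g u \<and> g u < K)"
    if u: "u \<in> L" "M \<le> u" for u
  proof -
    define j where "j = (u - M) div p"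
    define u0 where "u0 = M + (u - M) mod p"
    have uu: "u = u0 + j * p" using u(2) by (simp add: u0_def j_def)
    have u0: "u0 \<ge> M" "u0 < M + p" using p by (simp_all add: u0_def)
    have "u0 \<in> L" using Lj[of u0 j] u u0 uu by simp
    from SK[OF this u0(1)] show ?thesis
    proof
      assume a: "\<forall>j. g (u0 + j * p) = g u0 + j * p"
      have "g u = g u0 + j * p" using a uu by simp
      moreover have "g (u0 + (j + c) * p) = g u0 + (j + c) * p" using a by blast
      then have "g (u + K) = g u0 + j * p + K" by (simp add: uu K_def algebra_simps)
      moreover have "u0 < K" "g u0 < K" using u0 KM gK by auto
      ultimately show ?thesis using uu by simp
    next
      assume a: "\<forall>j. g (u0 + j * p) = g u0"
      have "g u = g u0" using a uu by simp
      moreover have "g (u0 + (j + c) * p) = g u0" using a by blast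
      then have "g (u + K) = g u0" by (simp add: uu K_def algebra_simps)
      ultimately show ?thesis using gK u0 by simp
    qed
  qed
  have LK: "u + K \<in> L \<longleftrightarrow> u \<in> L" if "M \<le> u" for u using Lj[OF that, of c] by (simp add: K_def)
  define L' :: "uword set" where "L' = {w. length w \<in> L}"
  define \<phi>' :: "uword \<Rightarrow> _" where "\<phi>' w = \<phi> (length w)" for w
  let ?E = "{(u, v). u \<in> L' \<and> v \<in> L' \<and> \<phi>' u = \<phi>' v}"
  let ?F = "{(u, v). u \<in> L' \<and> v \<in> L' \<and> f (\<phi>' u) = \<phi>' v}"
  have inj: "\<phi> u = \<phi> v \<longleftrightarrow> u = v" if "u \<in> L" "v \<in> L" for u v
    using \<phi> that by (auto simp: bij_betw_def inj_on_def)
  have E: "length_rel ?E m n \<longleftrightarrow> m \<in> L \<and> n = m" for m n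
    unfolding length_rel_def by (auto simp: L'_def \<phi>'_def inj)
  have F: "length_rel ?F m n \<longleftrightarrow> m \<in> L \<and> n = g m" for m n
    unfolding length_rel_def using gL by (auto simp: L'_def \<phi>'_def inj f)
  have "periodic_set K {n. replicate n () \<in> L'}"
    unfolding periodic_set_def using LK KM by (simp add: L'_def)
  then have "regular L'" unfolding regular_unary_iff using K0 by blast
  moreover have "periodic_rel K (length_rel ?E)"
    unfolding periodic_rel_def E using LK KM K0 by auto
  then have "regular_rel ?E" unfolding regular_rel_unary_iff using K0 by blast
  moreover have "periodic_rel K (length_rel ?F)"
    unfolding periodic_rel_def F
  proof (intro conjI allI impI)
    fix m d assume m: "K \<le> m"
    then have M: "M \<le> m" "M \<le> m + d" using KM by auto
    show "(m + K \<in> L \<and> m + d + K = g (m + K)) = (m \<in> L \<and> m + d = g m)"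
      using SK'[of m] LK[of m] M m by auto
    have "m + d \<in> L \<Longrightarrow> m + K = g (m + d + K) \<longleftrightarrow> m = g (m + d)"
      using SK'[of "m + d"] M m by auto
    then show "(m + d + K \<in> L \<and> m + K = g (m + d + K)) = (m + d \<in> L \<and> m = g (m + d))"
      using LK[OF M(2)] by blast
  next
    fix m d assume d: "K \<le> d"
    have "g m < m + K" if "m \<in> L"
      using SK'[of m] gK[of m] that by (cases "M \<le> m") auto
    then show "(m \<in> L \<and> m + d + K = g m) = (m \<in> L \<and> m + d = g m)"
      using d K0 by auto
    have M: "M \<le> m + d" using d KM by auto
    have "m + d \<in> L \<Longrightarrow> m = g (m + d + K) \<longleftrightarrow> m = g (m + d)"
      using SK'[of "m + d"] M d by auto
    then show "(m + d + K \<in> L \<and> m = g (m + d + K)) = (m + d \<in> L \<and> m = g (m + d))"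
      using LK[OF M] by blast
  qed
  then have "regular_rel ?F" unfolding regular_rel_unary_iff using K0 by blast
  moreover have "\<phi>' ` L' = X"
  proof -
    have "\<phi> ` L = \<phi>' ` L'"
      by (auto simp: L'_def \<phi>'_def image_iff) (metis length_replicate)
    then show ?thesis using \<phi> by (simp add: bij_betw_def)
  qed
  ultimately show ?thesis unfolding unary_FA_presentable_def by blast
qed

text \<open>Words that are not the shortest representative of their element can be discarded, because
  the set of shortest representatives is again periodic.\<close>
lemma presentableE:
  assumes "unary_FA_presentable X f" and fX: "\<And>x. x \<in> X \<Longrightarrow> f x \<in> X"
  obtains L g q \<phi> where "0 < q" "bij_betw \<phi> L X" "\<And>u. u \<in> L \<Longrightarrow> g u \<in> L \<and> f (\<phi> u) = \<phi> (g u)"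
    "periodic_set q L" "periodic_rel q (\<lambda>m n. m \<in> L \<and> n = g m)"
proof -
  obtain L0 :: "uword set" and \<phi>0 where L0: "regular L0" and \<phi>0: "\<phi>0 ` L0 = X"
    and E0: "regular_rel {(u, v). u \<in> L0 \<and> v \<in> L0 \<and> \<phi>0 u = \<phi>0 v}" (is "regular_rel ?E")
    and F0: "regular_rel {(u, v). u \<in> L0 \<and> v \<in> L0 \<and> f (\<phi>0 u) = \<phi>0 v}" (is "regular_rel ?F")
    using assms unfolding unary_FA_presentable_def by blast
  define A where "A = {n. replicate n () \<in> L0}"
  define \<psi> where "\<psi> n = \<phi>0 (replicate n ())" for n
  obtain k1 where k1: "0 < k1" "periodic_set k1 A" using L0 unfolding regular_unary_iff A_def by blast
  obtain k2 where k2: "0 < k2" "periodic_rel k2 (length_rel ?E)"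
    using E0 unfolding regular_rel_unary_iff by blast
  obtain k3 where k3: "0 < k3" "periodic_rel k3 (length_rel ?F)"
    using F0 unfolding regular_rel_unary_iff by blast
  \<comment> \<open>One common period for the set of words, for equality and for the map.\<close>
  define k where "k = k1 * (k2 * k3)"
  have k: "0 < k" using k1 k2 k3 by (simp add: k_def)
  have pA: "periodic_set k A" using periodic_set_mult[OF k1(2), of "k2 * k3"] k2 k3 by (simp add: k_def)
  define E where "E m n \<longleftrightarrow> m \<in> A \<and> n \<in> A \<and> \<psi> m = \<psi> n" for m n
  define F where "F m n \<longleftrightarrow> m \<in> A \<and> n \<in> A \<and> f (\<psi> m) = \<psi> n" for m n
  have "length_rel ?E = E" by (auto simp: fun_eq_iff length_rel_def E_def A_def \<psi>_def)
  then have pE: "periodic_rel k E"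
    using periodic_rel_mult[OF k2(2), of "k1 * k3"] k1 k3 by (simp add: k_def algebra_simps)
  have "length_rel ?F = F" by (auto simp: fun_eq_iff length_rel_def F_def A_def \<psi>_def)
  then have pF: "periodic_rel k F"
    using periodic_rel_mult[OF k3(2), of "k1 * k2"] k1 k2 by (simp add: k_def algebra_simps)
  have \<psi>: "\<psi> ` A = X"
  proof -
    have "\<phi>0 w \<in> \<psi> ` A" if "w \<in> L0" for w
      using that unit_list_eq[of w] unfolding A_def \<psi>_def by (metis (mono_tags, lifting) image_eqI mem_Collect_eq)
    then show ?thesis using \<phi>0 by (auto simp: A_def \<psi>_def)
  qed
  define L where "L = {n \<in> A. \<not> (\<exists>m<n. E m n)}"
  have bij: "bij_betw \<psi> L X"
    unfolding bij_betw_def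
  proof
    show "inj_on \<psi> L" unfolding inj_on_def L_def E_def by (metis (mono_tags, lifting) linorder_neqE_nat mem_Collect_eq)
    have least: "\<exists>m\<in>L. \<psi> m = \<psi> n" if "n \<in> A" for n
    proof
      let ?m = "LEAST m. m \<in> A \<and> \<psi> m = \<psi> n"
      have m: "?m \<in> A \<and> \<psi> ?m = \<psi> n" by (rule LeastI[of _ n]) (use that in simp)
      then show "\<psi> ?m = \<psi> n" by blast
      have "\<not> E m ?m" if "m < ?m" for m
        using not_less_Least[OF that] m unfolding E_def by metis
      then show "?m \<in> L" using m unfolding L_def by blast
    qed
    have "\<psi> ` A \<subseteq> \<psi> ` L"
    proof (rule image_subsetI)
      fix n assume "n \<in> A"
      then obtain m where "m \<in> L" "\<psi> m = \<psi> n" using least by blast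
      then show "\<psi> n \<in> \<psi> ` L" by (metis imageI)
    qed
    moreover have "\<psi> ` L \<subseteq> \<psi> ` A" by (auto simp: L_def)
    ultimately show "\<psi> ` L = X" using \<psi> by blast
  qed
  \<comment> \<open>A smaller word for the same element is either large enough to be translated
    together with \<open>n\<close>, or so far from \<open>n\<close> that \<open>n\<close> can be
    translated alone. On the way down, a word of length at least \<open>2 * k\<close> can be lowered
    by \<open>k\<close>, and a shorter one is at distance at least \<open>k\<close> from
    \<open>n\<close>; this is where \<open>3 * k\<close> comes from.\<close>
  have shift: "(\<exists>m<n + k. E m (n + k)) \<longleftrightarrow> (\<exists>m<n. E m n)" if n: "n \<ge> 3 * k" for n
  proof
    assume "\<exists>m<n. E m n"
    then obtain m where m: "m < n" "E m n" by blast
    define d where "d = n - m"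
    have nd: "n = m + d" using m by (simp add: d_def)
    show "\<exists>m<n + k. E m (n + k)"
    proof (cases "k \<le> m")
      case True
      then have "E (m + k) (n + k)" using pE m unfolding periodic_rel_def nd by blast
      then show ?thesis using m by (intro exI[of _ "m + k"]) auto
    next
      case False
      then have "k \<le> d" using n nd k by linarith
      then have "E m (n + k)" using pE m unfolding periodic_rel_def nd by blast
      then show ?thesis using m by (intro exI[of _ m]) auto
    qed
  next
    assume "\<exists>m<n + k. E m (n + k)"
    then obtain m where m: "m < n + k" "E m (n + k)" by blast
    show "\<exists>m<n. E m n"
    proof (cases "2 * k \<le> m")
      case True
      define m' where "m' = m - k"
      define d where "d = n - m'"
      have "m = m' + k" "k \<le> m'" "n = m' + d" "m' < n" using True k m by (auto simp: m'_def d_def)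
      moreover from this have "E m' n" using pE m unfolding periodic_rel_def by metis
      ultimately show ?thesis by blast
    next
      case False
      define d where "d = n - m"
      have "k \<le> d" "n = m + d" using False n k by (auto simp: d_def)
      moreover from this have "E m n" using pE m unfolding periodic_rel_def by metis
      ultimately show ?thesis using k by (intro exI[of _ m]) auto
    qed
  qed
  \<comment> \<open>A multiple of \<open>k\<close> that lies above the threshold
    \<open>3 * k\<close> of \<open>shift\<close>.\<close>
  define q where "q = k * 4"
  have q: "0 < q" using k by (simp add: q_def)
  have Lk: "n + k \<in> L \<longleftrightarrow> n \<in> L" if "n \<ge> 3 * k" for n
  proof -
    have "n + k \<in> A \<longleftrightarrow> n \<in> A" using pA that by (simp add: periodic_set_def)
    then show ?thesis unfolding L_def using shift[OF that] by blast
  qed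
  have pL: "periodic_set q L"
    unfolding periodic_set_def
  proof (intro allI impI)
    fix n assume n: "q \<le> n"
    then have "n + k \<in> L \<longleftrightarrow> n \<in> L" "n + k + k \<in> L \<longleftrightarrow> n + k \<in> L"
      "n + k + k + k \<in> L \<longleftrightarrow> n + k + k \<in> L" "n + k + k + k + k \<in> L \<longleftrightarrow> n + k + k + k \<in> L"
      by (intro Lk; simp add: q_def)+
    moreover have "n + q = n + k + k + k + k" by (simp add: q_def)
    ultimately show "n + q \<in> L \<longleftrightarrow> n \<in> L" by presburger
  qed
  have pFq: "periodic_rel q F" unfolding q_def by (rule periodic_rel_mult[OF pF]) simp
  define g where "g u = inv_into L \<psi> (f (\<psi> u))" for u
  have LA: "L \<subseteq> A" by (auto simp: L_def)
  have fpsi: "f (\<psi> u) \<in> \<psi> ` L" if "u \<in> L" for u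
    using that bij fX by (auto simp: bij_betw_def)
  have g: "g u \<in> L \<and> f (\<psi> u) = \<psi> (g u)" if "u \<in> L" for u
    using fpsi[OF that] unfolding g_def by (simp add: inv_into_into f_inv_into_f)
  have R: "(m \<in> L \<and> n = g m) \<longleftrightarrow> F m n \<and> m \<in> L \<and> n \<in> L" for m n
  proof
    show "F m n \<and> m \<in> L \<and> n \<in> L" if "m \<in> L \<and> n = g m"
      using that g[of m] LA unfolding F_def by blast
    assume a: "F m n \<and> m \<in> L \<and> n \<in> L"
    then have "\<psi> n = \<psi> (g m)" "g m \<in> L" using g[of m] unfolding F_def by simp_all
    then have "n = g m" using a bij inj_onD[of \<psi> L n "g m"] unfolding bij_betw_def by blast
    then show "m \<in> L \<and> n = g m" using a by blast
  qed
  have "periodic_rel q (\<lambda>m n. m \<in> L \<and> n = g m)"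
    unfolding periodic_rel_def R
  proof (intro conjI allI impI)
    fix m d assume m: "q \<le> m"
    have L: "m + q \<in> L \<longleftrightarrow> m \<in> L" "m + d + q \<in> L \<longleftrightarrow> m + d \<in> L"
      using pL m unfolding periodic_set_def by auto
    show "(F (m + q) (m + d + q) \<and> m + q \<in> L \<and> m + d + q \<in> L) = (F m (m + d) \<and> m \<in> L \<and> m + d \<in> L)"
      "(F (m + d + q) (m + q) \<and> m + d + q \<in> L \<and> m + q \<in> L) = (F (m + d) m \<and> m + d \<in> L \<and> m \<in> L)"
      using pFq m unfolding periodic_rel_def L by blast+
  next
    fix m d assume d: "q \<le> d"
    have L: "m + d + q \<in> L \<longleftrightarrow> m + d \<in> L"
      using pL d unfolding periodic_set_def by auto
    show "(F m (m + d + q) \<and> m \<in> L \<and> m + d + q \<in> L) = (F m (m + d) \<and> m \<in> L \<and> m + d \<in> L)"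
      "(F (m + d + q) m \<and> m + d + q \<in> L \<and> m \<in> L) = (F (m + d) m \<and> m + d \<in> L \<and> m \<in> L)"
      using pFq d unfolding periodic_rel_def L by blast+
  qed
  with that[of q \<psi> L g] q bij g pL show thesis by blast
qed

text \<open>A function admits no long edges between large points. If \<open>u\<close> and
  \<open>g u\<close> differ by at least \<open>q\<close>, the larger of them may be raised by
  \<open>q\<close> alone. If \<open>g u\<close> is the larger, this gives \<open>u\<close> a second
  value. If \<open>u\<close> is the larger, it gives \<open>g (u + q) = g u\<close>, which
  contradicts the simultaneous shift as soon as \<open>g u\<close> is at least \<open>q\<close>. So
  a long edge leads below \<open>q\<close>, and there the column is constant.\<close>

lemma periodic_graph_step:
  assumes pL: "periodic_set q L" and pR: "periodic_rel q (\<lambda>m n. m \<in> L \<and> n = g m)" and q: "0 < q"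
    and u: "u \<in> L" "2 * q \<le> u"
  shows "(q \<le> g u \<and> u < g u + q \<and> g u < u + q \<and> g (u + q) = g u + q) \<or> (g u < q \<and> g (u + q) = g u)"
proof -
  note R1 = pR[unfolded periodic_rel_def, THEN conjunct1, rule_format]
  note R2 = pR[unfolded periodic_rel_def, THEN conjunct2, rule_format]
  have uL: "u + q \<in> L" using pL u unfolding periodic_set_def by simp
  consider (up) d where "g u = u + d" | (down) d where "u = g u + d"
    by (meson le_Suc_ex nat_le_linear)
  then show ?thesis
  proof cases
    case up
    have a: "g (u + q) = g u + q" using R1[of u d] up u by auto
    moreover have "d < q"
    proof (rule ccontr)
      assume "\<not> d < q"
      then have "u + d + q = g u" using R2[of d u] up u by auto
      then show False using up q by simp
    qed
    ultimately show ?thesis using up u q by auto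
  next
    case down
    show ?thesis
    proof (cases "q \<le> g u")
      case True
      have a: "g (u + q) = g u + q" using R1[of "g u" d] True down u by auto
      moreover have "d < q"
      proof (rule ccontr)
        assume "\<not> d < q"
        then have "g u = g (u + q)" using R2[of d "g u"] down u by auto
        then show False using a q by simp
      qed
      ultimately show ?thesis using True down q by auto
    next
      case False
      then have "q \<le> d" using down u by linarith
      then have "g u = g (u + q)" using R2[of d "g u"] down u by auto
      then show ?thesis using False by auto
    qed
  qed
qed

lemma periodic_graph_columns:
  assumes pL: "periodic_set q L" and pR: "periodic_rel q (\<lambda>m n. m \<in> L \<and> n = g m)" and q: "0 < q"
    and u: "u \<in> L" "2 * q \<le> u"
  shows "((\<forall>j. g (u + j * q) = g u + j * q) \<and> u < g u + q \<and> g u < u + q) \<or>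
         ((\<forall>j. g (u + j * q) = g u) \<and> g u < q)"
proof -
  note step = periodic_graph_step[OF pL pR q]
  have uL: "u + j * q \<in> L" for j
  proof (induction j)
    case (Suc j)
    then show ?case using pL u unfolding periodic_set_def by (auto simp: add_ac dest: spec[of _ "u + j * q"])
  qed (use u in simp)
  show ?thesis
  proof (cases "q \<le> g u")
    case True
    have "g (u + j * q) = g u + j * q" for j
    proof (induction j)
      case (Suc j)
      then show ?case using step[OF uL[of j]] u True by (auto simp: add_ac)
    qed simp
    then show ?thesis using step[OF u] True by auto
  next
    case False
    have "g (u + j * q) = g u" for j
    proof (induction j)
      case (Suc j)
      then show ?case using step[OF uL[of j]] u False by (auto simp: add_ac)
    qed simp
    then show ?thesis using False by auto
  qed
qed

section \<open>The graphs described are presentable\<close>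

text \<open>A digraph whose vertices are the finite set \<open>A\<close> and the infinite columns \<open>e (c, 0), e (c, 1), \<dots>\<close>,
  where from index 1 on all edges leaving a column follow the same pattern.\<close>
definition columnar :: "'v set \<Rightarrow> 'c set \<Rightarrow> ('c \<times> nat \<Rightarrow> 'v) \<Rightarrow> 'v digraph \<Rightarrow> bool" where
  "columnar A C e G \<longleftrightarrow> finite A \<and> finite C \<and> inj_on e (C \<times> UNIV) \<and> A \<inter> e ` (C \<times> UNIV) = {} \<and>
     fst G = A \<union> e ` (C \<times> UNIV) \<and>
     (\<forall>c\<in>C. (\<exists>a\<in>fst G. \<forall>j. (e (c, Suc j), a) \<in> snd G) \<or>
             (\<exists>c'\<in>C. \<exists>k. \<forall>j. (e (c, Suc j), e (c', j + k)) \<in> snd G))"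

text \<open>The finite part is numbered first and the columns are then interleaved, so that one step
  along any column adds the same \<open>p\<close> to the number. The value of the map on a column is
  forced by the edges listed in \<open>columnar\<close>, since an isomorphic copy of the graph of a
  map has only one edge leaving each vertex.\<close>

lemma presentable_if_columnar:
  assumes col: "columnar A C e G" and iso: "graph_iso (map_graph X f) G" and fX: "\<And>x. x \<in> X \<Longrightarrow> f x \<in> X"
  shows "unary_FA_presentable X f"
proof -
  obtain h where h: "bij_betw h X (fst G)"
    and hE: "\<And>x y. x \<in> X \<Longrightarrow> y \<in> X \<Longrightarrow> y = f x \<longleftrightarrow> (h x, h y) \<in> snd G"
    using iso unfolding graph_iso_def map_graph_def by auto
  have fin: "finite A" "finite C" and inje: "inj_on e (C \<times> UNIV)" and disj: "A \<inter> e ` (C \<times> UNIV) = {}"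
    and V: "fst G = A \<union> e ` (C \<times> UNIV)"
    using col unfolding columnar_def by auto
  have cols: "(\<exists>a\<in>fst G. \<forall>j. (e (c, Suc j), a) \<in> snd G) \<or>
             (\<exists>c'\<in>C. \<exists>k. \<forall>j. (e (c, Suc j), e (c', j + k)) \<in> snd G)" if "c \<in> C" for c
    using col that unfolding columnar_def by blast
  define k where "k = inv_into X h"
  have k: "k v \<in> X" "h (k v) = v" if "v \<in> fst G" for v
    using h that unfolding k_def bij_betw_def by (auto intro: inv_into_into f_inv_into_f)
  have kh: "k (h x) = x" if "x \<in> X" for x using h that unfolding k_def by (simp add: bij_betw_inv_into_left)
  have hX: "h x \<in> fst G" if "x \<in> X" for x using h that by (auto simp: bij_betw_def)
  define F where "F v = h (f (k v))" for v
  have FV: "F v \<in> fst G" if "v \<in> fst G" for v using that k fX hX by (simp add: F_def)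
  have edge: "w = F v" if "(v, w) \<in> snd G" "v \<in> fst G" "w \<in> fst G" for v w
    using hE[of "k v" "k w"] that k by (simp add: F_def) metis
  have eV: "e (c, j) \<in> fst G" if "c \<in> C" for c j using that V by auto
  have colF: "(\<exists>a\<in>fst G. \<forall>j. F (e (c, Suc j)) = a) \<or> (\<exists>c'\<in>C. \<exists>k. \<forall>j. F (e (c, Suc j)) = e (c', j + k))"
    if "c \<in> C" for c
    using cols[OF that] edge eV that by metis
  obtain \<alpha> where \<alpha>: "bij_betw \<alpha> A {0..<card A}" using ex_bij_betw_finite_nat[OF fin(1)] by blast
  obtain \<gamma> where \<gamma>: "bij_betw \<gamma> C {0..<card C}" using ex_bij_betw_finite_nat[OF fin(2)] by blast
  \<comment> \<open>The successor keeps the period positive when there is no column at all.\<close>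
  define p where "p = Suc (card C)"
  have \<alpha>l: "\<alpha> a < card A" if "a \<in> A" for a using \<alpha> that by (auto simp: bij_betw_def)
  have \<gamma>l: "\<gamma> c < p" if "c \<in> C" for c
  proof -
    have "\<gamma> c \<in> {0..<card C}" using \<gamma> that by (rule bij_betwE[rule_format])
    then show ?thesis by (simp add: p_def)
  qed
  define enc where "enc v = (if v \<in> A then \<alpha> v else
      (let x = inv_into (C \<times> UNIV) e v in card A + snd x * p + \<gamma> (fst x)))" for v
  have encA: "enc a = \<alpha> a" if "a \<in> A" for a using that by (simp add: enc_def)
  have encC: "enc (e (c, j)) = card A + j * p + \<gamma> c" if "c \<in> C" for c j
  proof -
    have "e (c, j) \<notin> A" using disj that by blast
    moreover have "inv_into (C \<times> UNIV) e (e (c, j)) = (c, j)" using inje that by simp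
    ultimately show ?thesis by (simp add: enc_def)
  qed
  have Vcases: "v \<in> A \<or> (\<exists>c\<in>C. \<exists>j. v = e (c, j))" if "v \<in> fst G" for v using that V by auto
  have inj: "inj_on enc (fst G)"
  proof (rule inj_onI)
    fix x y assume xy: "x \<in> fst G" "y \<in> fst G" "enc x = enc y"
    consider "x \<in> A" "y \<in> A" | c j where "x \<in> A" "y = e (c, j)" "c \<in> C"
      | c j where "y \<in> A" "x = e (c, j)" "c \<in> C"
      | c j c' j' where "x = e (c, j)" "c \<in> C" "y = e (c', j')" "c' \<in> C"
      using Vcases[OF xy(1)] Vcases[OF xy(2)] by blast
    then show "x = y"
    proof cases
      case 1
      then show ?thesis using xy \<alpha> encA by (auto simp: bij_betw_def inj_on_def)
    next
      case 2
      then show ?thesis using xy(3) encA encC \<alpha>l[of x] by simp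
    next
      case 3
      then show ?thesis using xy(3) encA encC \<alpha>l[of y] by simp
    next
      case (4 c j c' j')
      then have eq: "j * p + \<gamma> c = j' * p + \<gamma> c'" using xy(3) encC by simp
      have "(j * p + \<gamma> c) div p = j" "(j' * p + \<gamma> c') div p = j'" "(j * p + \<gamma> c) mod p = \<gamma> c"
        "(j' * p + \<gamma> c') mod p = \<gamma> c'"
        using \<gamma>l[OF 4(2)] \<gamma>l[OF 4(4)] by simp_all
      then have "j = j'" "\<gamma> c = \<gamma> c'" using eq by metis+
      then show ?thesis using \<gamma> 4 by (auto simp: bij_betw_def inj_on_def)
    qed
  qed
  define L where "L = enc ` fst G"
  define dec where "dec = inv_into (fst G) enc"
  have dec: "dec (enc v) = v" if "v \<in> fst G" for v using inj that by (simp add: dec_def)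
  have decL: "dec u \<in> fst G" "enc (dec u) = u" if "u \<in> L" for u
    using that dec by (auto simp: L_def)
  define g where "g u = enc (F (dec u))" for u
  have big: "\<exists>c\<in>C. \<exists>j. u = enc (e (c, j))" if u: "u \<in> L" "card A \<le> u" for u
  proof -
    obtain v where v: "v \<in> fst G" "u = enc v" using u by (auto simp: L_def)
    have "v \<notin> A" using encA[of v] \<alpha>l[of v] v u by auto
    then show ?thesis using Vcases[OF v(1)] v(2) by blast
  qed
  \<comment> \<open>Index 0 has to be passed as well, because the pattern of a column is prescribed
    only from index 1 on. This costs one more period in the threshold.\<close>
  have big': "\<exists>c\<in>C. \<exists>j. u = enc (e (c, Suc j))" if u: "u \<in> L" "card A + p \<le> u" for u
  proof -
    obtain c j where c: "c \<in> C" "u = enc (e (c, j))" using big[of u] u by auto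
    then have "j \<noteq> 0" using u encC[OF c(1), of j] \<gamma>l[OF c(1)] by (intro notI) simp
    then show ?thesis using c by (metis not0_implies_Suc)
  qed
  have encp: "enc (e (c, j)) + i * p = enc (e (c, j + i))" if "c \<in> C" for c j i
    using encC[OF that] by (simp add: algebra_simps)
  have "periodic_map L g p (card A + p)"
    unfolding periodic_map_def
  proof (intro conjI ballI allI impI)
    show "0 < p" by (simp add: p_def)
    show "g u \<in> L" if "u \<in> L" for u
      unfolding g_def L_def using FV decL(1)[OF that] by simp
    fix u assume u: "card A + p \<le> u"
    show "u + p \<in> L \<longleftrightarrow> u \<in> L"
    proof
      assume "u \<in> L"
      then obtain c j where c: "c \<in> C" "u = enc (e (c, j))" using big'[of u] u by blast
      then have "u + p = enc (e (c, Suc j))" using encp[of c j 1] by simp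
      then show "u + p \<in> L" using c eV by (simp add: L_def)
    next
      assume "u + p \<in> L"
      then obtain c j where c: "c \<in> C" "u + p = enc (e (c, Suc j))" using big'[of "u + p"] u by auto
      then have "u = enc (e (c, j))" using encp[of c j 1] by simp
      then show "u \<in> L" using c eV by (simp add: L_def)
    qed
  next
    fix u assume u: "u \<in> L" "card A + p \<le> u"
    then obtain c j where c: "c \<in> C" "u = enc (e (c, Suc j))" using big' by blast
    have g: "g (u + i * p) = enc (F (e (c, Suc (j + i))))" for i
      unfolding g_def c(2) encp[OF c(1)] using dec eV c(1) by simp
    from colF[OF c(1)] consider a where "\<forall>j. F (e (c, Suc j)) = a"
      | c' k where "c' \<in> C" "\<forall>j. F (e (c, Suc j)) = e (c', j + k)" by blast
    then show "(\<forall>j. g (u + j * p) = g u + j * p) \<or> (\<forall>j. g (u + j * p) = g u)"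
    proof cases
      case 1
      then show ?thesis using g g[of 0] by simp
    next
      case (2 c' k)
      have "g (u + i * p) = g u + i * p" for i
        using g[of i] g[of 0] 2 encp[of c' "j + k" i] by (simp add: algebra_simps)
      then show ?thesis by blast
    qed
  qed
  moreover have "bij_betw (\<lambda>u. k (dec u)) L X"
  proof (rule bij_betw_byWitness[where f' = "\<lambda>x. enc (h x)"])
    show "\<forall>u\<in>L. enc (h (k (dec u))) = u" using decL k by simp
    show "\<forall>x\<in>X. k (dec (enc (h x))) = x" using hX dec kh by simp
    show "(\<lambda>u. k (dec u)) ` L \<subseteq> X" using decL k by auto
    show "(\<lambda>x. enc (h x)) ` X \<subseteq> L" using hX by (auto simp: L_def)
  qed
  moreover have "f (k (dec u)) = k (dec (g u))" if "u \<in> L" for u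
  proof -
    have "dec u \<in> fst G" using decL[OF that] by simp
    then show ?thesis unfolding g_def using dec FV fX k kh by (simp add: F_def)
  qed
  ultimately show ?thesis by (rule presentable_if_periodic_map)
qed

section \<open>Columns of repeated templates and of attachments\<close>

lemma srep_simps:
  "v \<noteq> t0 \<Longrightarrow> srep t0 t1 (j, v) = (j, v)"
  "srep t0 t1 (0, t0) = (0, t0)"
  "srep t0 t0 (j, t0) = (0, t0)"
  "t0 \<noteq> t1 \<Longrightarrow> srep t0 t1 (Suc j, t0) = (j, t1)"
  by (auto simp: srep_def)

lemma S_graph_vertices:
  assumes "t0 \<in> T" "t1 \<in> T"
  shows "fst (S_graph T \<eta> t0 t1) = insert (0, t0) {(j, v) | j v. v \<in> T - {t0}}"
proof
  show "fst (S_graph T \<eta> t0 t1) \<subseteq> insert (0, t0) {(j, v) | j v. v \<in> T - {t0}}"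
    using assms by (auto simp: S_graph_def srep_def)
  have "(0, t0) = srep t0 t1 (0, t0)" by (simp add: srep_simps)
  moreover have "(j, v) = srep t0 t1 (j, v)" if "v \<noteq> t0" for j v using that by (simp add: srep_simps)
  ultimately show "insert (0, t0) {(j, v) | j v. v \<in> T - {t0}} \<subseteq> fst (S_graph T \<eta> t0 t1)"
    unfolding S_graph_def using assms by fastforce
qed

text \<open>The edge comes from a template edge at \<open>v\<close> itself or, if
  \<open>v = t1\<close>, at the \<open>t0\<close> of the next copy; the offset
  \<open>\<epsilon>\<close> is 0 or 1 accordingly. The same template edge in the other copies gives
  the whole column. An edge into \<open>t0\<close> ends at \<open>t1\<close> of the preceding copy,
  which is why the sources start at \<open>Suc j\<close>.\<close>

lemma S_graph_column:
  assumes tem: "template T \<eta> t0 t1" and v: "v \<noteq> t0" and e: "((i, v), y) \<in> snd (S_graph T \<eta> t0 t1)"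
  shows "(\<forall>j. ((Suc j, v), (0, t0)) \<in> snd (S_graph T \<eta> t0 t1)) \<or>
         (\<exists>v'\<in>T - {t0}. \<exists>k. \<forall>j. ((Suc j, v), (j + k, v')) \<in> snd (S_graph T \<eta> t0 t1))"
proof -
  let ?E = "snd (S_graph T \<eta> t0 t1)"
  have T: "t1 \<in> T" "\<eta> \<subseteq> T \<times> T" using tem unfolding template_def dtree_def by auto
  have E: "(srep t0 t1 (j, u), srep t0 t1 (j, w)) \<in> ?E" if "(u, w) \<in> \<eta>" for j u w
    using that unfolding S_graph_def by auto
  obtain j u w where uw: "(u, w) \<in> \<eta>" "(i, v) = srep t0 t1 (j, u)" using e unfolding S_graph_def by auto
  have "\<exists>\<epsilon>. \<forall>j. (j, v) = srep t0 t1 (j + \<epsilon>, u)"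
  proof (cases "u = t0")
    case True
    then have "t0 \<noteq> t1" "v = t1" using uw(2) v by (auto simp: srep_def split: if_splits)
    then show ?thesis using True by (intro exI[of _ 1]) (simp add: srep_simps)
  next
    case False
    then have "v = u" using uw(2) by (simp add: srep_simps)
    then show ?thesis using False by (intro exI[of _ 0]) (simp add: srep_simps)
  qed
  then obtain \<epsilon> where "\<And>j. (j, v) = srep t0 t1 (j + \<epsilon>, u)" by blast
  then have edge: "((j, v), srep t0 t1 (j + \<epsilon>, w)) \<in> ?E" for j using E[OF uw(1), of "j + \<epsilon>"] by metis
  consider "w = t0" "t0 = t1" | "w = t0" "t0 \<noteq> t1" | "w \<noteq> t0" by blast
  then show ?thesis
  proof cases
    case 1
    then have "\<forall>j. ((Suc j, v), (0, t0)) \<in> ?E" using edge srep_simps(3) by metis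
    then show ?thesis by blast
  next
    case 2
    have "((Suc j, v), (j + \<epsilon>, t1)) \<in> ?E" for j using edge[of "Suc j"] 2 by (simp add: srep_simps)
    then show ?thesis using 2 T by blast
  next
    case 3
    have "((Suc j, v), (j + Suc \<epsilon>, w)) \<in> ?E" for j using edge[of "Suc j"] 3 by (simp add: srep_simps)
    then show ?thesis using 3 T uw by blast
  qed
qed

text \<open>A vertex other than \<open>c0 i\<close> is identified with nothing in the base, so an
  edge leaving it comes from its own component and recurs in all copies. Hence \<open>out\<close>
  asks for an edge in copy 1 only.\<close>

lemma attach_all_columnar:
  assumes B: "columnar A C e B" and I: "finite I"
    and tem: "\<And>i. i \<in> I \<Longrightarrow> template (CT i) (C\<eta> i) (c0 i) (c1 i)" and pB: "\<And>i. i \<in> I \<Longrightarrow> p i \<in> fst B"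
    and G: "G = attach_all B I (\<lambda>i. S_graph (CT i) (C\<eta> i) (c0 i) (c1 i)) (\<lambda>i. (0, c0 i)) p"
    and out: "\<And>i v. i \<in> I \<Longrightarrow> v \<in> CT i \<Longrightarrow> v \<noteq> c0 i \<Longrightarrow> \<exists>y. (Inr (i, (1, v)), y) \<in> snd G"
  shows "columnar (Inl ` A) (C <+> (SIGMA i:I. CT i - {c0 i}))
           (\<lambda>(c, j). case c of Inl c \<Rightarrow> Inl (e (c, j)) | Inr (i, v) \<Rightarrow> Inr (i, (j, v))) G"
proof -
  let ?S = "\<lambda>i. S_graph (CT i) (C\<eta> i) (c0 i) (c1 i)"
  let ?C = "C <+> (SIGMA i:I. CT i - {c0 i})"
  let ?e = "\<lambda>(c, j). case c of Inl c \<Rightarrow> Inl (e (c, j)) | Inr (i, v) \<Rightarrow> Inr (i, (j, v))"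
  let ?r = "grep (\<lambda>i. (0, c0 i)) p"
  have c01: "c0 i \<in> CT i" "c1 i \<in> CT i" "finite (CT i)" if "i \<in> I" for i
    using tem[OF that] unfolding template_def by auto
  have fB: "fst B = A \<union> e ` (C \<times> UNIV)" "inj_on e (C \<times> UNIV)" "A \<inter> e ` (C \<times> UNIV) = {}" "finite A" "finite C"
    using B unfolding columnar_def by auto
  have SV: "fst (?S i) = insert (0, c0 i) {(j, v) | j v. v \<in> CT i - {c0 i}}" if "i \<in> I" for i
    by (rule S_graph_vertices[OF c01(1)[OF that] c01(2)[OF that]])
  have r1: "?r (Inr (i, (j, v))) = Inr (i, (j, v))" if "v \<noteq> c0 i" for i j v using that by (simp add: grep_def)
  have r2: "?r (Inr (i, (0, c0 i))) = Inl (p i)" for i by (simp add: grep_def)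
  have fG: "fst G = Inl ` fst B \<union> {Inr (i, (j, v)) | i j v. i \<in> I \<and> v \<in> CT i - {c0 i}}" (is "_ = ?V")
  proof
    show "fst G \<subseteq> ?V"
      unfolding G attach_all_def using SV pB by (auto simp: grep_def split: if_splits)
    show "?V \<subseteq> fst G"
    proof
      fix x assume "x \<in> ?V"
      then consider b where "b \<in> fst B" "x = Inl b"
        | i j v where "i \<in> I" "v \<in> CT i - {c0 i}" "x = Inr (i, (j, v))" by blast
      then show "x \<in> fst G"
      proof cases
        case 1
        then show ?thesis unfolding G attach_all_def by simp
      next
        case (2 i j v)
        then have "x = ?r (Inr (i, (j, v)))" "(j, v) \<in> fst (?S i)" using r1[of v i j] SV[of i] by auto
        then show ?thesis unfolding G attach_all_def fst_conv using 2(1) by blast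
      qed
    qed
  qed
  have fG': "fst G = Inl ` A \<union> ?e ` (?C \<times> UNIV)"
  proof
    show "fst G \<subseteq> Inl ` A \<union> ?e ` (?C \<times> UNIV)"
    proof
      fix x assume "x \<in> fst G"
      then consider a where "a \<in> A" "x = Inl a" | c j where "c \<in> C" "x = Inl (e (c, j))"
        | i j v where "i \<in> I" "v \<in> CT i - {c0 i}" "x = Inr (i, (j, v))"
        unfolding fG fB(1) by blast
      then show "x \<in> Inl ` A \<union> ?e ` (?C \<times> UNIV)"
      proof cases
        case (2 c j)
        then have "x = ?e (Inl c, j)" "(Inl c, j) \<in> ?C \<times> UNIV" by auto
        then show ?thesis by blast
      next
        case (3 i j v)
        then have "x = ?e (Inr (i, v), j)" "(Inr (i, v), j) \<in> ?C \<times> UNIV" by auto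
        then show ?thesis by blast
      qed auto
    qed
    show "Inl ` A \<union> ?e ` (?C \<times> UNIV) \<subseteq> fst G"
      unfolding fG fB(1) by auto
  qed
  have EB: "(Inl a, Inl b) \<in> snd G" if "(a, b) \<in> snd B" for a b
    using that unfolding G attach_all_def by auto
  have ES: "(?r (Inr (i, a)), ?r (Inr (i, b))) \<in> snd G" if "(a, b) \<in> snd (?S i)" "i \<in> I" for a b i
    unfolding G attach_all_def snd_conv using that by blast
  have colB: "(\<exists>a\<in>fst G. \<forall>j. (?e (Inl c, Suc j), a) \<in> snd G) \<or>
             (\<exists>c'\<in>?C. \<exists>k. \<forall>j. (?e (Inl c, Suc j), ?e (c', j + k)) \<in> snd G)" if c: "c \<in> C" for c
  proof -
    from c B consider a where "a \<in> fst B" "\<forall>j. (e (c, Suc j), a) \<in> snd B"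
      | c' k where "c' \<in> C" "\<forall>j. (e (c, Suc j), e (c', j + k)) \<in> snd B"
      unfolding columnar_def by blast
    then show ?thesis
    proof cases
      case (1 a)
      then have "Inl a \<in> fst G" "\<forall>j. (?e (Inl c, Suc j), Inl a) \<in> snd G" using EB fG by auto
      then show ?thesis by blast
    next
      case (2 c' k)
      then have "Inl c' \<in> ?C" "\<forall>j. (?e (Inl c, Suc j), ?e (Inl c', j + k)) \<in> snd G" using EB by auto
      then show ?thesis by blast
    qed
  qed
  have colS: "(\<exists>a\<in>fst G. \<forall>j. (?e (Inr (i, v), Suc j), a) \<in> snd G) \<or>
             (\<exists>c'\<in>?C. \<exists>k. \<forall>j. (?e (Inr (i, v), Suc j), ?e (c', j + k)) \<in> snd G)"
    if i: "i \<in> I" and v: "v \<in> CT i" "v \<noteq> c0 i" for i v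
  proof -
    obtain y where "(Inr (i, (1, v)), y) \<in> snd G" using out[OF i v] by blast
    then obtain i' a b where ab: "(a, b) \<in> snd (?S i')" "i' \<in> I" "Inr (i, (1, v)) = ?r (Inr (i', a))"
      unfolding G attach_all_def by auto
    then have "a = (1, v)" "i' = i" by (auto simp: grep_def split: if_splits)
    then have "((1, v), b) \<in> snd (?S i)" using ab by simp
    from S_graph_column[OF tem[OF i] v(2) this]
    consider "\<forall>j. ((Suc j, v), (0, c0 i)) \<in> snd (?S i)"
      | v' k where "v' \<in> CT i - {c0 i}" "\<forall>j. ((Suc j, v), (j + k, v')) \<in> snd (?S i)" by blast
    then show ?thesis
    proof cases
      case 1
      have "(Inr (i, (Suc j, v)), Inl (p i)) \<in> snd G" for j
        using ES[OF 1[rule_format] i, of j] unfolding r1[OF v(2)] r2[of i] .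
      moreover have "Inl (p i) \<in> fst G" using pB[OF i] fG by auto
      ultimately show ?thesis by auto
    next
      case (2 v' k)
      then have v': "v' \<noteq> c0 i" by blast
      have "(Inr (i, (Suc j, v)), Inr (i, (j + k, v'))) \<in> snd G" for j
        using ES[OF 2(2)[rule_format] i, of j] unfolding r1[OF v(2)] r1[OF v'] .
      then have "\<forall>j. (?e (Inr (i, v), Suc j), ?e (Inr (i, v'), j + k)) \<in> snd G" by simp
      moreover have "Inr (i, v') \<in> ?C" using 2 i by auto
      ultimately show ?thesis by blast
    qed
  qed
  show ?thesis unfolding columnar_def
  proof (intro conjI ballI)
    show "finite (Inl ` A)" using fB by simp
    show "finite ?C" using fB I c01 by auto
    show "inj_on ?e (?C \<times> UNIV)" using fB(2) by (auto simp: inj_on_def split: sum.splits)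
    show "Inl ` A \<inter> ?e ` (?C \<times> UNIV) = {}" using fB(3) by (auto split: sum.splits)
    show "fst G = Inl ` A \<union> ?e ` (?C \<times> UNIV)" by (rule fG')
    fix c assume "c \<in> ?C"
    then consider c' where "c = Inl c'" "c' \<in> C" | i v where "c = Inr (i, v)" "i \<in> I" "v \<in> CT i" "v \<noteq> c0 i"
      by auto
    then show "(\<exists>a\<in>fst G. \<forall>j. (?e (c, Suc j), a) \<in> snd G) \<or>
             (\<exists>c'\<in>?C. \<exists>k. \<forall>j. (?e (c, Suc j), ?e (c', j + k)) \<in> snd G)"
    proof cases
      case 1
      then show ?thesis using colB by simp
    next
      case (2 i v)
      then show ?thesis using colS[of i v] by simp
    qed
  qed
qed

lemma graph_iso_out_edge:
  assumes "graph_iso (map_graph X f) G" "\<And>x. x \<in> X \<Longrightarrow> f x \<in> X" "v \<in> fst G"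
  shows "\<exists>w. (v, w) \<in> snd G"
proof -
  obtain h where h: "bij_betw h X (fst G)"
    and hE: "\<And>x y. x \<in> X \<Longrightarrow> y \<in> X \<Longrightarrow> y = f x \<longleftrightarrow> (h x, h y) \<in> snd G"
    using assms(1) unfolding graph_iso_def map_graph_def by auto
  obtain x where "x \<in> X" "v = h x" using h assms(3) by (auto simp: bij_betw_def)
  then show ?thesis using hE[of x "f x"] assms(2) by blast
qed

lemma columnar_finite: "finite (fst B) \<Longrightarrow> columnar (fst B) {} e B"
  by (simp add: columnar_def)

lemma attach_all_Inr_vertex:
  assumes "i \<in> I" "v \<in> CT i" "v \<noteq> c0 i"
  shows "Inr (i, (j, v)) \<in> fst (attach_all B I (\<lambda>i. S_graph (CT i) (C\<eta> i) (c0 i) (c1 i)) (\<lambda>i. (0, c0 i)) p)"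
proof -
  have "(j, v) \<in> fst (S_graph (CT i) (C\<eta> i) (c0 i) (c1 i))"
    using assms unfolding S_graph_def by (auto simp: srep_simps intro!: exI[of _ j] exI[of _ v])
  moreover have "grep (\<lambda>i. (0, c0 i)) p (Inr (i, (j, v))) = Inr (i, (j, v))" using assms by (simp add: grep_def)
  ultimately show ?thesis
    unfolding attach_all_def fst_conv using assms(1) by (metis (mono_tags, lifting) UnI2 mem_Collect_eq)
qed

lemma attach_inward_compsE:
  assumes "attach_inward_comps B G"
  obtains I CT C\<eta> c0 c1 p where "finite I"
    "\<And>i. i \<in> I \<Longrightarrow> template (CT i) (C\<eta> i) (c0 i) (c1 i)"
    "\<And>i. i \<in> I \<Longrightarrow> inwardly_oriented (CT i) (C\<eta> i) (c0 i) (c1 i)" "\<And>i. i \<in> I \<Longrightarrow> p i \<in> fst B"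
    "G = attach_all B I (\<lambda>i. S_graph (CT i) (C\<eta> i) (c0 i) (c1 i)) (\<lambda>i. (0, c0 i)) p"
  using assms unfolding attach_inward_comps_def by (elim exE conjE) (rule that, auto)

lemma presentable_if_attach_inward_comps:
  assumes B: "columnar A C e B" and att: "attach_inward_comps B G"
    and iso: "graph_iso (map_graph X f) G" and fX: "\<And>x. x \<in> X \<Longrightarrow> f x \<in> X"
  shows "unary_FA_presentable X f"
proof -
  obtain I CT C\<eta> c0 c1 p where I: "finite I"
    and tem: "\<And>i. i \<in> I \<Longrightarrow> template (CT i) (C\<eta> i) (c0 i) (c1 i)"
    and "\<And>i. i \<in> I \<Longrightarrow> inwardly_oriented (CT i) (C\<eta> i) (c0 i) (c1 i)" and pB: "\<And>i. i \<in> I \<Longrightarrow> p i \<in> fst B"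
    and G: "G = attach_all B I (\<lambda>i. S_graph (CT i) (C\<eta> i) (c0 i) (c1 i)) (\<lambda>i. (0, c0 i)) p"
    using att by (rule attach_inward_compsE) (rule that)
  have "\<exists>y. (Inr (i, (1, v)), y) \<in> snd G" if "i \<in> I" "v \<in> CT i" "v \<noteq> c0 i" for i v
    using graph_iso_out_edge[OF iso fX] attach_all_Inr_vertex[OF that(1), of v CT c0 1] that G by blast
  from attach_all_columnar[OF B I tem pB G this] show ?thesis
    using presentable_if_columnar iso fX by blast
qed

text \<open>The only simple path from \<open>t\<close> to itself is \<open>[t]\<close>, which cannot
  contain the head of an edge leaving \<open>t\<close>.\<close>

lemma oriented_towards_no_out_edge:
  assumes "oriented_towards \<eta> t" "dtree T \<eta>"
  shows "(t, w) \<notin> \<eta>"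
proof
  assume e: "(t, w) \<in> \<eta>"
  then obtain p where p: "upath (\<eta> \<union> \<eta>\<inverse>) t t p" "w \<in> set p"
    using assms(1) unfolding oriented_towards_def by blast
  then have "p = [t]"
    unfolding upath_def by (metis distinct.simps(2) last_ConsR last_in_set list.collapse list.sel(1))
  then have "w = t" using p by simp
  then show False using e assms(2) unfolding dtree_def by blast
qed

text \<open>The base or centre of an inward component comes only from copies of \<open>t0\<close>,
  and no template edge leaves \<open>t0\<close>. So inward components add no outgoing edges to the
  graph they are attached to.\<close>

lemma attach_inward_comps_edge_from_base:
  assumes "attach_inward_comps B G" "(Inl a, y) \<in> snd G"
  shows "\<exists>b. (a, b) \<in> snd B"
proof -
  obtain I CT C\<eta> c0 c1 p where "finite I"
    and tem: "\<And>i. i \<in> I \<Longrightarrow> template (CT i) (C\<eta> i) (c0 i) (c1 i)"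
    and inw: "\<And>i. i \<in> I \<Longrightarrow> inwardly_oriented (CT i) (C\<eta> i) (c0 i) (c1 i)"
    and "\<And>i. i \<in> I \<Longrightarrow> p i \<in> fst B"
    and G: "G = attach_all B I (\<lambda>i. S_graph (CT i) (C\<eta> i) (c0 i) (c1 i)) (\<lambda>i. (0, c0 i)) p"
    using assms(1) by (rule attach_inward_compsE) (rule that)
  show ?thesis
  proof (rule ccontr)
    assume "\<not> ?thesis"
    then obtain i u w where iu: "i \<in> I" "(u, w) \<in> snd (S_graph (CT i) (C\<eta> i) (c0 i) (c1 i))"
      "Inl a = grep (\<lambda>i. (0, c0 i)) p (Inr (i, u))"
      using assms(2) unfolding G attach_all_def by auto
    then have "u = (0, c0 i)" by (cases u) (auto simp: grep_def split: if_splits)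
    with iu(2) obtain j u' w' where u': "(u', w') \<in> C\<eta> i" "(0, c0 i) = srep (c0 i) (c1 i) (j, u')"
      unfolding S_graph_def by auto
    then have "u' = c0 i" by (auto simp: srep_def split: if_splits)
    then show False
      using u'(1) oriented_towards_no_out_edge[of "C\<eta> i" "c0 i" "CT i"] tem[OF iu(1)] inw[OF iu(1)]
      unfolding inwardly_oriented_def template_def by blast
  qed
qed

lemma presentable_if_shape1:
  assumes "shape1 X f" and fX: "\<And>x. x \<in> X \<Longrightarrow> f x \<in> X"
  shows "unary_FA_presentable X f"
proof -
  obtain n I TV TE root at and G :: "((nat + nat \<times> nat) + nat \<times> (nat \<times> nat)) digraph" where I: "finite I"
    and tr: "\<And>i. i \<in> I \<Longrightarrow> inward_rooted_finite_tree (TV i) (TE i) (root i)"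
    and att: "attach_inward_comps (attach_all (cycle_graph n) I (\<lambda>i. (TV i, TE i)) root at) G"
    and iso: "graph_iso (map_graph X f) G"
    using assms(1) unfolding shape1_def by (elim exE conjE) (rule that, auto)
  have "finite (fst (attach_all (cycle_graph n) I (\<lambda>i. (TV i, TE i)) root at))"
  proof -
    have "{grep root at (Inr (i, v)) | i v. i \<in> I \<and> v \<in> TV i} = (\<lambda>x. grep root at (Inr x)) ` (SIGMA i:I. TV i)"
      by auto
    moreover have "finite (SIGMA i:I. TV i)" using I tr unfolding inward_rooted_finite_tree_def by auto
    ultimately show ?thesis by (simp add: attach_all_def cycle_graph_def)
  qed
  from presentable_if_attach_inward_comps[OF columnar_finite[OF this] att iso fX] show ?thesis .
qed

lemma presentable_if_shape2:
  assumes "shape2 X f" and fX: "\<And>x. x \<in> X \<Longrightarrow> f x \<in> X"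
  shows "unary_FA_presentable X f"
proof -
  obtain V E r T \<eta> t0 t1 and G :: "((nat + nat \<times> (nat \<times> nat)) + nat \<times> (nat \<times> nat)) digraph"
    where tr: "inward_rooted_finite_tree V E r" and tem: "template T \<eta> t0 t1"
    and att: "attach_inward_comps
          (attach_all (V, E) {0} (\<lambda>_. S_graph T \<eta> t0 t1) (\<lambda>_. (0, t0)) (\<lambda>_. r)) G"
    and iso: "graph_iso (map_graph X f) G"
    using assms(1) unfolding shape2_def by (elim exE conjE) (rule that, auto)
  let ?B = "attach_all (V, E) {0} (\<lambda>_. S_graph T \<eta> t0 t1) (\<lambda>_. (0, t0)) (\<lambda>_. r)"
  have fin: "finite (fst (V, E))" and r: "r \<in> V" using tr unfolding inward_rooted_finite_tree_def by auto
  \<comment> \<open>Only the final graph is known to belong to a total map. Its edges leaving the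
    vertices of \<open>?B\<close> lie in \<open>?B\<close> already, because inward components add
    none.\<close>
  have out: "\<exists>y. (Inr (0, (1, v)), y) \<in> snd ?B" if "v \<in> T" "v \<noteq> t0" for v
  proof -
    have "Inr (0, (1, v)) \<in> fst ?B"
      using attach_all_Inr_vertex[of 0 "{0}" v "\<lambda>_. T" "\<lambda>_. t0"] that by simp
    then have "Inl (Inr (0, (1, v))) \<in> fst G"
      using att unfolding attach_inward_comps_def attach_all_def[of ?B] by auto
    then show ?thesis
      using graph_iso_out_edge[OF iso fX] attach_inward_comps_edge_from_base[OF att] by blast
  qed
  have "\<exists>A C e. columnar A (C :: (nat + nat \<times> nat) set) e ?B"
    using attach_all_columnar[where I = "{0}" and CT = "\<lambda>_. T" and C\<eta> = "\<lambda>_. \<eta>" and ?c0.0 = "\<lambda>_. t0"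
        and ?c1.0 = "\<lambda>_. t1" and p = "\<lambda>_. r" and G = ?B, OF columnar_finite[OF fin]] tem r out by auto
  then show ?thesis using presentable_if_attach_inward_comps att iso fX by blast
qed

section \<open>Trees and attachments\<close>

lemma upath_Cons:
  "upath S a b (x # q) \<longleftrightarrow> x = a \<and> (q = [] \<and> b = a \<or> q \<noteq> [] \<and> a \<notin> set q \<and> (a, hd q) \<in> S \<and> upath S (hd q) b q)"
proof (cases q)
  case Nil
  then show ?thesis by (auto simp: upath_def)
next
  case (Cons y r)
  have "(\<forall>i. Suc i < length (x # q) \<longrightarrow> ((x # q) ! i, (x # q) ! Suc i) \<in> S) \<longleftrightarrow>
    (x, hd q) \<in> S \<and> (\<forall>i. Suc i < length q \<longrightarrow> (q ! i, q ! Suc i) \<in> S)"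
    unfolding Cons by (auto simp: nth_Cons split: nat.splits)
  then show ?thesis using Cons unfolding upath_def by auto
qed

lemma upath_rev:
  assumes "sym S" "upath S a b p"
  shows "upath S b a (rev p)"
proof -
  have "(rev p ! i, rev p ! Suc i) \<in> S" if i: "Suc i < length p" for i
  proof -
    have "(p ! (length p - Suc (Suc i)), p ! Suc (length p - Suc (Suc i))) \<in> S"
      using assms(2) i unfolding upath_def by auto
    moreover have "Suc (length p - Suc (Suc i)) = length p - Suc i" using i by simp
    ultimately show ?thesis using i assms(1) by (simp add: rev_nth sym_def)
  qed
  then show ?thesis using assms(2) unfolding upath_def by (auto simp: hd_rev last_rev)
qed

lemma upath_subset:
  assumes "upath S a b p" "a \<in> T" "S \<subseteq> T \<times> T"
  shows "set p \<subseteq> T"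
  using assms
proof (induction p arbitrary: a)
  case (Cons x q)
  show ?case
  proof (cases "q = []")
    case True
    then show ?thesis using Cons.prems by (simp add: upath_Cons)
  next
    case False
    then have "upath S (hd q) b q" "(a, hd q) \<in> S" "x = a" using Cons.prems by (auto simp: upath_Cons)
    then show ?thesis using Cons by auto
  qed
qed simp

lemma upath_mono: "upath S a b p \<Longrightarrow> S \<subseteq> S' \<Longrightarrow> upath S' a b p"
  unfolding upath_def by blast

section \<open>Adding a leaf to a directed tree\<close>

context
  fixes T :: "'v set" and \<eta> :: "('v \<times> 'v) set" and v w :: 'v
  assumes tree: "dtree T \<eta>" and w: "w \<in> T" and v: "v \<notin> T"
begin

private abbreviation "S \<equiv> \<eta> \<union> \<eta>\<inverse>"
private abbreviation "S' \<equiv> insert (v, w) \<eta> \<union> (insert (v, w) \<eta>)\<inverse>"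

private lemma S_subset: "S \<subseteq> T \<times> T"
  using tree unfolding dtree_def by blast

private lemma S'_subset: "S' \<subseteq> insert v T \<times> insert v T"
  using S_subset w by blast

private lemma upath_avoiding:
  assumes "upath S' a b p" "v \<notin> set p"
  shows "upath S a b p"
proof -
  have "(p ! i, p ! Suc i) \<in> S" if "Suc i < length p" for i
  proof -
    have "(p ! i, p ! Suc i) \<in> S'" "p ! i \<noteq> v" "p ! Suc i \<noteq> v"
      using assms that unfolding upath_def by (auto simp: in_set_conv_nth)
    then show ?thesis by auto
  qed
  then show ?thesis using assms unfolding upath_def by blast
qed

text \<open>A simple path between old vertices cannot pass the new vertex: both neighbours of
  \<open>v\<close> on it would have to be \<open>w\<close>.\<close>

private lemma upath_old_iff:
  assumes "a \<in> T" "b \<in> T"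
  shows "upath S' a b p \<longleftrightarrow> upath S a b p"
proof
  assume p: "upath S' a b p"
  have "v \<notin> set p"
  proof
    assume "v \<in> set p"
    then obtain i where i: "i < length p" "p ! i = v" by (auto simp: in_set_conv_nth)
    have ne: "p \<noteq> []" "hd p = a" "last p = b" "distinct p" using p unfolding upath_def by auto
    have "p ! 0 = a" "p ! (length p - 1) = b" using ne by (simp_all add: hd_conv_nth last_conv_nth)
    then have "i \<noteq> 0" "i \<noteq> length p - 1" using i v assms by metis+
    then obtain k where k: "i = Suc k" "Suc (Suc k) < length p" using i by (cases i) auto
    have "(p ! j, p ! Suc j) \<in> S'" if "Suc j < length p" for j
      using p that unfolding upath_def by blast
    from this[of k] this[of "Suc k"] have "(p ! k, v) \<in> S'" "(v, p ! Suc (Suc k)) \<in> S'"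
      using k i by auto
    then have "p ! k = w" "p ! Suc (Suc k) = w" using v S_subset by auto
    then show False using nth_eq_iff_index_eq[OF ne(4), of k "Suc (Suc k)"] k by simp
  qed
  then show "upath S a b p" using upath_avoiding p by blast
next
  assume "upath S a b p"
  then show "upath S' a b p" by (rule upath_mono) blast
qed

private lemma upath_from_new:
  assumes "b \<in> T"
  shows "upath S' v b p \<longleftrightarrow> (\<exists>q. p = v # q \<and> upath S w b q)"
proof
  assume p: "upath S' v b p"
  obtain x q where q: "p = x # q" using p by (cases p) (auto simp: upath_def)
  have *: "x = v" "q \<noteq> []" "v \<notin> set q" "(v, hd q) \<in> S'" "upath S' (hd q) b q"
    using p assms v unfolding q upath_Cons by auto
  then have "hd q = w" using S_subset v by auto
  then have "upath S w b q" using upath_avoiding[of "hd q"] * by blast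
  then show "\<exists>q. p = v # q \<and> upath S w b q" using q * by blast
next
  assume "\<exists>q. p = v # q \<and> upath S w b q"
  then obtain q where q: "p = v # q" "upath S w b q" by blast
  have "set q \<subseteq> T" using upath_subset[OF q(2) w S_subset] .
  then have "v \<notin> set q" using v by blast
  moreover have "q \<noteq> []" "hd q = w" using q(2) unfolding upath_def by auto
  moreover have "upath S' w b q" using q(2) by (rule upath_mono) blast
  ultimately show "upath S' v b p" unfolding q(1) upath_Cons by auto
qed

text \<open>A path from \<open>v\<close> is \<open>v\<close> followed by a path from
  \<open>w\<close>, and a path to \<open>v\<close> is the reversal of one from \<open>v\<close>.
  Uniqueness is thus inherited from the old tree.\<close>

lemma dtree_insert_leaf: "dtree (insert v T) (insert (v, w) \<eta>)"
proof -
  have uniq: "\<exists>!p. upath S a b p" if "a \<in> T" "b \<in> T" for a b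
    using tree that unfolding dtree_def by blast
  have sym: "sym S'" by (auto simp: sym_def)
  have from_v: "\<exists>!p. upath S' v b p" if b: "b \<in> T" for b
  proof -
    obtain q where q: "upath S w b q" "\<And>q'. upath S w b q' \<Longrightarrow> q' = q" using uniq[OF w b] by blast
    show ?thesis
    proof (rule ex1I[of _ "v # q"])
      show "upath S' v b (v # q)" using upath_from_new[OF b] q(1) by blast
      show "p = v # q" if "upath S' v b p" for p using upath_from_new[OF b] q(2) that by blast
    qed
  qed
  have to_v: "\<exists>!p. upath S' a v p" if a: "a \<in> T" for a
  proof -
    obtain q where q: "upath S' v a q" "\<And>q'. upath S' v a q' \<Longrightarrow> q' = q" using from_v[OF a] by blast
    show ?thesis
    proof (rule ex1I[of _ "rev q"])
      show "upath S' a v (rev q)" using upath_rev[OF sym q(1)] .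
      show "p = rev q" if "upath S' a v p" for p
        using q(2)[OF upath_rev[OF sym that]] by (metis rev_rev_ident)
    qed
  qed
  have self: "\<exists>!p. upath S' v v p"
  proof (rule ex1I[of _ "[v]"])
    show "upath S' v v [v]" by (simp add: upath_Cons)
    fix p assume p: "upath S' v v p"
    then obtain x q where q: "p = x # q" by (cases p) (auto simp: upath_def)
    have "q = []"
    proof (rule ccontr)
      assume "q \<noteq> []"
      moreover from this have "v \<notin> set q" "upath S' (hd q) v q" using p unfolding q upath_Cons by auto
      ultimately show False unfolding upath_def by (metis last_in_set)
    qed
    then show "p = [v]" using p unfolding q upath_Cons by simp
  qed
  have paths: "\<exists>!p. upath S' a b p" if ab: "a \<in> insert v T" "b \<in> insert v T" for a b
  proof -
    consider "a \<in> T" "b \<in> T" | "a = v" "b \<in> T" | "a \<in> T" "b = v" | "a = v" "b = v" using ab by blast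
    then show ?thesis
    proof cases
      case 1
      then show ?thesis using upath_old_iff[OF 1] uniq[OF 1] by simp
    next
      case 2
      then show ?thesis using from_v by simp
    next
      case 3
      then show ?thesis using to_v by simp
    next
      case 4
      then show ?thesis using self by simp
    qed
  qed
  show ?thesis
    unfolding dtree_def
  proof (intro conjI ballI)
    show "case e of (a, b) \<Rightarrow> a \<noteq> b \<and> (b, a) \<notin> insert (v, w) \<eta>" if "e \<in> insert (v, w) \<eta>" for e
      using that tree w v unfolding dtree_def by auto
    show "insert (v, w) \<eta> \<subseteq> insert v T \<times> insert v T" using S'_subset by blast
  qed (use paths in auto)
qed

lemma oriented_towards_insert_leaf:
  assumes "oriented_towards \<eta> r" "r \<in> T"
  shows "oriented_towards (insert (v, w) \<eta>) r"
proof -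
  obtain q where q: "upath S w r q" using tree w assms(2) unfolding dtree_def by blast
  have "upath S' v r (v # q)" using upath_from_new[OF assms(2)] q by blast
  moreover have "w \<in> set (v # q)" using q unfolding upath_def by auto
  moreover have "\<exists>p. upath S' a r p \<and> b \<in> set p" if ab: "(a, b) \<in> \<eta>" for a b
  proof -
    obtain p where "upath S a r p" "b \<in> set p" using assms(1) ab unfolding oriented_towards_def by blast
    moreover from this have "upath S' a r p" by (elim upath_mono) blast
    ultimately show ?thesis by blast
  qed
  ultimately show ?thesis unfolding oriented_towards_def by blast
qed

end

lemma inward_rooted_finite_tree_singleton: "inward_rooted_finite_tree {r} {} r"
proof -
  have "\<exists>!p. upath ({} \<union> {}\<inverse>) r r p"
  proof (rule ex1I[of _ "[r]"])
    fix p assume "upath ({} \<union> {}\<inverse>) r r p"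
    then show "p = [r]" by (cases p) (auto simp: upath_Cons, simp add: upath_def)
  qed (simp add: upath_Cons)
  then show ?thesis
    unfolding inward_rooted_finite_tree_def dtree_def oriented_towards_def by auto
qed

text \<open>A vertex of maximal rank is nobody's parent, hence a leaf; removing it leaves a smaller
  instance.\<close>

lemma inward_rooted_finite_tree_ranked:
  fixes \<rho> :: "'v \<Rightarrow> nat"
  assumes "finite T" "r \<in> T" "\<And>v. v \<in> T - {r} \<Longrightarrow> g v \<in> T \<and> \<rho> (g v) < \<rho> v"
  shows "inward_rooted_finite_tree T {(v, g v) | v. v \<in> T - {r}} r"
  using assms
proof (induction "card T" arbitrary: T)
  case 0
  then show ?case by auto
next
  case (Suc n)
  show ?case
  proof (cases "T = {r}")
    case True
    then show ?thesis using inward_rooted_finite_tree_singleton by auto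
  next
    case False
    then have "finite (T - {r})" "T - {r} \<noteq> {}" using Suc.prems by auto
    then have "Max (\<rho> ` (T - {r})) \<in> \<rho> ` (T - {r})" by (intro Max_in) auto
    then obtain v where v: "v \<in> T - {r}" and "\<rho> v = Max (\<rho> ` (T - {r}))" by (metis imageE)
    then have max: "\<rho> u \<le> \<rho> v" if "u \<in> T - {r}" for u
      using that \<open>finite (T - {r})\<close> by simp
    let ?T = "T - {v}"
    have gv: "g u \<noteq> v" if "u \<in> T - {r}" for u using Suc.prems(3)[OF that] max[OF that] by auto
    have IH: "inward_rooted_finite_tree ?T {(u, g u) | u. u \<in> ?T - {r}} r"
    proof (rule Suc.hyps)
      show "n = card ?T" using Suc.hyps(2) Suc.prems v by simp
      show "g u \<in> ?T \<and> \<rho> (g u) < \<rho> u" if "u \<in> ?T - {r}" for u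
        using Suc.prems(3)[of u] gv[of u] that by auto
    qed (use Suc.prems v in auto)
    have T: "T = insert v ?T" and E: "{(u, g u) | u. u \<in> T - {r}} = insert (v, g v) {(u, g u) | u. u \<in> ?T - {r}}"
      using v by auto
    have h: "dtree ?T {(u, g u) | u. u \<in> ?T - {r}}" "g v \<in> ?T" "v \<notin> ?T" "r \<in> ?T"
      "oriented_towards {(u, g u) | u. u \<in> ?T - {r}} r"
      using IH Suc.prems(3)[OF v] gv[OF v] unfolding inward_rooted_finite_tree_def by auto
    have "dtree T {(u, g u) | u. u \<in> T - {r}}"
      using dtree_insert_leaf[OF h(1-3)] unfolding T[symmetric] E[symmetric] .
    moreover have "oriented_towards {(u, g u) | u. u \<in> T - {r}} r"
      using oriented_towards_insert_leaf[OF h(1-3) h(5,4)] unfolding E[symmetric] .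
    ultimately show ?thesis using Suc.prems unfolding inward_rooted_finite_tree_def by blast
  qed
qed

text \<open>The number of steps to the root serves as the rank.\<close>

lemma inward_rooted_finite_tree_parent:
  assumes "finite T" "r \<in> T" "\<And>v. v \<in> T - {r} \<Longrightarrow> g v \<in> T" "\<And>v. v \<in> T \<Longrightarrow> \<exists>n. (g ^^ n) v = r"
  shows "inward_rooted_finite_tree T {(v, g v) | v. v \<in> T - {r}} r"
proof (rule inward_rooted_finite_tree_ranked[where \<rho> = "\<lambda>v. LEAST n. (g ^^ n) v = r"])
  fix v assume v: "v \<in> T - {r}"
  let ?n = "LEAST n. (g ^^ n) v = r"
  have n: "(g ^^ ?n) v = r" using assms(4) v by (metis (mono_tags) DiffD1 LeastI_ex)
  have "?n \<noteq> 0"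
  proof
    assume "?n = 0"
    then have "v = r" using n by simp
    then show False using v by simp
  qed
  then obtain m where m: "?n = Suc m" by (cases ?n) auto
  then have "(g ^^ m) (g v) = r" using n by (simp add: funpow_swap1)
  then have "(LEAST n. (g ^^ n) (g v) = r) \<le> m" by (rule Least_le)
  then show "g v \<in> T \<and> (LEAST n. (g ^^ n) (g v) = r) < (LEAST n. (g ^^ n) v = r)"
    using m assms(3)[OF v] by simp
qed (use assms in auto)

text \<open>\<open>\<psi>\<close> identifies the digraph \<open>B\<close> with the restriction of \<open>g\<close> to \<open>V\<close>.\<close>
definition represents :: "('a \<Rightarrow> 'a) \<Rightarrow> 'a set \<Rightarrow> 'v digraph \<Rightarrow> ('v \<Rightarrow> 'a) \<Rightarrow> bool" where
  "represents g V B \<psi> \<longleftrightarrow> bij_betw \<psi> (fst B) V \<and>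
     (\<forall>(a, b)\<in>snd B. a \<in> fst B \<and> b \<in> fst B \<and> g (\<psi> a) = \<psi> b) \<and>
     (\<forall>a\<in>fst B. \<exists>b. (a, b) \<in> snd B)"

text \<open>The edges of \<open>G\<close> agree with \<open>g\<close> and every vertex has one. As
  \<open>g\<close> has one value at each point, no edge can be missing, so nothing more is needed
  for an isomorphism.\<close>

lemma graph_iso_if_represents:
  assumes G: "represents g L G \<psi>" and \<phi>: "bij_betw \<phi> L X" and f: "\<And>u. u \<in> L \<Longrightarrow> g u \<in> L \<and> f (\<phi> u) = \<phi> (g u)"
  shows "graph_iso (map_graph X f) G"
proof -
  define \<theta> where "\<theta> = \<phi> \<circ> \<psi>"
  have \<psi>: "bij_betw \<psi> (fst G) L" using G unfolding represents_def by blast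
  then have \<theta>: "bij_betw \<theta> (fst G) X" unfolding \<theta>_def using \<phi> by (rule bij_betw_trans)
  define h where "h = inv_into (fst G) \<theta>"
  have h: "bij_betw h X (fst G)" unfolding h_def using \<theta> by (rule bij_betw_inv_into)
  have \<theta>h: "\<theta> (h x) = x" "h x \<in> fst G" if "x \<in> X" for x
    using that \<theta> h bij_betw_inv_into_right[of \<theta> "fst G" X x] by (auto simp: h_def bij_betw_def)
  have edge: "f (\<theta> a) = \<theta> b \<and> b \<in> fst G" if "(a, b) \<in> snd G" for a b
  proof -
    have ab: "a \<in> fst G" "b \<in> fst G" "g (\<psi> a) = \<psi> b" using G that unfolding represents_def by auto
    then have "\<psi> a \<in> L" using \<psi> by (auto simp: bij_betw_def)
    then show ?thesis using f ab by (simp add: \<theta>_def)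
  qed
  have "y = f x \<longleftrightarrow> (h x, h y) \<in> snd G" if xy: "x \<in> X" "y \<in> X" for x y
  proof
    assume y: "y = f x"
    obtain b where b: "(h x, b) \<in> snd G" using G \<theta>h[OF xy(1)] unfolding represents_def by blast
    then have "\<theta> b = \<theta> (h y)" "b \<in> fst G" using edge[OF b] \<theta>h xy y by auto
    then have "b = h y" using \<theta> \<theta>h(2)[OF xy(2)] by (auto simp: bij_betw_def inj_on_def)
    then show "(h x, h y) \<in> snd G" using b by simp
  next
    assume "(h x, h y) \<in> snd G"
    then show "y = f x" using edge \<theta>h xy by fastforce
  qed
  then show ?thesis unfolding graph_iso_def map_graph_def using h by (intro exI[of _ h]) auto
qed

text \<open>\<open>outB\<close> allows a base vertex to get its outgoing edge from a component
  attached there. An outward periodic path needs this: the root of the finite tree has its only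
  outgoing edge inside the path.\<close>

lemma represents_attach_all:
  fixes C :: "nat \<Rightarrow> 'c digraph"
  assumes \<psi>: "bij_betw \<psi> (fst B) V"
    and EB: "\<And>a b. (a, b) \<in> snd B \<Longrightarrow> a \<in> fst B \<and> b \<in> fst B \<and> g (\<psi> a) = \<psi> b"
    and p: "\<And>i. i \<in> I \<Longrightarrow> p i \<in> fst B \<and> \<chi> (t i) = \<psi> (p i)"
    and inj: "\<And>i. i \<in> I \<Longrightarrow> inj_on \<chi> (fst (C i) - {t i})"
    and W: "\<And>i. i \<in> I \<Longrightarrow> \<chi> ` (fst (C i) - {t i}) = W i"
    and disjV: "\<And>i. i \<in> I \<Longrightarrow> V \<inter> W i = {}"
    and disjW: "\<And>i i'. i \<in> I \<Longrightarrow> i' \<in> I \<Longrightarrow> i \<noteq> i' \<Longrightarrow> W i \<inter> W i' = {}"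
    and EC: "\<And>i a b. i \<in> I \<Longrightarrow> (a, b) \<in> snd (C i) \<Longrightarrow> a \<in> fst (C i) \<and> b \<in> fst (C i) \<and> g (\<chi> a) = \<chi> b"
    and outB: "\<And>a. a \<in> fst B \<Longrightarrow> (\<exists>b. (a, b) \<in> snd B) \<or> (\<exists>i\<in>I. p i = a \<and> (\<exists>b. (t i, b) \<in> snd (C i)))"
    and outC: "\<And>i a. i \<in> I \<Longrightarrow> a \<in> fst (C i) \<Longrightarrow> a \<noteq> t i \<Longrightarrow> \<exists>b. (a, b) \<in> snd (C i)"
  shows "represents g (V \<union> (\<Union>i\<in>I. W i)) (attach_all B I C t p) (case_sum \<psi> (\<lambda>(i, v). \<chi> v))"
proof -
  let ?G = "attach_all B I C t p"
  let ?\<psi> = "case_sum \<psi> (\<lambda>(i :: nat, v). \<chi> v)"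
  let ?r = "\<lambda>i v. grep t p (Inr (i, v))"
  have r1: "?r i v = Inr (i, v)" if "v \<noteq> t i" for i v using that by (simp add: grep_def)
  have r2: "?r i (t i) = Inl (p i)" for i by (simp add: grep_def)
  have \<psi>r: "?\<psi> (?r i v) = \<chi> v" if "i \<in> I" for i v using p[OF that] by (cases "v = t i") (auto simp: grep_def)
  have V: "fst ?G = Inl ` fst B \<union> (\<Union>i\<in>I. (\<lambda>v. Inr (i, v)) ` (fst (C i) - {t i}))" (is "_ = ?V")
  proof
    show "fst ?G \<subseteq> ?V" unfolding attach_all_def using p by (auto simp: grep_def)
    show "?V \<subseteq> fst ?G"
    proof
      fix x assume "x \<in> ?V"
      then consider b where "b \<in> fst B" "x = Inl b"
        | i v where "i \<in> I" "v \<in> fst (C i)" "v \<noteq> t i" "x = Inr (i, v)" by blast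
      then show "x \<in> fst ?G"
      proof cases
        case 1
        then show ?thesis unfolding attach_all_def by simp
      next
        case (2 i v)
        then have "x = ?r i v" using r1 by simp
        then show ?thesis unfolding attach_all_def fst_conv using 2 by blast
      qed
    qed
  qed
  have rV: "?r i v \<in> fst ?G" if "i \<in> I" "v \<in> fst (C i)" for i v
    unfolding attach_all_def fst_conv using that by blast
  have img: "?\<psi> ` fst ?G = V \<union> (\<Union>i\<in>I. W i)"
  proof -
    have "?\<psi> ` (Inl ` fst B) = V" using \<psi> by (auto simp: bij_betw_def image_image)
    moreover have "?\<psi> ` (\<lambda>v. Inr (i, v)) ` (fst (C i) - {t i}) = W i" if "i \<in> I" for i
      using W[OF that] by (simp add: image_image)
    ultimately show ?thesis unfolding V image_Un image_UN by simp
  qed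
  have injG: "inj_on ?\<psi> (fst ?G)"
  proof (rule inj_onI)
    fix x y assume xy: "x \<in> fst ?G" "y \<in> fst ?G" "?\<psi> x = ?\<psi> y"
    have c: "(\<exists>b\<in>fst B. z = Inl b) \<or> (\<exists>i\<in>I. \<exists>v\<in>fst (C i) - {t i}. z = Inr (i, v))" if "z \<in> fst ?G" for z
      using that unfolding V by blast
    have inV: "\<psi> b \<in> V" if "b \<in> fst B" for b using \<psi> that by (auto simp: bij_betw_def)
    have inW: "\<chi> v \<in> W i" if "i \<in> I" "v \<in> fst (C i) - {t i}" for i v using W that by blast
    from c[OF xy(1)] c[OF xy(2)] consider
        a b where "a \<in> fst B" "b \<in> fst B" "x = Inl a" "y = Inl b"
      | a i v where "a \<in> fst B" "x = Inl a" "i \<in> I" "v \<in> fst (C i) - {t i}" "y = Inr (i, v)"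
      | a i v where "a \<in> fst B" "y = Inl a" "i \<in> I" "v \<in> fst (C i) - {t i}" "x = Inr (i, v)"
      | i v j w where "i \<in> I" "v \<in> fst (C i) - {t i}" "x = Inr (i, v)" "j \<in> I" "w \<in> fst (C j) - {t j}" "y = Inr (j, w)"
      by blast
    then show "x = y"
    proof cases
      case 1
      then show ?thesis using xy(3) \<psi> by (auto simp: bij_betw_def inj_on_def)
    next
      case (2 a i v)
      then have "\<chi> v = \<psi> a" using xy(3) by simp
      then show ?thesis using inV[OF 2(1)] inW[OF 2(3,4)] disjV[OF 2(3)] by auto
    next
      case (3 a i v)
      then have "\<chi> v = \<psi> a" using xy(3) by simp
      then show ?thesis using inV[OF 3(1)] inW[OF 3(3,4)] disjV[OF 3(3)] by auto
    next
      case (4 i v j w)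
      then have eq: "\<chi> v = \<chi> w" using xy(3) by simp
      then have "i = j" using inW[OF 4(1,2)] inW[OF 4(4,5)] disjW[OF 4(1,4)] by auto
      then have "v = w" using inj[OF 4(1)] 4 eq by (auto dest: inj_onD)
      then show ?thesis using 4 \<open>i = j\<close> by simp
    qed
  qed
  have edges: "a \<in> fst ?G \<and> b \<in> fst ?G \<and> g (?\<psi> a) = ?\<psi> b" if "(a, b) \<in> snd ?G" for a b
  proof -
    from that consider u v where "(u, v) \<in> snd B" "a = Inl u" "b = Inl v"
      | i u v where "i \<in> I" "(u, v) \<in> snd (C i)" "a = ?r i u" "b = ?r i v"
      unfolding attach_all_def by auto
    then show ?thesis
    proof cases
      case 1
      then show ?thesis using EB V by auto
    next
      case (2 i u v)
      then show ?thesis using EC[OF 2(1,2)] rV \<psi>r by simp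
    qed
  qed
  have ESC: "(?r i u, ?r i v) \<in> snd ?G" if "i \<in> I" "(u, v) \<in> snd (C i)" for i u v
    unfolding attach_all_def snd_conv using that by blast
  have "\<exists>b. (a, b) \<in> snd ?G" if "a \<in> fst ?G" for a
  proof -
    from that V consider u where "u \<in> fst B" "a = Inl u"
      | i v where "i \<in> I" "v \<in> fst (C i)" "v \<noteq> t i" "a = Inr (i, v)" by blast
    then show ?thesis
    proof cases
      case (1 u)
      from outB[OF 1(1)] show ?thesis
      proof
        assume "\<exists>b. (u, b) \<in> snd B"
        then show ?thesis unfolding 1(2) attach_all_def by auto
      next
        assume "\<exists>i\<in>I. p i = u \<and> (\<exists>b. (t i, b) \<in> snd (C i))"
        then obtain i b where "i \<in> I" "p i = u" "(t i, b) \<in> snd (C i)" by blast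
        then show ?thesis using ESC[of i "t i" b] r2 1(2) by metis
      qed
    next
      case (2 i v)
      then obtain b where "(v, b) \<in> snd (C i)" using outC by blast
      then show ?thesis using ESC[of i v b] r1 2 by metis
    qed
  qed
  then show ?thesis unfolding represents_def bij_betw_def using injG img edges by blast
qed

section \<open>Maps that are periodic along columns\<close>

definition const_at :: "(nat \<Rightarrow> nat) \<Rightarrow> nat \<Rightarrow> nat \<Rightarrow> bool" where
  "const_at g P v \<longleftrightarrow> (\<forall>j. g (v + j * P) = g v)"

definition shift_at :: "(nat \<Rightarrow> nat) \<Rightarrow> nat \<Rightarrow> nat \<Rightarrow> bool" where
  "shift_at g P v \<longleftrightarrow> (\<forall>j. g (v + j * P) = g v + j * P)"

text \<open>The number of steps is the same along the whole column. The image of the first point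
  \<open>v\<close> is left open, since it may leave the column.\<close>

definition inward_at :: "(nat \<Rightarrow> nat) \<Rightarrow> nat \<Rightarrow> nat \<Rightarrow> bool" where
  "inward_at g P v \<longleftrightarrow> (\<exists>n>0. \<forall>j. (g ^^ n) (v + Suc j * P) = v + j * P)"

definition outward_at :: "(nat \<Rightarrow> nat) \<Rightarrow> nat \<Rightarrow> nat \<Rightarrow> bool" where
  "outward_at g P v \<longleftrightarrow> (\<exists>n>0. \<forall>j. (g ^^ n) (v + j * P) = v + Suc j * P)"

lemma funpow_plus: "(g ^^ (m + n)) x = (g ^^ m) ((g ^^ n) x)"
  by (simp add: funpow_add)

text \<open>The last assumption says that every orbit soon meets a vertex of bounded size, a column that
  is mapped to one point, or a column on which a power of \<open>g\<close> is a shift by one period.\<close>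
locale columns =
  fixes L :: "nat set" and g :: "nat \<Rightarrow> nat" and P M Q :: nat
  assumes P_pos: "0 < P"
    and g_closed: "u \<in> L \<Longrightarrow> g u \<in> L"
    and orbit: "u \<in> L \<Longrightarrow> v \<in> L \<Longrightarrow> \<exists>m n. (g ^^ m) u = (g ^^ n) v"
    and nonempty: "L \<noteq> {}"
    and L_period: "M \<le> u \<Longrightarrow> u + P \<in> L \<longleftrightarrow> u \<in> L"
    and shift_or_const: "u \<in> L \<Longrightarrow> M \<le> u \<Longrightarrow> shift_at g P u \<or> (const_at g P u \<and> g u < M)"
    and hit: "u \<in> L \<Longrightarrow> \<exists>i. ((g ^^ i) u < M + P \<or> const_at g P ((g ^^ i) u) \<or>
                inward_at g P ((g ^^ i) u) \<or> outward_at g P ((g ^^ i) u)) \<and> (\<forall>k\<le>i. u \<le> (g ^^ k) u + Q)"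
begin

lemma iter_closed: "u \<in> L \<Longrightarrow> (g ^^ i) u \<in> L"
  by (induction i) (auto intro: g_closed)

lemma L_shift: "M \<le> u \<Longrightarrow> u + j * P \<in> L \<longleftrightarrow> u \<in> L"
proof (induction j)
  case (Suc j)
  then show ?case using L_period[of "u + j * P"] by (simp add: add_ac)
qed simp

lemma not_shift_and_const: "shift_at g P u \<Longrightarrow> const_at g P u \<Longrightarrow> False"
  using P_pos unfolding shift_at_def const_at_def by (metis add_0_right add_left_cancel mult_1 nat_less_le)

text \<open>The margin of one period beyond \<open>M\<close> is there so that a vertex outside
  \<open>low\<close> can be lowered by \<open>P\<close> without falling below the threshold.\<close>

definition low :: "nat set" where "low = {u \<in> L. u < M + P}"

lemma finite_low: "finite low"
  by (rule finite_subset[of _ "{..<M + P}"]) (auto simp: low_def)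

lemma const_low: "v \<in> L \<Longrightarrow> M \<le> v \<Longrightarrow> const_at g P v \<Longrightarrow> g v \<in> low"
  using shift_or_const[of v] not_shift_and_const[of v] g_closed[of v] by (auto simp: low_def)

definition basin :: "nat \<Rightarrow> nat set" where "basin c = {u \<in> L. \<exists>m. (g ^^ m) u = c}"

lemma basin_self: "c \<in> L \<Longrightarrow> c \<in> basin c"
  unfolding basin_def by (auto intro: exI[of _ 0])

lemma basin_iter: "(g ^^ i) u \<in> basin c \<Longrightarrow> u \<in> L \<Longrightarrow> u \<in> basin c"
  unfolding basin_def by (auto simp flip: funpow_plus)

lemma basin_trans: "u \<in> basin v \<Longrightarrow> v \<in> basin c \<Longrightarrow> u \<in> basin c"
  using basin_iter unfolding basin_def by blast

lemma basinI: "u \<in> L \<Longrightarrow> (g ^^ i) u = c \<Longrightarrow> u \<in> basin c"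
  unfolding basin_def by blast

lemma basin_g: "u \<in> basin c \<Longrightarrow> u \<noteq> c \<Longrightarrow> g u \<in> basin c"
proof -
  assume u: "u \<in> basin c" "u \<noteq> c"
  then obtain m where m: "(g ^^ m) u = c" "u \<in> L" unfolding basin_def by blast
  then obtain k where "m = Suc k" using u by (cases m) auto
  then show ?thesis using m g_closed by (intro basinI[of _ k]) (auto simp: funpow_swap1)
qed

text \<open>The first \<open>m\<close> steps use only shift columns, so they commute with raising by
  \<open>P\<close>; the margin above \<open>M\<close> makes them commute with lowering by
  \<open>P\<close> too.\<close>

definition clean :: "nat \<Rightarrow> nat \<Rightarrow> bool" where
  "clean u m \<longleftrightarrow> (\<forall>i<m. M + P \<le> (g ^^ i) u \<and> shift_at g P ((g ^^ i) u))"

text \<open>A constant column maps into \<open>low\<close>. Avoiding \<open>low\<close> up to index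
  \<open>m\<close> inclusive therefore rules out constant columns before \<open>m\<close>.\<close>

lemma clean_if_not_low:
  assumes "u \<in> L" "\<And>i. i \<le> m \<Longrightarrow> (g ^^ i) u \<notin> low"
  shows "clean u m"
  unfolding clean_def
proof (intro allI impI)
  fix i assume i: "i < m"
  have iL: "(g ^^ i) u \<in> L" using iter_closed assms(1) .
  then have ge: "M + P \<le> (g ^^ i) u" using assms(2)[of i] i by (simp add: low_def)
  have "g ((g ^^ i) u) \<notin> low" using assms(2)[of "Suc i"] i by simp
  then have "shift_at g P ((g ^^ i) u)"
    using shift_or_const[OF iL] const_low[OF iL] ge by auto
  then show "M + P \<le> (g ^^ i) u \<and> shift_at g P ((g ^^ i) u)" using ge by blast
qed

lemma clean_up:
  assumes "clean u m" "i \<le> m"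
  shows "(g ^^ i) (u + j * P) = (g ^^ i) u + j * P"
  using assms(2)
proof (induction i)
  case (Suc i)
  then have "(g ^^ i) (u + j * P) = (g ^^ i) u + j * P" by simp
  moreover have "shift_at g P ((g ^^ i) u)" using assms(1) Suc.prems unfolding clean_def by simp
  ultimately show ?case unfolding shift_at_def by simp
qed simp

text \<open>One period below a shift column at least at \<open>M + P\<close> the column is again
  shift or constant. Constancy would spread upwards to the shift column, so it is shift.\<close>

lemma clean_down:
  assumes "clean u m" "u \<in> L" "M + P \<le> u" "i \<le> m"
  shows "(g ^^ i) (u - P) + P = (g ^^ i) u"
  using assms(4)
proof (induction i)
  case 0
  then show ?case using assms(3) by simp
next
  case (Suc i)
  define w where "w = (g ^^ i) u"
  define w' where "w' = (g ^^ i) (u - P)"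
  have w: "w = w' + P" using Suc by (simp add: w_def w'_def)
  have ge: "M + P \<le> w" and sh: "shift_at g P w"
    using assms(1) Suc.prems unfolding clean_def w_def by simp_all
  have "w \<in> L" unfolding w_def using iter_closed assms(2) .
  then have w'L: "w' \<in> L" using L_period[of w'] w ge by simp
  have "\<not> const_at g P w'"
  proof
    assume c: "const_at g P w'"
    have "g (w' + 1 * P) = g w'" "g (w' + Suc 1 * P) = g w'" using c unfolding const_at_def by blast+
    moreover have "g (w + 1 * P) = g w + 1 * P" using sh unfolding shift_at_def by blast
    ultimately show False using w P_pos by (simp add: add_ac)
  qed
  then have "shift_at g P w'" using shift_or_const[OF w'L] w ge by auto
  then have "g (w' + 1 * P) = g w' + 1 * P" unfolding shift_at_def by blast
  then show ?case using w by (simp add: w_def w'_def)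
qed

section \<open>Constant and inward columns far out\<close>

definition good :: "nat \<Rightarrow> bool" where
  "good v \<longleftrightarrow> v \<in> L \<and> M \<le> v \<and> (const_at g P v \<or> inward_at g P v)"

lemma const_at_up: "const_at g P v \<Longrightarrow> const_at g P (v + j * P)"
  unfolding const_at_def by (metis add.assoc add_mult_distrib)

lemma inward_at_up: "inward_at g P v \<Longrightarrow> inward_at g P (v + j * P)"
  unfolding inward_at_def
proof (elim exE conjE)
  fix n assume n: "0 < n" "\<forall>k. (g ^^ n) (v + Suc k * P) = v + k * P"
  have "(g ^^ n) (v + j * P + Suc k * P) = v + j * P + k * P" for k
    using n(2)[rule_format, of "j + k"] by (simp add: algebra_simps)
  then show "\<exists>n>0. \<forall>k. (g ^^ n) (v + j * P + Suc k * P) = v + j * P + k * P" using n by blast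
qed

lemma good_up: "good v \<Longrightarrow> good (v + j * P)"
  unfolding good_def using L_shift[of v j] const_at_up inward_at_up by auto

lemma const_at_down:
  assumes "const_at g P (v + j * P)" "v \<in> L" "M \<le> v"
  shows "const_at g P v"
proof (rule ccontr)
  assume "\<not> const_at g P v"
  then have sh: "shift_at g P v" using shift_or_const[OF assms(2,3)] by blast
  have "g (v + j * P + 1 * P) = g (v + j * P)" using assms(1) unfolding const_at_def by blast
  moreover have "g (v + Suc j * P) = g v + Suc j * P" "g (v + j * P) = g v + j * P"
    using sh unfolding shift_at_def by blast+
  ultimately show False using P_pos by (simp add: algebra_simps)
qed

end

text \<open>\<open>N\<close> puts the columns to be cut off beyond the reach of \<open>low\<close>
  and of cycles. It is assumed here because it is obtained differently in the two cases: with a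
  cycle all forward orbits are finite, while without one the orbits of \<open>low\<close> end in a
  spine that contains no good point.\<close>

locale high_columns = columns +
  fixes N :: nat
  assumes N_ge: "M + P \<le> N"
    and N_low: "good c \<Longrightarrow> N \<le> c \<Longrightarrow> l \<in> low \<Longrightarrow> (g ^^ i) l \<noteq> c"
    and N_acyclic: "good c \<Longrightarrow> N \<le> c \<Longrightarrow> 0 < i \<Longrightarrow> (g ^^ i) c \<noteq> c"
begin

definition peak :: "nat \<Rightarrow> bool" where "peak c \<longleftrightarrow> good c \<and> N \<le> c"

lemma peak_up: "peak c \<Longrightarrow> peak (c + j * P)"
  unfolding peak_def using good_up by auto

lemma peakD: "peak c \<Longrightarrow> c \<in> L" "peak c \<Longrightarrow> M + P \<le> c" "peak c \<Longrightarrow> N \<le> c"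
  unfolding peak_def good_def using N_ge by auto

lemma peak_not_low: "peak c \<Longrightarrow> l \<in> low \<Longrightarrow> (g ^^ i) l \<noteq> c"
  unfolding peak_def using N_low by blast

lemma peak_acyclic: "peak c \<Longrightarrow> 0 < i \<Longrightarrow> (g ^^ i) c \<noteq> c"
  unfolding peak_def using N_acyclic by blast

text \<open>An orbit that has met \<open>low\<close> reaches no peak any more, so the whole path
  into a peak is clean. This makes the basins of \<open>c\<close> and \<open>c + P\<close>
  translates of each other.\<close>

lemma peak_clean:
  assumes "peak c" "u \<in> L" "(g ^^ m) u = c"
  shows "clean u m" "M + P \<le> u"
proof -
  have nl: "(g ^^ i) u \<notin> low" if "i \<le> m" for i
  proof
    assume "(g ^^ i) u \<in> low"
    moreover have "(g ^^ (m - i)) ((g ^^ i) u) = c" using assms(3) that by (simp flip: funpow_plus)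
    ultimately show False using peak_not_low[OF assms(1)] by blast
  qed
  then show "clean u m" using clean_if_not_low[OF assms(2)] by blast
  show "M + P \<le> u" using nl[of 0] assms(2) by (simp add: low_def)
qed

lemma basin_up:
  assumes "peak c" "u \<in> basin c"
  shows "u + j * P \<in> basin (c + j * P)"
proof -
  obtain m where m: "u \<in> L" "(g ^^ m) u = c" using assms(2) unfolding basin_def by blast
  note cl = peak_clean[OF assms(1) m]
  have "(g ^^ m) (u + j * P) = c + j * P" using clean_up[OF cl(1), of m j] m by simp
  moreover have "u + j * P \<in> L" using L_shift[of u j] m cl(2) by simp
  ultimately show ?thesis by (intro basinI) auto
qed

lemma basin_down1:
  assumes "peak c" "u \<in> basin (c + P)"
  shows "\<exists>u'\<in>basin c. u = u' + P"
proof -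
  obtain m where m: "u \<in> L" "(g ^^ m) u = c + P" using assms(2) unfolding basin_def by blast
  have "peak (c + P)" using peak_up[OF assms(1), of 1] by simp
  note cl = peak_clean[OF this m]
  have "(g ^^ m) (u - P) + P = c + P" using clean_down[OF cl(1) m(1) cl(2), of m] m by simp
  moreover have "u - P \<in> L" using L_period[of "u - P"] m cl(2) by simp
  ultimately have "u - P \<in> basin c" by (intro basinI[of _ m]) auto
  moreover have "u = u - P + P" using cl(2) by simp
  ultimately show ?thesis by blast
qed

lemma basin_down:
  assumes "peak c" "u \<in> basin (c + j * P)"
  shows "\<exists>u'\<in>basin c. u = u' + j * P"
  using assms(2)
proof (induction j arbitrary: u)
  case (Suc j)
  have "u \<in> basin (c + j * P + P)" using Suc.prems by (simp add: add_ac)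
  then obtain u1 where u1: "u1 \<in> basin (c + j * P)" "u = u1 + P" using basin_down1[OF peak_up[OF assms(1)]] by blast
  then obtain u' where "u' \<in> basin c" "u1 = u' + j * P" using Suc.IH by blast
  then show ?case using u1(2) by (intro bexI[of _ u']) auto
qed auto

text \<open>\<open>inward_at\<close> does not say where \<open>d\<close> itself goes. The path from
  \<open>d + P\<close> to \<open>d\<close> is clean, so lowering it by \<open>P\<close> gives a path
  from \<open>d\<close> to \<open>d - P\<close>, and the column extends downwards.\<close>

lemma inward_down:
  assumes d: "peak d" "inward_at g P d" "N + P \<le> d"
  shows "peak (d - P)" "inward_at g P (d - P)" "\<exists>n>0. (g ^^ n) d = d - P"
proof -
  define e where "e = d - P"
  have e: "d = e + P" "N \<le> e" "M \<le> e" using d N_ge by (auto simp: e_def)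
  have eL: "e \<in> L" using L_period[of e] e peakD(1)[OF d(1)] by simp
  obtain n where n: "0 < n" "\<And>j. (g ^^ n) (d + Suc j * P) = d + j * P"
    using d(2) unfolding inward_at_def by blast
  have 0: "(g ^^ n) (d + P) = d" using n(2)[of 0] by simp
  have dP: "d + P \<in> L" using L_period[of d] peakD[OF d(1)] by simp
  note cl = peak_clean[OF d(1) dP 0]
  have de: "(g ^^ n) d = e" using clean_down[OF cl(1) dP cl(2), of n] 0 e by simp
  have "(g ^^ n) (e + Suc j * P) = e + j * P" for j
  proof (cases j)
    case 0
    then show ?thesis using de e by simp
  next
    case (Suc k)
    then show ?thesis using n(2)[of k] e by (simp add: algebra_simps)
  qed
  then have in_e: "inward_at g P e" unfolding inward_at_def using n(1) by blast
  then show "inward_at g P (d - P)" unfolding e_def .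
  show "peak (d - P)" unfolding e_def[symmetric] peak_def good_def using in_e eL e(2,3) by simp
  show "\<exists>n>0. (g ^^ n) d = d - P" unfolding e_def[symmetric] using n(1) de by blast
qed

lemma inward_reduce:
  assumes "peak c" "inward_at g P c"
  shows "\<exists>i. peak ((g ^^ i) c) \<and> inward_at g P ((g ^^ i) c) \<and> (g ^^ i) c < N + P"
  using assms
proof (induction c rule: less_induct)
  case (less c)
  show ?case
  proof (cases "c < N + P")
    case True
    then show ?thesis using less.prems by (intro exI[of _ 0]) auto
  next
    case False
    then have ge: "N + P \<le> c" by simp
    obtain n where n: "(g ^^ n) c = c - P" using inward_down(3)[OF less.prems ge] by blast
    have "c - P < c" using ge P_pos by simp
    from less.IH[OF this inward_down(1,2)[OF less.prems ge]] obtain i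
      where "peak ((g ^^ i) (c - P)) \<and> inward_at g P ((g ^^ i) (c - P)) \<and> (g ^^ i) (c - P) < N + P" by blast
    then show ?thesis using n by (intro exI[of _ "i + n"]) (simp add: funpow_plus)
  qed
qed

text \<open>Peaks may flow into further peaks. Cutting at the last one makes the cut on every orbit
  unique and leaves \<open>g c\<close> outside everything that is cut off.\<close>

definition last_peak :: "nat \<Rightarrow> bool" where
  "last_peak c \<longleftrightarrow> peak c \<and> (\<forall>i>0. \<not> peak ((g ^^ i) c))"

lemma const_last_peak:
  assumes "peak c" "const_at g P c"
  shows "last_peak c"
proof -
  have "\<not> peak ((g ^^ i) c)" if i: "0 < i" for i
  proof
    assume t: "peak ((g ^^ i) c)"
    obtain k where k: "i = Suc k" using i by (cases i) auto
    have "g c \<in> low" using const_low[OF _ _ assms(2)] peakD[OF assms(1)] by simp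
    then show False using peak_not_low[OF t, of "g c" k] k by (simp add: funpow_swap1)
  qed
  then show ?thesis unfolding last_peak_def using assms by blast
qed

lemma last_peak_unique:
  assumes "last_peak c" "last_peak c'" "u \<in> basin c" "u \<in> basin c'"
  shows "c = c'"
proof -
  obtain m m' where m: "(g ^^ m) u = c" "(g ^^ m') u = c'" using assms unfolding basin_def by blast
  have "\<not> m < m'"
  proof
    assume "m < m'"
    then have "(g ^^ (m' - m)) c = c'" "0 < m' - m" using m by (auto simp flip: funpow_plus)
    then show False using assms unfolding last_peak_def by blast
  qed
  moreover have "\<not> m' < m"
  proof
    assume "m' < m"
    then have "(g ^^ (m - m')) c' = c" "0 < m - m'" using m by (auto simp flip: funpow_plus)
    then show False using assms unfolding last_peak_def by blast
  qed
  ultimately have "m = m'" by simp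
  then show ?thesis using m by simp
qed

text \<open>Peaks are at least \<open>N\<close>, so the bound \<open>N + P\<close> leaves at most
  one head per residue modulo \<open>P\<close>.\<close>

definition heads :: "nat set" where
  "heads = {d. last_peak d \<and> d < N + P}"

text \<open>For an inward column the basins decrease with \<open>j\<close> and the union is just
  \<open>basin d\<close>; for a constant column they are pairwise disjoint. The union treats stars
  and paths alike.\<close>

definition branch :: "nat \<Rightarrow> nat set" where
  "branch d = (\<Union>j. basin (d + j * P))"

text \<open>The vertex set of the template without its base point. The translates by multiples of
  \<open>P\<close> tile the branch; for a constant column the piece is all of
  \<open>basin d\<close>.\<close>

definition piece :: "nat \<Rightarrow> nat set" where
  "piece d = basin d - basin (d + P)"

definition base :: "nat set" where
  "base = L - (\<Union>d\<in>heads. branch d)"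

lemma finite_heads: "finite heads"
  by (rule finite_subset[of _ "{..<N + P}"]) (auto simp: heads_def)

lemma headsD: "d \<in> heads \<Longrightarrow> peak d" "d \<in> heads \<Longrightarrow> last_peak d"
  unfolding heads_def last_peak_def by auto

lemma branch_iter: "(g ^^ i) u \<in> branch d \<Longrightarrow> u \<in> L \<Longrightarrow> u \<in> branch d"
  unfolding branch_def using basin_iter by blast

lemma const_covered:
  assumes "peak c" "const_at g P c"
  shows "\<exists>d\<in>heads. c \<in> branch d"
proof -
  define j where "j = (c - N) div P"
  define d where "d = N + (c - N) mod P"
  have c: "c = d + j * P" using peakD(3)[OF assms(1)] by (simp add: d_def j_def)
  have d: "N \<le> d" "d < N + P" "M \<le> d" using P_pos N_ge by (simp_all add: d_def)
  have dL: "d \<in> L" using L_shift[of d j] d c peakD(1)[OF assms(1)] by simp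
  have "const_at g P d" using const_at_down assms(2) dL d unfolding c by blast
  then have "last_peak d" using const_last_peak dL d by (simp add: peak_def good_def)
  then have "d \<in> heads" using d by (simp add: heads_def)
  moreover have "c \<in> branch d" unfolding branch_def c[symmetric] using basin_self[OF peakD(1)[OF assms(1)]] c by blast
  ultimately show ?thesis by blast
qed

text \<open>One passes to a later peak and brings it below \<open>N + P\<close> again. This ends
  because the set of points below \<open>N + P\<close> that still lie ahead shrinks strictly: a peak
  never returns to itself.\<close>

lemma inward_covered:
  assumes "peak c" "inward_at g P c" "c < N + P"
  shows "\<exists>d\<in>heads. c \<in> branch d"
  using assms
proof (induction "card {w. w < N + P \<and> (\<exists>i>0. (g ^^ i) c = w)}" arbitrary: c rule: less_induct)
  case less
  note cL = peakD(1)[OF less.prems(1)]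
  show ?case
  proof (cases "last_peak c")
    case True
    then have "c \<in> heads" using less.prems by (simp add: heads_def)
    moreover have "c \<in> branch c" using basin_self[OF cL] unfolding branch_def by (auto intro: exI[of _ 0])
    ultimately show ?thesis by blast
  next
    case False
    then obtain i where i: "0 < i" "peak ((g ^^ i) c)" using less.prems unfolding last_peak_def by blast
    have "const_at g P ((g ^^ i) c) \<or> inward_at g P ((g ^^ i) c)" using i(2) unfolding peak_def good_def by blast
    then show ?thesis
    proof
      assume "const_at g P ((g ^^ i) c)"
      then show ?thesis using const_covered[OF i(2)] branch_iter cL by blast
    next
      assume "inward_at g P ((g ^^ i) c)"
      then obtain k where "peak ((g ^^ k) ((g ^^ i) c))" "inward_at g P ((g ^^ k) ((g ^^ i) c))"
        "(g ^^ k) ((g ^^ i) c) < N + P"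
        using inward_reduce[OF i(2)] by blast
      moreover define w where "w = (g ^^ (k + i)) c"
      ultimately have w: "peak w" "inward_at g P w" "w < N + P" by (simp_all add: funpow_plus)
      have "{x. x < N + P \<and> (\<exists>i>0. (g ^^ i) w = x)} \<subset> {x. x < N + P \<and> (\<exists>i>0. (g ^^ i) c = x)}"
      proof
        show "{x. x < N + P \<and> (\<exists>i>0. (g ^^ i) w = x)} \<subseteq> {x. x < N + P \<and> (\<exists>i>0. (g ^^ i) c = x)}"
        proof clarify
          fix j :: nat assume "0 < j"
          then show "\<exists>i>0. (g ^^ i) c = (g ^^ j) w"
            unfolding w_def by (intro exI[of _ "j + (k + i)"]) (simp add: funpow_plus)
        qed
        have "w \<notin> {x. x < N + P \<and> (\<exists>i>0. (g ^^ i) w = x)}" using peak_acyclic[OF w(1)] by auto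
        moreover have "w \<in> {x. x < N + P \<and> (\<exists>i>0. (g ^^ i) c = x)}"
          using w i(1) by (auto simp: w_def intro!: exI[of _ "k + i"])
        ultimately show "{x. x < N + P \<and> (\<exists>i>0. (g ^^ i) w = x)} \<noteq> {x. x < N + P \<and> (\<exists>i>0. (g ^^ i) c = x)}"
          by blast
      qed
      then have "card {x. x < N + P \<and> (\<exists>i>0. (g ^^ i) w = x)} < card {x. x < N + P \<and> (\<exists>i>0. (g ^^ i) c = x)}"
        by (intro psubset_card_mono) auto
      from less.hyps[OF this w] show ?thesis using branch_iter cL unfolding w_def by blast
    qed
  qed
qed

lemma peak_covered:
  assumes "peak c"
  shows "\<exists>d\<in>heads. c \<in> branch d"
proof (cases "const_at g P c")
  case True
  then show ?thesis using const_covered assms by blast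
next
  case False
  then have "inward_at g P c" using assms unfolding peak_def good_def by blast
  then obtain i where "peak ((g ^^ i) c)" "inward_at g P ((g ^^ i) c)" "(g ^^ i) c < N + P"
    using inward_reduce[OF assms] by blast
  then show ?thesis using inward_covered branch_iter peakD(1)[OF assms] by blast
qed

text \<open>Every peak lies in a branch and branches contain all preimages of their points. So
  removing the branches of the finitely many heads removes every orbit that passes any peak at
  all.\<close>

lemma base_iff: "u \<in> base \<longleftrightarrow> u \<in> L \<and> (\<forall>i. \<not> peak ((g ^^ i) u))"
proof
  assume u: "u \<in> base"
  then show "u \<in> L \<and> (\<forall>i. \<not> peak ((g ^^ i) u))"
    using peak_covered branch_iter unfolding base_def by blast
next
  assume u: "u \<in> L \<and> (\<forall>i. \<not> peak ((g ^^ i) u))"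
  have "u \<notin> branch d" if "d \<in> heads" for d
  proof
    assume "u \<in> branch d"
    then obtain j m where "(g ^^ m) u = d + j * P" unfolding branch_def basin_def by blast
    then show False using u peak_up[OF headsD(1)[OF that], of j] by metis
  qed
  then show "u \<in> base" unfolding base_def using u by blast
qed

lemma base_closed: "u \<in> base \<Longrightarrow> g u \<in> base"
proof -
  assume u: "u \<in> base"
  have "\<not> peak ((g ^^ i) (g u))" for i
    using u base_iff[of u] by (metis funpow_simps_right(2) o_apply)
  then show "g u \<in> base" using u base_iff g_closed by blast
qed

lemma g_head_base: "d \<in> heads \<Longrightarrow> g d \<in> base"
proof -
  assume d: "d \<in> heads"
  have "\<not> peak ((g ^^ i) (g d))" for i
    using headsD(2)[OF d] unfolding last_peak_def by (metis funpow_simps_right(2) o_apply zero_less_Suc)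
  then show "g d \<in> base" using base_iff g_closed peakD(1)[OF headsD(1)[OF d]] by blast
qed

lemma head_cases:
  assumes "d \<in> heads"
  obtains (const) "const_at g P d" | (inward) n where "0 < n" "\<And>j. (g ^^ n) (d + Suc j * P) = d + j * P"
  using headsD(1)[OF assms] unfolding peak_def good_def inward_at_def by blast

lemma branch_last_peak:
  assumes "d \<in> heads" "u \<in> basin (d + j * P)"
  shows "\<exists>k. last_peak (d + k * P) \<and> u \<in> basin (d + k * P)"
  using assms(1)
proof (cases rule: head_cases)
  case const
  then show ?thesis
    using const_last_peak[OF peak_up[OF headsD(1)[OF assms(1)]] const_at_up] assms(2) by blast
next
  case (inward n)
  have "d + j * P \<in> basin d" for j
  proof (induction j)
    case 0
    then show ?case using basin_self peakD(1)[OF headsD(1)[OF assms(1)]] by simp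
  next
    case (Suc j)
    have "d + Suc j * P \<in> L" using peakD(1)[OF peak_up[OF headsD(1)[OF assms(1)]]] .
    then show ?case using Suc basin_iter inward(2)[of j] by metis
  qed
  then have "u \<in> basin (d + 0 * P)" using assms(2) basin_trans by simp
  then show ?thesis using headsD(2)[OF assms(1)] by (intro exI[of _ 0]) simp
qed

lemma branch_disjoint:
  assumes "d \<in> heads" "d' \<in> heads" "d \<noteq> d'"
  shows "branch d \<inter> branch d' = {}"
proof (rule ccontr)
  assume "branch d \<inter> branch d' \<noteq> {}"
  then obtain u j j' where "u \<in> basin (d + j * P)" "u \<in> basin (d' + j' * P)" unfolding branch_def by blast
  then obtain k k' where "last_peak (d + k * P)" "u \<in> basin (d + k * P)"
    "last_peak (d' + k' * P)" "u \<in> basin (d' + k' * P)" using branch_last_peak assms by meson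
  then have eq: "d + k * P = d' + k' * P" using last_peak_unique by blast
  \<comment> \<open>Both heads lie in the window from \<open>N\<close> to \<open>N + P\<close>, so
    being congruent modulo \<open>P\<close> makes them equal.\<close>
  obtain x y where xy: "d = N + x" "d' = N + y" "x < P" "y < P"
    using assms peakD(3)[OF headsD(1)] unfolding heads_def by (auto simp: le_iff_add) (metis le_Suc_ex nat_add_left_cancel_less)
  then have "(x + k * P) mod P = (y + k' * P) mod P" using eq by simp
  then show False using xy assms(3) by simp
qed

text \<open>Needed for the disjointness of the translated pieces. On an inward column the way from
  \<open>d + Suc k * P\<close> leads through \<open>d + P\<close>; on a constant one the hypotheses
  contradict the uniqueness of the last peak.\<close>

lemma basin_head_inter:
  assumes d: "d \<in> heads" and v: "v \<in> basin d" "v \<in> basin (d + Suc k * P)"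
  shows "v \<in> basin (d + P)"
  using d
proof (cases rule: head_cases)
  case const
  have "last_peak (d + Suc k * P)"
    using const_last_peak[OF peak_up[OF headsD(1)[OF d]] const_at_up] const by blast
  then have "d = d + Suc k * P" using last_peak_unique headsD(2)[OF d] v by blast
  then show ?thesis using P_pos by simp
next
  case (inward n)
  have "d + Suc k * P \<in> basin (d + P)" for k
  proof (induction k)
    case 0
    then show ?case using basin_self peakD(1)[OF peak_up[OF headsD(1)[OF d], of 1]] by simp
  next
    case (Suc k)
    have "d + Suc (Suc k) * P \<in> L" using peakD(1)[OF peak_up[OF headsD(1)[OF d]]] .
    then show ?case using Suc basin_iter inward(2)[of "Suc k"] by metis
  qed
  then show ?thesis using v(2) basin_trans by blast
qed

text \<open>The translate containing \<open>u\<close> is given by the largest \<open>j\<close> with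
  \<open>u\<close> in the basin of \<open>d + j * P\<close>. It exists because members of that basin
  are at least \<open>j * P\<close>.\<close>

lemma branch_pieces: "d \<in> heads \<Longrightarrow> branch d = {v + j * P | v j. v \<in> piece d}"
proof
  assume d: "d \<in> heads"
  note t = headsD(1)[OF d]
  show "{v + j * P | v j. v \<in> piece d} \<subseteq> branch d"
    unfolding piece_def branch_def using basin_up[OF t] by blast
  show "branch d \<subseteq> {v + j * P | v j. v \<in> piece d}"
  proof
    fix u assume "u \<in> branch d"
    then obtain j0 where j0: "u \<in> basin (d + j0 * P)" unfolding branch_def by blast
    have bound: "j \<le> u" if uj: "u \<in> basin (d + j * P)" for j
    proof -
      obtain u' where "u = u' + j * P" using basin_down[OF t uj] by blast
      then show ?thesis using P_pos by (simp add: trans_le_add2)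
    qed
    obtain j where j: "u \<in> basin (d + j * P)" "\<And>k. u \<in> basin (d + k * P) \<Longrightarrow> k \<le> j"
      using GreatestI_ex_nat[of "\<lambda>j. u \<in> basin (d + j * P)" u] Greatest_le_nat[of "\<lambda>j. u \<in> basin (d + j * P)" _ u]
        j0 bound by blast
    obtain v where v: "v \<in> basin d" "u = v + j * P" using basin_down[OF t j(1)] by blast
    have "v \<notin> basin (d + P)"
    proof
      assume "v \<in> basin (d + P)"
      then have "u \<in> basin (d + P + j * P)" using basin_up[of "d + P" v j] peak_up[OF t, of 1] v by simp
      then have "u \<in> basin (d + Suc j * P)" by (simp add: add_ac)
      then show False using j(2)[of "Suc j"] by simp
    qed
    then show "u \<in> {v + j * P | v j. v \<in> piece d}" using v unfolding piece_def by blast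
  qed
qed

lemma piece_inj:
  assumes d: "d \<in> heads" and v: "v \<in> piece d" "v' \<in> piece d" and eq: "v + j * P = v' + j' * P"
  shows "v = v' \<and> j = j'"
proof -
  have *: False if w: "w \<in> piece d" "w' \<in> piece d" "w + i * P = w' + i' * P" "i < i'" for w w' i i'
  proof -
    obtain k where k: "i' = i + Suc k" using w(4) less_iff_Suc_add by auto
    then have "w = w' + Suc k * P" using w(3) by (simp add: algebra_simps)
    then have "w \<in> basin (d + Suc k * P)" using basin_up[OF headsD(1)[OF d], of w' "Suc k"] w(2) by (simp add: piece_def)
    then show False using basin_head_inter[OF d] w(1) unfolding piece_def by blast
  qed
  have "\<not> j < j'" "\<not> j' < j" using *[OF v eq] *[OF v(2,1) eq[symmetric]] by blast+
  then show ?thesis using eq by simp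
qed

lemma head_in_piece:
  assumes d: "d \<in> heads"
  shows "d \<in> piece d"
proof -
  have "d \<notin> basin (d + P)"
  proof
    assume "d \<in> basin (d + P)"
    then obtain m where m: "(g ^^ m) d = d + P" unfolding basin_def by blast
    have "peak (d + P)" using peak_up[OF headsD(1)[OF d], of 1] by simp
    moreover have "m \<noteq> 0" using m P_pos by (intro notI) simp
    ultimately show False using headsD(2)[OF d] m unfolding last_peak_def by (metis neq0_conv)
  qed
  then show ?thesis using basin_self peakD(1)[OF headsD(1)[OF d]] by (simp add: piece_def)
qed

lemma base_not_branch: "u \<in> base \<Longrightarrow> d \<in> heads \<Longrightarrow> u \<notin> branch d"
  unfolding base_def by blast

lemma piece_subset_branch: "piece d \<subseteq> branch d"
proof
  fix u assume "u \<in> piece d"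
  then have "u \<in> basin (d + 0 * P)" by (simp add: piece_def)
  then show "u \<in> branch d" unfolding branch_def by blast
qed

lemma g_head_not_piece: "d \<in> heads \<Longrightarrow> g d \<notin> piece d"
  using g_head_base base_not_branch piece_subset_branch by blast

lemma piece_step:
  assumes d: "d \<in> heads" and u: "u \<in> piece d" "u \<noteq> d"
  shows "g u \<in> piece d" "shift_at g P u"
proof -
  have uL: "u \<in> L" using u unfolding piece_def basin_def by blast
  show "g u \<in> piece d"
    using basin_g[of u d] basin_iter[of 1 u "d + P"] u uL unfolding piece_def by auto
  obtain m where m: "(g ^^ m) u = d" using u unfolding piece_def basin_def by blast
  then have "m \<noteq> 0" using u by (intro notI) simp
  then show "shift_at g P u" using peak_clean(1)[OF headsD(1)[OF d] uL m] unfolding clean_def by (auto dest: spec[of _ 0])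
qed

text \<open>This makes \<open>g d\<close> a leaf of the template: its only neighbour there is
  \<open>d\<close>.\<close>

lemma head_sibling:
  assumes d: "d \<in> heads" and u: "u \<in> piece d" "g u = g d"
  shows "u = d"
proof (rule ccontr)
  assume "u \<noteq> d"
  then have "g u \<in> piece d" using piece_step[OF d] u by blast
  then show False using g_head_not_piece[OF d] u by simp
qed

text \<open>\<open>g (d + P)\<close> is going to be the vertex \<open>t1\<close> of the template.
  For a constant column it equals \<open>t0 = g d\<close>, which gives a star. For an inward column
  it still flows into \<open>d\<close>, and by acyclicity not back into \<open>d + P\<close>, so it
  lies in the piece and gives a periodic path.\<close>

lemma second_attachment:
  assumes d: "d \<in> heads"
  shows "(g (d + P) = g d \<and> const_at g P d) \<or> (g (d + P) = g d + P \<and> shift_at g P d \<and> g (d + P) \<in> piece d)"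
  using d
proof (cases rule: head_cases)
  case const
  then have "g (d + 1 * P) = g d" unfolding const_at_def by blast
  then show ?thesis using const by simp
next
  case (inward n)
  note t = headsD(1)[OF d]
  have dPL: "d + P \<in> L" and tP: "peak (d + P)" using peak_up[OF t, of 1] peakD(1) by simp_all
  have nd: "(g ^^ n) (d + P) = d" using inward(2)[of 0] by simp
  then obtain m where m: "n = Suc m" using inward(1) by (cases n) auto
  have "(g ^^ m) (g (d + P)) = d" using nd m by (simp add: funpow_swap1)
  then have "g (d + P) \<in> basin d" using basinI g_closed[OF dPL] by blast
  moreover have "g (d + P) \<notin> basin (d + P)"
  proof
    assume "g (d + P) \<in> basin (d + P)"
    then obtain k where "(g ^^ k) (g (d + P)) = d + P" unfolding basin_def by blast
    then have "(g ^^ Suc k) (d + P) = d + P" by (simp add: funpow_swap1)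
    then show False using peak_acyclic[OF tP] by blast
  qed
  ultimately have p: "g (d + P) \<in> piece d" by (simp add: piece_def)
  have "\<not> const_at g P d"
  proof
    assume "const_at g P d"
    then have "g (d + 1 * P) = g d" unfolding const_at_def by blast
    then show False using p g_head_not_piece[OF d] by simp
  qed
  then have "shift_at g P d" using shift_or_const[OF peakD(1)[OF t]] peakD(2)[OF t] by simp
  moreover from this have "g (d + 1 * P) = g d + 1 * P" unfolding shift_at_def by blast
  ultimately show ?thesis using p by simp
qed

end

section \<open>The templates cut off at the heads\<close>

context high_columns
begin

text \<open>By \<open>hit\<close> the orbit of \<open>u\<close> meets a special vertex before
  dropping by more than \<open>Q\<close>. If it reaches \<open>d\<close> no later than that,
  \<open>u\<close> is at most \<open>d + Q\<close>. Otherwise the special vertex \<open>v\<close>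
  can only be inward, and then it lies on the one finite path from \<open>d + P\<close> to
  \<open>d\<close>, which bounds \<open>u\<close> as well.\<close>

lemma finite_piece:
  assumes d: "d \<in> heads"
  shows "finite (piece d)"
proof -
  note t = headsD(1)[OF d]
  have tP: "peak (d + P)" using peak_up[OF t, of 1] by simp
  have key: "u \<le> d + Q \<or> (\<exists>a m. a \<le> m \<and> 0 < m \<and> (g ^^ m) (d + P) = d \<and> u \<le> (g ^^ (m - a)) (d + P) + Q)"
    if u: "u \<in> piece d" for u
  proof -
    have uL: "u \<in> L" using u unfolding piece_def basin_def by blast
    obtain s where s: "(g ^^ s) u = d" using u unfolding piece_def basin_def by blast
    obtain i where i: "(g ^^ i) u < M + P \<or> const_at g P ((g ^^ i) u) \<or>
                inward_at g P ((g ^^ i) u) \<or> outward_at g P ((g ^^ i) u)"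
      and iQ: "\<And>k. k \<le> i \<Longrightarrow> u \<le> (g ^^ k) u + Q" using hit[OF uL] by blast
    show ?thesis
    proof (cases "s \<le> i")
      case True
      then show ?thesis using iQ[of s] s by simp
    next
      case False
      define v where "v = (g ^^ i) u"
      define a where "a = s - i"
      have a: "0 < a" "(g ^^ a) v = d" using s False by (auto simp: a_def v_def simp flip: funpow_plus)
      have vL: "v \<in> L" unfolding v_def using iter_closed uL .
      note cl = peak_clean[OF t vL a(2)]
      have up: "(g ^^ a) (v + P) = d + P" using clean_up[OF cl(1), of a 1] a by simp
      have nc: "\<not> const_at g P v"
      proof
        assume "const_at g P v"
        then have "g v \<in> low" using const_low[OF vL] cl(2) by simp
        moreover obtain b where "a = Suc b" using a(1) by (cases a) auto
        ultimately show False using peak_not_low[OF t, of "g v" b] a(2) by (simp add: funpow_swap1)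
      qed
      \<comment> \<open>Followed down the path from \<open>v\<close> to \<open>d\<close>, the way
        from \<open>v\<close> to \<open>v + P\<close> becomes one from \<open>d\<close> to
        \<open>d + P\<close>, a later peak.\<close>
      have no: "\<not> outward_at g P v"
      proof
        assume "outward_at g P v"
        then obtain n where n: "0 < n" "(g ^^ n) (v + 0 * P) = v + Suc 0 * P" unfolding outward_at_def by blast
        have "(g ^^ n) d = (g ^^ (n + a)) v" using a(2) by (simp add: funpow_plus)
        also have "\<dots> = (g ^^ a) ((g ^^ n) v)" by (simp add: add.commute[of n] funpow_plus)
        also have "\<dots> = d + P" using n up by simp
        finally show False using headsD(2)[OF d] tP n(1) unfolding last_peak_def by metis
      qed
      \<comment> \<open>By elimination; the way from \<open>v + P\<close> back to \<open>v\<close>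
        then carries over to one from \<open>d + P\<close> to \<open>d\<close> with the same number
        of steps.\<close>
      have "inward_at g P v" using i nc no cl(2) unfolding v_def by linarith
      then obtain m where m: "0 < m" "(g ^^ m) (v + Suc 0 * P) = v + 0 * P" unfolding inward_at_def by blast
      then have mv: "(g ^^ m) (v + P) = v" by simp
      have "(g ^^ m) (d + P) = (g ^^ (m + a)) (v + P)" using up by (simp add: funpow_plus)
      also have "\<dots> = (g ^^ a) ((g ^^ m) (v + P))" by (simp add: add.commute[of m] funpow_plus)
      finally have md: "(g ^^ m) (d + P) = d" using mv a(2) by simp
      \<comment> \<open>Otherwise the path from \<open>v + P\<close> to \<open>d + P\<close> would
        pass \<open>v\<close> first, so that \<open>u\<close> would flow into \<open>d + P\<close>,
        which its piece excludes.\<close>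
      have "a \<le> m"
      proof (rule ccontr)
        assume "\<not> a \<le> m"
        then have "(g ^^ (a - m)) v = d + P" using mv up by (metis funpow_plus le_add_diff_inverse2 nat_le_linear)
        then have "v \<in> basin (d + P)" using basinI vL by blast
        then show False using basin_iter[of i u] uL u unfolding v_def piece_def by blast
      qed
      then have "v = (g ^^ (m - a)) (d + P)" using mv up by (metis funpow_plus le_add_diff_inverse2)
      then show ?thesis using \<open>a \<le> m\<close> m(1) md iQ[of i] unfolding v_def by auto
    qed
  qed
  show ?thesis using d
  proof (cases rule: head_cases)
    case const
    have "u \<le> d + Q" if u: "u \<in> piece d" for u
    proof (rule ccontr)
      assume "\<not> u \<le> d + Q"
      then obtain m where m: "0 < m" "(g ^^ m) (d + P) = d" using key[OF u] by blast
      obtain k where k: "m = Suc k" using m(1) by (cases m) auto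
      have "g (d + 1 * P) = g d" using const unfolding const_at_def by blast
      then have "(g ^^ m) d = d" using m(2) k by (simp add: funpow_swap1)
      then show False using peak_acyclic[OF t m(1)] by blast
    qed
    then have "piece d \<subseteq> {..d + Q}" by auto
    then show ?thesis using finite_subset by blast
  next
    case (inward n)
    have nd: "(g ^^ n) (d + P) = d" using inward(2)[of 0] by simp
    have "u \<le> d + Q + (\<Sum>k\<le>n. (g ^^ k) (d + P))" if "u \<in> piece d" for u
      using key[OF that]
    proof
      assume "\<exists>a m. a \<le> m \<and> 0 < m \<and> (g ^^ m) (d + P) = d \<and> u \<le> (g ^^ (m - a)) (d + P) + Q"
      then obtain a m where m: "a \<le> m" "(g ^^ m) (d + P) = d" "u \<le> (g ^^ (m - a)) (d + P) + Q" by blast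
      \<comment> \<open>Two different step counts from \<open>d + P\<close> to \<open>d\<close>
        would put \<open>d\<close> on a cycle. Hence \<open>m = n\<close>, which does not depend on
        \<open>u\<close>.\<close>
      have eq: "(g ^^ (y - x)) d = d" if "x < y" "(g ^^ x) (d + P) = d" "(g ^^ y) (d + P) = d" for x y
        using that by (metis funpow_plus le_add_diff_inverse2 less_imp_le)
      have "\<not> m < n" "\<not> n < m" using eq[OF _ m(2) nd] eq[OF _ nd m(2)] peak_acyclic[OF t] by auto
      then have "m - a \<le> n" by simp
      then have "(g ^^ (m - a)) (d + P) \<le> (\<Sum>k\<le>n. (g ^^ k) (d + P))"
        by (intro member_le_sum[where f = "\<lambda>k. (g ^^ k) (d + P)"]) auto
      then show ?thesis using m(3) by simp
    qed simp
    then have "piece d \<subseteq> {..d + Q + (\<Sum>k\<le>n. (g ^^ k) (d + P))}" by auto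
    then show ?thesis using finite_subset by blast
  qed
qed

text \<open>The root is \<open>g d\<close> and not \<open>d\<close>: a template needs a leaf as
  \<open>t0\<close>, and the point of attachment has to lie in \<open>base\<close>.\<close>

abbreviation "head_tree d \<equiv> insert (g d) (piece d)"
abbreviation "head_edges d \<equiv> {(u, g u) | u. u \<in> piece d}"

lemma head_template:
  assumes d: "d \<in> heads"
  shows "template (head_tree d) (head_edges d) (g d) (g (d + P))" "oriented_towards (head_edges d) (g d)"
proof -
  note nin = g_head_not_piece[OF d]
  have "inward_rooted_finite_tree (head_tree d) {(v, g v) | v. v \<in> head_tree d - {g d}} (g d)"
  proof (rule inward_rooted_finite_tree_parent)
    show "finite (head_tree d)" using finite_piece[OF d] by simp
    show "g v \<in> head_tree d" if "v \<in> head_tree d - {g d}" for v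
      using piece_step(1)[OF d, of v] that by (cases "v = d") auto
    show "\<exists>n. (g ^^ n) v = g d" if v: "v \<in> head_tree d" for v
    proof (cases "v = g d")
      case True
      then show ?thesis by (intro exI[of _ 0]) simp
    next
      case False
      then obtain m where "(g ^^ m) v = d" using v unfolding piece_def basin_def by blast
      then show ?thesis by (intro exI[of _ "Suc m"]) simp
    qed
  qed simp
  moreover have "head_tree d - {g d} = piece d" using nin by blast
  ultimately have tree: "inward_rooted_finite_tree (head_tree d) (head_edges d) (g d)" by simp
  then show "oriented_towards (head_edges d) (g d)" unfolding inward_rooted_finite_tree_def by blast
  have "{w. (g d, w) \<in> head_edges d \<union> (head_edges d)\<inverse>} = {d}"
    using nin head_sibling[OF d] head_in_piece[OF d] by auto
  then have "leaf (head_edges d) (g d)" unfolding leaf_def by simp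
  moreover have "g (d + P) \<in> head_tree d" using second_attachment[OF d] by auto
  ultimately show "template (head_tree d) (head_edges d) (g d) (g (d + P))"
    using tree unfolding template_def inward_rooted_finite_tree_def by simp
qed

abbreviation "head_graph d \<equiv> S_graph (head_tree d) (head_edges d) (g d) (g (d + P))"

lemma head_graph_vertices:
  assumes d: "d \<in> heads"
  shows "fst (head_graph d) = insert (0, g d) {(j, v) | j v. v \<in> piece d}"
proof -
  have "g (d + P) \<in> head_tree d" using head_template(1)[OF d] unfolding template_def by blast
  moreover have "head_tree d - {g d} = piece d" using g_head_not_piece[OF d] by blast
  ultimately show ?thesis using S_graph_vertices[of "g d" "head_tree d" "g (d + P)"] by simp
qed

text \<open>The vertex \<open>(j, w)\<close> of the template graph stands for
  \<open>w + j * P\<close>. The delicate edge leaves \<open>d\<close> in copy \<open>Suc i\<close>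
  of an inward column: it ends in \<open>(i, g (d + P))\<close>, and
  \<open>g (d + P) + i * P = g d + Suc i * P\<close>.\<close>

lemma head_graph_edge:
  assumes d: "d \<in> heads" and u: "u \<in> piece d"
  shows "\<exists>j' w. srep (g d) (g (d + P)) (j, g u) = (j', w) \<and> g (u + j * P) = w + j' * P"
proof (cases "u = d")
  case False
  have "g u \<noteq> g d" using head_sibling[OF d u] False by blast
  then show ?thesis
    using piece_step(2)[OF d u False] by (simp add: srep_simps shift_at_def)
next
  case True
  from second_attachment[OF d] show ?thesis
  proof
    assume c: "g (d + P) = g d \<and> const_at g P d"
    then show ?thesis using True by (simp add: srep_simps const_at_def)
  next
    assume c: "g (d + P) = g d + P \<and> shift_at g P d \<and> g (d + P) \<in> piece d"
    then have *: "g (d + j * P) = g d + j * P" unfolding shift_at_def by blast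
    have "g d \<noteq> g (d + P)" using c P_pos by simp
    then show ?thesis using True * c by (cases j) (simp_all add: srep_simps)
  qed
qed

lemma attach_heads:
  assumes B: "represents g base B \<psi>"
  shows "\<exists>G \<Psi>. attach_inward_comps B G \<and> represents g L G \<Psi>"
proof -
  define p where "p d = inv_into (fst B) \<psi> (g d)" for d
  define \<chi> :: "nat \<times> nat \<Rightarrow> nat" where "\<chi> = (\<lambda>(j, v). v + j * P)"
  \<comment> \<open>The heads are numbers and index the components themselves.\<close>
  let ?G = "attach_all B heads head_graph (\<lambda>d. (0, g d)) p"
  have \<psi>: "bij_betw \<psi> (fst B) base" using B unfolding represents_def by blast
  have p: "p d \<in> fst B \<and> \<psi> (p d) = g d" if "d \<in> heads" for d
    using g_head_base[OF that] \<psi> unfolding p_def bij_betw_def by (auto intro: inv_into_into f_inv_into_f)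
  have verts: "fst (head_graph d) - {(0, g d)} = {(j, v) | j v. v \<in> piece d}" if "d \<in> heads" for d
    using head_graph_vertices[OF that] g_head_not_piece[OF that] by auto
  have "represents g (base \<union> (\<Union>d\<in>heads. branch d)) ?G (case_sum \<psi> (\<lambda>(i, v). \<chi> v))"
  proof (rule represents_attach_all)
    show "bij_betw \<psi> (fst B) base" by (rule \<psi>)
    show "a \<in> fst B \<and> b \<in> fst B \<and> g (\<psi> a) = \<psi> b" if "(a, b) \<in> snd B" for a b
      using B that unfolding represents_def by blast
    show "(\<exists>b. (a, b) \<in> snd B) \<or> (\<exists>i\<in>heads. p i = a \<and> (\<exists>b. ((0, g i), b) \<in> snd (head_graph i)))"
      if "a \<in> fst B" for a
      using B that unfolding represents_def by blast
  next
    fix d assume d: "d \<in> heads"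
    show "p d \<in> fst B \<and> \<chi> (0, g d) = \<psi> (p d)" using p[OF d] by (simp add: \<chi>_def)
    show "inj_on \<chi> (fst (head_graph d) - {(0, g d)})"
    proof (rule inj_onI)
      fix x y assume xy: "x \<in> fst (head_graph d) - {(0, g d)}" "y \<in> fst (head_graph d) - {(0, g d)}" "\<chi> x = \<chi> y"
      obtain j v where x: "x = (j, v)" "v \<in> piece d" using xy(1) unfolding verts[OF d] by blast
      obtain j' v' where y: "y = (j', v')" "v' \<in> piece d" using xy(2) unfolding verts[OF d] by blast
      have "v + j * P = v' + j' * P" using xy(3) x(1) y(1) by (simp add: \<chi>_def)
      then show "x = y" using piece_inj[OF d x(2) y(2)] x(1) y(1) by simp
    qed
    show "\<chi> ` (fst (head_graph d) - {(0, g d)}) = branch d"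
      unfolding verts[OF d] branch_pieces[OF d] \<chi>_def by force
    show "base \<inter> branch d = {}" using base_not_branch d by blast
    show "branch d \<inter> branch d' = {}" if "d' \<in> heads" "d \<noteq> d'" for d'
      using branch_disjoint[OF d that] .
    show "a \<in> fst (head_graph d) \<and> b \<in> fst (head_graph d) \<and> g (\<chi> a) = \<chi> b"
      if "(a, b) \<in> snd (head_graph d)" for a b
    proof -
      obtain j u where u: "u \<in> piece d" "a = srep (g d) (g (d + P)) (j, u)" "b = srep (g d) (g (d + P)) (j, g u)"
        using \<open>(a, b) \<in> snd (head_graph d)\<close> unfolding S_graph_def by auto
      have "u \<noteq> g d" using u g_head_not_piece[OF d] by auto
      then have a: "a = (j, u)" using u by (simp add: srep_simps)
      have "g u \<in> head_tree d" using piece_step(1)[OF d u(1)] by (cases "u = d") auto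
      then have "b \<in> fst (head_graph d)" unfolding u(3) S_graph_def by auto
      moreover have "a \<in> fst (head_graph d)" unfolding a head_graph_vertices[OF d] using u(1) by simp
      ultimately show ?thesis using head_graph_edge[OF d u(1), of j] u(3) a by (auto simp: \<chi>_def)
    qed
    show "\<exists>b. (a, b) \<in> snd (head_graph d)" if a: "a \<in> fst (head_graph d)" "a \<noteq> (0, g d)" for a
    proof -
      obtain j v where v: "a = (j, v)" "v \<in> piece d" using a verts[OF d] by blast
      then have "v \<noteq> g d" using g_head_not_piece[OF d] by auto
      then have "a = srep (g d) (g (d + P)) (j, v)" using v(1) by (simp add: srep_simps)
      moreover have "(srep (g d) (g (d + P)) (j, v), srep (g d) (g (d + P)) (j, g v)) \<in> snd (head_graph d)"
        unfolding S_graph_def snd_conv using v(2) by blast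
      ultimately show ?thesis by blast
    qed
  qed
  moreover have "base \<union> (\<Union>d\<in>heads. branch d) = L"
    unfolding base_def branch_def basin_def by blast
  ultimately have "represents g L ?G (case_sum \<psi> (\<lambda>(i, v). \<chi> v))" by simp
  moreover have "attach_inward_comps B ?G"
    unfolding attach_inward_comps_def inwardly_oriented_def
    by (intro exI[of _ heads] exI[of _ head_tree] exI[of _ head_edges] exI[of _ g] exI[of _ "\<lambda>d. g (d + P)"]
        exI[of _ p] conjI ballI refl finite_heads head_template) (simp_all add: p)
  ultimately show ?thesis by (intro exI conjI)
qed

end

section \<open>Orbits with a cycle\<close>

context columns
begin

lemma high_columns_intro:
  assumes "M + P \<le> N" "\<And>c l i. good c \<Longrightarrow> N \<le> c \<Longrightarrow> l \<in> low \<Longrightarrow> (g ^^ i) l \<noteq> c"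
    "\<And>c i. good c \<Longrightarrow> N \<le> c \<Longrightarrow> 0 < i \<Longrightarrow> (g ^^ i) c \<noteq> c"
  shows "high_columns L g P M Q N"
  using assms by unfold_locales

end

locale cyclic_columns = columns +
  fixes z n
  assumes z: "z \<in> L" and n: "0 < n" "(g ^^ n) z = z" and n_least: "\<And>i. 0 < i \<Longrightarrow> i < n \<Longrightarrow> (g ^^ i) z \<noteq> z"
begin

lemma z_mod: "(g ^^ i) z = (g ^^ (i mod n)) z"
  using funpow_mod_eq[OF n(2), of i] by simp

definition cycle :: "nat set" where "cycle = (\<lambda>i. (g ^^ i) z) ` {..<n}"

lemma z_iter_cycle: "(g ^^ i) z \<in> cycle"
  unfolding cycle_def using z_mod[of i] n(1) by auto

lemma finite_cycle: "finite cycle"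
  by (simp add: cycle_def)

lemma reaches_cycle: "u \<in> L \<Longrightarrow> \<exists>a. \<forall>i\<ge>a. (g ^^ i) u \<in> cycle"
proof -
  assume "u \<in> L"
  then obtain a b where ab: "(g ^^ a) u = (g ^^ b) z" using orbit z by blast
  have "(g ^^ i) u \<in> cycle" if "a \<le> i" for i
  proof -
    have "(g ^^ i) u = (g ^^ (i - a)) ((g ^^ a) u)" using that by (simp flip: funpow_plus)
    also have "\<dots> = (g ^^ (i - a + b)) z" using ab by (simp add: funpow_plus)
    finally show ?thesis using z_iter_cycle by simp
  qed
  then show ?thesis by blast
qed

lemma finite_forward: "u \<in> L \<Longrightarrow> finite (range (\<lambda>i. (g ^^ i) u))"
proof -
  assume "u \<in> L"
  then obtain a where a: "\<And>i. a \<le> i \<Longrightarrow> (g ^^ i) u \<in> cycle" using reaches_cycle by blast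
  have "range (\<lambda>i. (g ^^ i) u) \<subseteq> (\<lambda>i. (g ^^ i) u) ` {..<a} \<union> cycle"
  proof (rule image_subsetI)
    fix i
    show "(g ^^ i) u \<in> (\<lambda>i. (g ^^ i) u) ` {..<a} \<union> cycle" using a by (cases "a \<le> i") auto
  qed
  then show ?thesis using finite_cycle by (meson finite_UnI finite_imageI finite_lessThan finite_subset)
qed

lemma periodic_in_cycle:
  assumes "c \<in> L" "0 < i" "(g ^^ i) c = c"
  shows "c \<in> cycle"
proof -
  obtain a where a: "\<And>k. a \<le> k \<Longrightarrow> (g ^^ k) c \<in> cycle" using reaches_cycle[OF assms(1)] by blast
  have "(g ^^ (i * a)) c = (g ^^ (i * a mod i)) c" using funpow_mod_eq[OF assms(3), of "i * a"] by simp
  then show ?thesis using a[of "i * a"] assms(2) by simp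
qed

text \<open>Along an outward column a single orbit visits infinitely many points, whereas with a
  cycle present every forward orbit is finite.\<close>

lemma not_outward: "v \<in> L \<Longrightarrow> \<not> outward_at g P v"
proof
  assume v: "v \<in> L" "outward_at g P v"
  then obtain m where m: "\<And>j. (g ^^ m) (v + j * P) = v + Suc j * P" unfolding outward_at_def by blast
  have eq: "(g ^^ (j * m)) v = v + j * P" for j
  proof (induction j)
    case (Suc j)
    have "(g ^^ (Suc j * m)) v = (g ^^ m) ((g ^^ (j * m)) v)" by (simp add: funpow_plus)
    then show ?case using Suc m by simp
  qed simp
  have "range (\<lambda>j. v + j * P) \<subseteq> range (\<lambda>i. (g ^^ i) v)"
    unfolding eq[symmetric] by blast
  moreover have "inj (\<lambda>j. v + j * P)" using P_pos by (auto simp: inj_def)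
  ultimately show False using finite_forward[OF v(1)] finite_subset finite_imageD infinite_UNIV_nat by metis
qed

text \<open>Only finitely many points are reached from \<open>low\<close>, and all periodic points
  lie on the one cycle, so a bound beyond both exists.\<close>

lemma exists_high: "\<exists>N. high_columns L g P M Q N \<and> (\<forall>c\<in>cycle. c < N)"
proof -
  have "finite ((\<Union>l\<in>low. range (\<lambda>i. (g ^^ i) l)) \<union> cycle)"
    using finite_low finite_forward finite_cycle by (auto simp: low_def)
  then obtain N0 where N0: "\<And>x. x \<in> (\<Union>l\<in>low. range (\<lambda>i. (g ^^ i) l)) \<union> cycle \<Longrightarrow> x < N0"
    unfolding finite_nat_set_iff_bounded by blast
  have low_N0: "(g ^^ i) l < N0" if "l \<in> low" for i l using N0[of "(g ^^ i) l"] that by blast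
  have cycle_N0: "c < N0" if "c \<in> cycle" for c using N0[of c] that by blast
  define N where "N = M + P + N0"
  have "high_columns L g P M Q N"
  proof (rule high_columns_intro)
    show "M + P \<le> N" by (simp add: N_def)
    show "(g ^^ i) l \<noteq> c" if "good c" "N \<le> c" "l \<in> low" for c l i
      using low_N0[of l i] that(2,3) by (simp add: N_def)
    show "(g ^^ i) c \<noteq> c" if "good c" "N \<le> c" "0 < i" for c i
    proof
      assume "(g ^^ i) c = c"
      then have "c < N0" using periodic_in_cycle[of c i] cycle_N0 that by (simp add: good_def)
      then show False using that(2) by (simp add: N_def)
    qed
  qed
  then show ?thesis using cycle_N0 by (auto simp: N_def trans_less_add2)
qed

definition entry :: "nat \<Rightarrow> nat" where
  "entry u = (g ^^ (LEAST m. (g ^^ m) u \<in> cycle)) u"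

lemma entry_in_cycle: "u \<in> L \<Longrightarrow> entry u \<in> cycle"
proof -
  assume "u \<in> L"
  then obtain a where "(g ^^ a) u \<in> cycle" using reaches_cycle by blast
  then show ?thesis unfolding entry_def by (rule LeastI)
qed

lemma entry_cycle: "u \<in> cycle \<Longrightarrow> entry u = u"
proof -
  assume "u \<in> cycle"
  then have "(LEAST m. (g ^^ m) u \<in> cycle) = 0" by (intro Least_eq_0) simp
  then show ?thesis by (simp add: entry_def)
qed

lemma entry_step:
  assumes "u \<in> L" "u \<notin> cycle"
  shows "entry (g u) = entry u"
proof -
  obtain a where "(g ^^ a) u \<in> cycle" using reaches_cycle[OF assms(1)] by blast
  then have "(LEAST m. (g ^^ m) u \<in> cycle) = Suc (LEAST m. (g ^^ Suc m) u \<in> cycle)"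
    by (rule Least_Suc) (use assms in simp)
  then show ?thesis unfolding entry_def by (simp add: funpow_swap1)
qed

lemma z_inj: "inj_on (\<lambda>i. (g ^^ i) z) {..<n}"
proof -
  have *: False if ij: "i < j" "j < n" "(g ^^ i) z = (g ^^ j) z" for i j
  proof -
    have "(g ^^ (n - j + i)) z = (g ^^ (n - j + j)) z" using ij(3) by (simp add: funpow_plus)
    then have "(g ^^ (n - j + i)) z = z" using ij n by simp
    moreover have "0 < n - j + i" "n - j + i < n" using ij by linarith+
    then have "(g ^^ (n - j + i)) z \<noteq> z" by (rule n_least)
    ultimately show False by (rule notE[rotated])
  qed
  show ?thesis
  proof (rule inj_onI)
    fix i j assume "i \<in> {..<n}" "j \<in> {..<n}" "(g ^^ i) z = (g ^^ j) z"
    then show "i = j" using *[of i j] *[of j i] by (cases i j rule: linorder_cases) auto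
  qed
qed

lemma g_cycle: "u \<in> cycle \<Longrightarrow> g u \<in> cycle"
proof -
  assume "u \<in> cycle"
  then obtain i where "u = (g ^^ i) z" unfolding cycle_def by blast
  then show ?thesis using z_iter_cycle[of "Suc i"] by simp
qed

lemma shape1_columns:
  assumes \<phi>: "bij_betw \<phi> L X" and f: "\<And>u. u \<in> L \<Longrightarrow> g u \<in> L \<and> f (\<phi> u) = \<phi> (g u)"
  shows "shape1 X f"
proof -
  obtain N where N: "high_columns L g P M Q N" "\<And>c. c \<in> cycle \<Longrightarrow> c < N" using exists_high by blast
  interpret high_columns L g P M Q N by (rule N(1))
  have cyc_base: "cycle \<subseteq> base"
  proof
    fix c assume c: "c \<in> cycle"
    then have "c \<in> L" unfolding cycle_def using iter_closed z by auto
    moreover have "(g ^^ i) c \<in> cycle" for i using c by (induction i) (auto intro: g_cycle)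
    then have "\<not> peak ((g ^^ i) c)" for i using N(2)[of "(g ^^ i) c"] peakD(3)[of "(g ^^ i) c"] by fastforce
    ultimately show "c \<in> base" using base_iff by blast
  qed
  \<comment> \<open>The special vertex supplied by \<open>hit\<close> is not outward here and,
    starting from \<open>base\<close>, not a peak. So it is small, and \<open>u\<close> exceeds it
    by at most \<open>Q\<close>.\<close>
  have "u \<le> N + M + P + Q" if u: "u \<in> base" for u
  proof -
    have uL: "u \<in> L" and np: "\<And>i. \<not> peak ((g ^^ i) u)" using u base_iff by blast+
    obtain i where i: "(g ^^ i) u < M + P \<or> const_at g P ((g ^^ i) u) \<or>
                inward_at g P ((g ^^ i) u) \<or> outward_at g P ((g ^^ i) u)"
      and iQ: "u \<le> (g ^^ i) u + Q" using hit[OF uL] by blast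
    have "(g ^^ i) u < N + M + P"
    proof (rule ccontr)
      assume a: "\<not> (g ^^ i) u < N + M + P"
      then have "const_at g P ((g ^^ i) u) \<or> inward_at g P ((g ^^ i) u)"
        using i not_outward[OF iter_closed[OF uL]] by auto
      then have "peak ((g ^^ i) u)" unfolding peak_def good_def using a iter_closed[OF uL] by auto
      then show False using np by blast
    qed
    then show ?thesis using iQ by simp
  qed
  then have fin: "finite base" by (intro finite_subset[of base "{..N + M + P + Q}"]) auto
  have baseL: "base \<subseteq> L" using base_iff by blast
  \<comment> \<open>The vertices of \<open>base\<close> are grouped by the cycle vertex at which
    their orbit enters the cycle; a group can consist of that vertex alone.\<close>
  define TV where "TV i = {u \<in> base. entry u = (g ^^ i) z}" for i
  define TE where "TE i = {(u, g u) | u. u \<in> TV i - {(g ^^ i) z}}" for i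
  define root where "root i = (g ^^ i) z" for i
  have root: "root i \<in> TV i" for i
    unfolding root_def TV_def using cyc_base z_iter_cycle[of i] entry_cycle by auto
  have not_cyc: "u \<notin> cycle" if "u \<in> TV i - {root i}" for u i
    using that entry_cycle unfolding TV_def root_def by auto
  have step: "g u \<in> TV i" if u: "u \<in> TV i - {root i}" for u i
    using u entry_step[of u] not_cyc[OF u] base_closed[of u] baseL unfolding TV_def by auto
  have tree: "inward_rooted_finite_tree (TV i) (TE i) (root i)" for i
    unfolding TE_def root_def[symmetric]
  proof (rule inward_rooted_finite_tree_parent)
    show "finite (TV i)" using fin by (simp add: TV_def)
    show "\<exists>m. (g ^^ m) v = root i" if "v \<in> TV i" for v
      using that unfolding TV_def root_def entry_def by blast
  qed (use root step in auto)
  let ?B = "attach_all (cycle_graph n) {..<n} (\<lambda>i. (TV i, TE i)) root (\<lambda>i. i)"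
  have "represents g (cycle \<union> (\<Union>i\<in>{..<n}. TV i - {root i})) ?B (case_sum (\<lambda>i. (g ^^ i) z) (\<lambda>(i, v). (\<lambda>v. v) v))"
  proof (rule represents_attach_all)
    show "bij_betw (\<lambda>i. (g ^^ i) z) (fst (cycle_graph n)) cycle"
      using z_inj by (simp add: bij_betw_def cycle_graph_def cycle_def)
    show "a \<in> fst (cycle_graph n) \<and> b \<in> fst (cycle_graph n) \<and> g ((g ^^ a) z) = (g ^^ b) z"
      if "(a, b) \<in> snd (cycle_graph n)" for a b
    proof -
      have ab: "a < n" "b = Suc a mod n" using that by (auto simp: cycle_graph_def)
      then show ?thesis using z_mod[of "Suc a"] n(1) by (simp add: cycle_graph_def)
    qed
    show "(\<exists>b. (a, b) \<in> snd (cycle_graph n)) \<or>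
        (\<exists>i\<in>{..<n}. i = a \<and> (\<exists>b. (root i, b) \<in> snd (TV i, TE i)))" if "a \<in> fst (cycle_graph n)" for a
      using that by (auto simp: cycle_graph_def)
  next
    fix i assume i: "i \<in> {..<n}"
    show "i \<in> fst (cycle_graph n) \<and> root i = (g ^^ i) z" using i by (simp add: cycle_graph_def root_def)
    show "cycle \<inter> (TV i - {root i}) = {}" using not_cyc by blast
    show "a \<in> fst (TV i, TE i) \<and> b \<in> fst (TV i, TE i) \<and> g a = b" if "(a, b) \<in> snd (TV i, TE i)" for a b
      using that step[of a i] by (auto simp: TE_def root_def)
    show "\<exists>b. (a, b) \<in> snd (TV i, TE i)" if "a \<in> fst (TV i, TE i)" "a \<noteq> root i" for a
      using that by (auto simp: TE_def root_def)
    show "(TV i - {root i}) \<inter> (TV j - {root j}) = {}" if "j \<in> {..<n}" "i \<noteq> j" for j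
      using i that inj_onD[OF z_inj, of i j] unfolding TV_def by auto
  qed auto
  moreover have "cycle \<union> (\<Union>i\<in>{..<n}. TV i - {root i}) = base"
  proof
    show "cycle \<union> (\<Union>i\<in>{..<n}. TV i - {root i}) \<subseteq> base" using cyc_base by (auto simp: TV_def)
    show "base \<subseteq> cycle \<union> (\<Union>i\<in>{..<n}. TV i - {root i})"
    proof
      fix u assume u: "u \<in> base"
      then obtain i where i: "i < n" "entry u = (g ^^ i) z" using entry_in_cycle[of u] baseL unfolding cycle_def by auto
      then have "u \<in> TV i" using u by (simp add: TV_def)
      then show "u \<in> cycle \<union> (\<Union>i\<in>{..<n}. TV i - {root i})"
        using i z_iter_cycle[of i] unfolding root_def by blast
    qed
  qed
  ultimately have "represents g base ?B (case_sum (\<lambda>i. (g ^^ i) z) (\<lambda>(i, v). (\<lambda>v. v) v))" by simp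
  from attach_heads[OF this] obtain G \<Psi> where G: "attach_inward_comps ?B G" "represents g L G \<Psi>" by blast
  have "graph_iso (map_graph X f) G" using graph_iso_if_represents[OF G(2) \<phi>] f by blast
  then show ?thesis
    unfolding shape1_def using G(1) n(1) tree
    by (intro exI[of _ n] exI[of _ "{..<n}"] exI[of _ TV] exI[of _ TE] exI[of _ root] exI[of _ "\<lambda>i. i"] exI[of _ G])
      auto
qed

end

section \<open>Orbits without a cycle\<close>

context columns
begin

text \<open>If the orbit avoided \<open>low\<close>, all of it would be clean and the step from
  \<open>v\<close> to \<open>v - P\<close> could be repeated forever, which is impossible in the
  naturals.\<close>

lemma inward_hits_low:
  assumes v: "v \<in> L" "inward_at g P v"
  shows "\<exists>i. (g ^^ i) v \<in> low"
proof (rule ccontr)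
  assume "\<not> ?thesis"
  then have nl: "(g ^^ i) v \<notin> low" for i by blast
  obtain m where m: "(g ^^ m) (v + Suc 0 * P) = v + 0 * P" using v(2) unfolding inward_at_def by blast
  have cl: "clean ((g ^^ i) v) m" for i
    using nl[of "_ + i"] by (intro clean_if_not_low[OF iter_closed[OF v(1)]]) (simp add: funpow_plus)
  have step: "(g ^^ m) v + P = v" using clean_up[OF cl[of 0], of m 1] m by simp
  have "(g ^^ (k * m)) v + k * P = v" for k
  proof (induction k)
    case (Suc k)
    have "(g ^^ (Suc k * m)) v + k * P = (g ^^ m) ((g ^^ (k * m)) v) + k * P" by (simp add: funpow_plus)
    also have "\<dots> = (g ^^ m) ((g ^^ (k * m)) v + k * P)" using clean_up[OF cl, of m "k * m" k] by simp
    also have "\<dots> = (g ^^ m) v" using Suc by simp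
    finally show ?case using step by simp
  qed simp
  from this[of "Suc v"] have "Suc v * P \<le> v" by (metis le_add2)
  moreover have "Suc v * 1 \<le> Suc v * P" by (rule mult_le_mono2) (use P_pos in simp)
  ultimately have "Suc v * 1 \<le> v" by (rule order_trans[rotated])
  then show False by simp
qed

text \<open>Without cycles an orbit is injective and leaves the finite set \<open>low\<close> for
  good. A special vertex met after that is neither constant nor inward, since both kinds lead back
  into \<open>low\<close>.\<close>

lemma exists_outward:
  assumes acyclic: "\<And>u i. u \<in> L \<Longrightarrow> 0 < i \<Longrightarrow> (g ^^ i) u \<noteq> u"
  shows "\<exists>v\<in>L. outward_at g P v"
proof -
  obtain u where u: "u \<in> L" using nonempty by blast
  have "inj (\<lambda>i. (g ^^ i) u)"
  proof -
    have *: False if "i < j" "(g ^^ i) u = (g ^^ j) u" for i j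
    proof -
      have "(g ^^ (j - i)) ((g ^^ i) u) = (g ^^ j) u" using that(1) by (simp flip: funpow_plus)
      then have "(g ^^ (j - i)) ((g ^^ i) u) = (g ^^ i) u" using that(2) by simp
      moreover have "0 < j - i" using that by simp
      ultimately show False using acyclic[OF iter_closed[OF u]] by blast
    qed
    show ?thesis
    proof (rule injI)
      fix i j assume "(g ^^ i) u = (g ^^ j) u"
      then show "i = j" using *[of i j] *[of j i] by (cases i j rule: linorder_cases) auto
    qed
  qed
  then have "finite ((\<lambda>i. (g ^^ i) u) -` low)" using finite_low by (rule finite_vimageI[rotated])
  then obtain i0 where i0: "\<And>i. (g ^^ i) u \<in> low \<Longrightarrow> i < i0"
    unfolding finite_nat_set_iff_bounded by blast
  define w where "w = (g ^^ i0) u"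
  have wL: "w \<in> L" unfolding w_def using iter_closed u .
  have nl: "(g ^^ i) w \<notin> low" for i using i0[of "i + i0"] by (auto simp: w_def funpow_plus)
  obtain i where i: "(g ^^ i) w < M + P \<or> const_at g P ((g ^^ i) w) \<or>
                inward_at g P ((g ^^ i) w) \<or> outward_at g P ((g ^^ i) w)" using hit[OF wL] by blast
  define v where "v = (g ^^ i) w"
  have vL: "v \<in> L" unfolding v_def using iter_closed wL .
  have nlv: "(g ^^ k) v \<notin> low" for k using nl[of "k + i"] by (simp add: v_def funpow_plus)
  have ge: "M + P \<le> v" using nlv[of 0] vL by (simp add: low_def)
  have "\<not> const_at g P v" using const_low[OF vL] ge nlv[of 1] by auto
  moreover have "\<not> inward_at g P v" using inward_hits_low[OF vL] nlv by blast
  ultimately have "outward_at g P v" using i ge unfolding v_def by linarith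
  then show ?thesis using vL by blast
qed

end

text \<open>\<open>d0\<close> starts the spine so far out that all of \<open>low\<close> flows into
  it, which confines irregular behaviour to its basin. The condition \<open>m > 0\<close> keeps
  \<open>d0\<close> itself out of \<open>low\<close>.\<close>

locale outward_columns = columns +
  fixes d0 n
  assumes acyclic: "\<And>u i. u \<in> L \<Longrightarrow> 0 < i \<Longrightarrow> (g ^^ i) u \<noteq> u"
    and d0: "d0 \<in> L" and n: "0 < n" and d0_step: "\<And>j. (g ^^ n) (d0 + j * P) = d0 + Suc j * P"
    and low_d0: "\<And>l. l \<in> low \<Longrightarrow> \<exists>m>0. (g ^^ m) l = d0"
begin

lemma spine_not_low: "(g ^^ t) d0 \<notin> low"
proof
  assume "(g ^^ t) d0 \<in> low"
  then obtain m where m: "0 < m" "(g ^^ m) ((g ^^ t) d0) = d0" using low_d0 by blast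
  then have "(g ^^ (m + t)) d0 = d0" by (simp add: funpow_plus)
  then show False using acyclic[OF d0] m by simp
qed

lemma spine_clean: "clean ((g ^^ t) d0) m"
  using spine_not_low[of "_ + t"] by (intro clean_if_not_low[OF iter_closed[OF d0]]) (simp add: funpow_plus)

lemma spine_shift: "(g ^^ t) (d0 + j * P) = (g ^^ t) d0 + j * P"
  using clean_up[OF spine_clean[of 0 t]] by simp

lemma spine_power: "(g ^^ (j * n)) d0 = d0 + j * P"
proof (induction j)
  case (Suc j)
  have "(g ^^ (Suc j * n)) d0 = (g ^^ n) ((g ^^ (j * n)) d0)" by (simp add: funpow_plus)
  then show ?case using Suc d0_step by simp
qed simp

text \<open>On the spine, adding \<open>P\<close> amounts to \<open>n\<close> steps forward. An
  inward column through a spine vertex would undo this and close a cycle; a constant one would lead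
  into \<open>low\<close>.\<close>

lemma spine_not_good: "\<not> good ((g ^^ t) d0)"
proof
  define v where "v = (g ^^ t) d0"
  have vL: "v \<in> L" unfolding v_def using iter_closed d0 .
  assume "good ((g ^^ t) d0)"
  then have "M \<le> v" "const_at g P v \<or> inward_at g P v" unfolding good_def v_def by auto
  moreover have "\<not> const_at g P v" if "M \<le> v"
    using const_low[OF vL that] spine_not_low[of "Suc t"] by (auto simp: v_def)
  ultimately obtain m where m: "0 < m" "(g ^^ m) (v + Suc 0 * P) = v + 0 * P" unfolding inward_at_def by blast
  have "v + P = (g ^^ t) (d0 + P)" using spine_shift[of t 1] by (simp add: v_def)
  also have "\<dots> = (g ^^ t) ((g ^^ n) d0)" using d0_step[of 0] by simp
  also have "\<dots> = (g ^^ n) v" unfolding v_def by (simp add: add.commute flip: funpow_plus)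
  finally have "(g ^^ (m + n)) v = v" using m(2) by (simp add: funpow_plus)
  then show False using acyclic[OF vL, of "m + n"] m(1) by simp
qed

text \<open>Forward orbits are infinite here, but from \<open>d0\<close> on they follow the spine,
  which contains no good point. So \<open>N\<close> has to exceed only the finitely many vertices on
  the way from \<open>low\<close> to \<open>d0\<close>.\<close>

lemma exists_high: "\<exists>N. high_columns L g P M Q N"
proof -
  obtain \<mu> where \<mu>: "\<And>l. l \<in> low \<Longrightarrow> (g ^^ \<mu> l) l = d0" using low_d0 by metis
  have "finite (\<Union>l\<in>low. (\<lambda>i. (g ^^ i) l) ` {..<\<mu> l})" using finite_low by auto
  then obtain N0 where N0: "\<And>x. x \<in> (\<Union>l\<in>low. (\<lambda>i. (g ^^ i) l) ` {..<\<mu> l}) \<Longrightarrow> x < N0"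
    unfolding finite_nat_set_iff_bounded by blast
  have "high_columns L g P M Q (M + P + N0)"
  proof (rule high_columns_intro)
    show "(g ^^ i) l \<noteq> c" if c: "good c" "M + P + N0 \<le> c" and l: "l \<in> low" for c l i
    proof (cases "i < \<mu> l")
      case True
      then have "(g ^^ i) l < N0" using N0[of "(g ^^ i) l"] l by blast
      then show ?thesis using c by auto
    next
      case False
      then have "(g ^^ i) l = (g ^^ (i - \<mu> l)) ((g ^^ \<mu> l) l)" by (simp flip: funpow_plus)
      then have "(g ^^ i) l = (g ^^ (i - \<mu> l)) d0" using \<mu>[OF l] by simp
      then show ?thesis using spine_not_good c by auto
    qed
    show "(g ^^ i) c \<noteq> c" if "good c" "0 < i" for c i using acyclic that unfolding good_def by blast
  qed simp
  then show ?thesis by blast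
qed

text \<open>Every orbit merges with the spine, and the orbit of \<open>v\<close> contains
  \<open>v + a * P\<close>. Writing that point as a spine vertex \<open>(g ^^ k) d0\<close> with
  \<open>k < n\<close> plus \<open>i * P\<close>, the lower bound on \<open>v\<close> gives
  \<open>i > a\<close>, so \<open>a * P\<close> cancels and leaves at least one full period; hence
  \<open>t\<close> is at least \<open>n\<close>.\<close>

lemma outward_on_spine:
  assumes v: "v \<in> L" "outward_at g P v" "P + (\<Sum>k<n. (g ^^ k) d0) \<le> v"
  shows "\<exists>t\<ge>n. v = (g ^^ t) d0"
proof -
  obtain m where m: "0 < m" "\<And>j. (g ^^ m) (v + j * P) = v + Suc j * P"
    using v(2) unfolding outward_at_def by blast
  have vm: "(g ^^ (j * m)) v = v + j * P" for j
  proof (induction j)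
    case (Suc j)
    have "(g ^^ (Suc j * m)) v = (g ^^ m) ((g ^^ (j * m)) v)" by (simp add: funpow_plus)
    then show ?case using Suc m by simp
  qed simp
  obtain a b where ab: "(g ^^ a) v = (g ^^ b) d0" using orbit v(1) d0 by blast
  \<comment> \<open>The orbit of \<open>v\<close> is on the spine from step \<open>a\<close> on, and
    it is at \<open>v + a * P\<close> at step \<open>a * m\<close>.\<close>
  have "a \<le> a * m" using m(1) by simp
  then have "v + a * P = (g ^^ (a * m - a)) ((g ^^ a) v)" using vm[of a] by (simp flip: funpow_plus)
  then have "v + a * P = (g ^^ (a * m - a + b)) d0" using ab by (simp add: funpow_plus)
  moreover define k where "k = (a * m - a + b) mod n"
  moreover define i where "i = (a * m - a + b) div n"
  ultimately have "v + a * P = (g ^^ (k + i * n)) d0" by simp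
  also have "\<dots> = (g ^^ k) d0 + i * P" by (simp add: funpow_plus spine_power spine_shift)
  finally have eq: "v + a * P = (g ^^ k) d0 + i * P" .
  have "k < n" using n by (simp add: k_def)
  then have "(g ^^ k) d0 \<le> (\<Sum>k<n. (g ^^ k) d0)"
    by (intro member_le_sum[where f = "\<lambda>k. (g ^^ k) d0"]) auto
  then have "Suc a * P \<le> i * P" using eq v(3) by simp
  then have "Suc a \<le> i" using mult_le_cancel2[of "Suc a" P i] P_pos by blast
  then obtain c where c: "i = a + Suc c" using less_iff_Suc_add by (metis Suc_le_eq add_Suc_right)
  then have "v = (g ^^ k) d0 + Suc c * P" using eq by (simp add: algebra_simps)
  also have "\<dots> = (g ^^ (k + Suc c * n)) d0" by (simp add: funpow_plus spine_power spine_shift del: mult_Suc)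
  finally show ?thesis by (intro exI[of _ "k + Suc c * n"]) simp
qed

lemma basin_spine_mono:
  assumes "i \<le> j" "u \<in> basin (d0 + i * P)"
  shows "u \<in> basin (d0 + j * P)"
proof -
  have "(g ^^ ((j - i) * n)) (d0 + i * P) = (g ^^ ((j - i) * n + i * n)) d0"
    by (simp add: funpow_plus spine_power)
  also have "\<dots> = (g ^^ (j * n)) d0" using assms(1) by (simp flip: add_mult_distrib)
  finally have "(g ^^ ((j - i) * n)) (d0 + i * P) = d0 + j * P" by (simp add: spine_power)
  moreover have "d0 + i * P \<in> L" using iter_closed[OF d0, of "i * n"] by (simp add: spine_power)
  ultimately have "d0 + i * P \<in> basin (d0 + j * P)" using basinI by blast
  then show ?thesis using assms(2) basin_trans by blast
qed

text \<open>Along the spine the basins grow with \<open>j\<close>, opposite to inward columns, so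
  the difference is taken the other way round than in a piece.\<close>

definition layer :: "nat \<Rightarrow> nat set" where
  "layer j = basin (d0 + Suc j * P) - basin (d0 + j * P)"

lemma spine_descent: "(g ^^ s) (d0 + Suc j * P) \<noteq> d0 + j * P"
proof
  assume "(g ^^ s) (d0 + Suc j * P) = d0 + j * P"
  then have "(g ^^ (s + n)) (d0 + j * P) = d0 + j * P" using d0_step[of j] by (simp add: funpow_plus)
  moreover have "d0 + j * P \<in> L" using iter_closed[OF d0, of "j * n"] by (simp add: spine_power)
  ultimately show False using acyclic[of "d0 + j * P" "s + n"] n by simp
qed

text \<open>A vertex passing through \<open>low\<close> flows into \<open>d0\<close> and hence into
  every \<open>d0 + j * P\<close>, so it lies in no layer.\<close>

lemma layer_clean:
  assumes u: "u \<in> layer j" and m: "(g ^^ m) u = d0 + Suc j * P"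
  shows "clean u m" "M + P \<le> u" "u \<in> L"
proof -
  show uL: "u \<in> L" using u unfolding layer_def basin_def by blast
  have nl: "(g ^^ i) u \<notin> low" for i
  proof
    assume "(g ^^ i) u \<in> low"
    then obtain m where "(g ^^ m) ((g ^^ i) u) = d0" using low_d0 by blast
    then have "(g ^^ i) u \<in> basin d0" by (rule basinI[OF iter_closed[OF uL]])
    then have "(g ^^ i) u \<in> basin (d0 + 0 * P)" by simp
    then have "u \<in> basin (d0 + 0 * P)" using basin_iter uL by blast
    then have "u \<in> basin (d0 + j * P)" using basin_spine_mono by blast
    then show False using u unfolding layer_def by blast
  qed
  then show "clean u m" using clean_if_not_low[OF uL] by blast
  show "M + P \<le> u" using nl[of 0] uL by (simp add: low_def)
qed

lemma layer_up: "u \<in> layer j \<Longrightarrow> u + P \<in> layer (Suc j)"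
proof -
  assume u: "u \<in> layer j"
  then obtain m where m: "(g ^^ m) u = d0 + Suc j * P" unfolding layer_def basin_def by blast
  note cl = layer_clean[OF u m]
  have up: "(g ^^ i) (u + P) = (g ^^ i) u + P" if "i \<le> m" for i using clean_up[OF cl(1) that, of 1] by simp
  have L: "u + P \<in> L" using L_period[of u] cl by simp
  have mu: "(g ^^ m) (u + P) = d0 + Suc (Suc j) * P" using up[of m] m by simp
  have "(g ^^ s) (u + P) \<noteq> d0 + Suc j * P" for s
  proof
    assume s: "(g ^^ s) (u + P) = d0 + Suc j * P"
    show False
    proof (cases "s \<le> m")
      case True
      then have "(g ^^ s) u = d0 + j * P" using up[OF True] s by simp
      then show False using u basinI[OF cl(3)] unfolding layer_def by blast
    next
      case False
      then have "(g ^^ (s - m)) ((g ^^ m) (u + P)) = d0 + Suc j * P" using s by (simp flip: funpow_plus)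
      then show False using spine_descent[of "s - m" "Suc j"] mu by simp
    qed
  qed
  then have "u + P \<notin> basin (d0 + Suc j * P)" unfolding basin_def by blast
  then show ?thesis using basinI[OF L mu] unfolding layer_def by blast
qed

lemma layer_down: "u \<in> layer (Suc j) \<Longrightarrow> P \<le> u \<and> u - P \<in> layer j"
proof -
  assume u: "u \<in> layer (Suc j)"
  then obtain m where m: "(g ^^ m) u = d0 + Suc (Suc j) * P" unfolding layer_def basin_def by blast
  note cl = layer_clean[OF u m]
  have down: "(g ^^ i) (u - P) + P = (g ^^ i) u" if "i \<le> m" for i using clean_down[OF cl(1,3,2) that] .
  have L: "u - P \<in> L" using L_period[of "u - P"] cl by simp
  have mu: "(g ^^ m) (u - P) = d0 + Suc j * P" using down[of m] m by simp
  have "(g ^^ s) (u - P) \<noteq> d0 + j * P" for s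
  proof
    assume s: "(g ^^ s) (u - P) = d0 + j * P"
    show False
    proof (cases "s \<le> m")
      case True
      then have "(g ^^ s) u = d0 + Suc j * P" using down[OF True] s by simp
      then show False using u basinI[OF cl(3)] unfolding layer_def by blast
    next
      case False
      then have "(g ^^ (s - m)) ((g ^^ m) (u - P)) = d0 + j * P" using s by (simp flip: funpow_plus)
      then show False using spine_descent[of "s - m" j] mu by simp
    qed
  qed
  then have "u - P \<notin> basin (d0 + j * P)" unfolding basin_def by blast
  then show ?thesis using basinI[OF L mu] cl(2) unfolding layer_def by auto
qed

lemma layer_iff: "u \<in> layer j \<longleftrightarrow> (\<exists>v\<in>layer 0. u = v + j * P)"
proof (induction j arbitrary: u)
  case (Suc j)
  show ?case
  proof
    assume "u \<in> layer (Suc j)"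
    then have "P \<le> u" "u - P \<in> layer j" using layer_down by blast+
    moreover from this obtain v where "v \<in> layer 0" "u - P = v + j * P" using Suc by blast
    ultimately show "\<exists>v\<in>layer 0. u = v + Suc j * P" by (intro bexI[of _ v]) auto
  next
    assume "\<exists>v\<in>layer 0. u = v + Suc j * P"
    then obtain v where v: "v \<in> layer 0" "u = v + Suc j * P" by blast
    then have "v + j * P \<in> layer j" using Suc by blast
    then show "u \<in> layer (Suc j)" using layer_up[of "v + j * P" j] v by (simp add: add_ac)
  qed
qed simp

lemma layer_disjoint: "u \<in> layer i \<Longrightarrow> u \<in> layer j \<Longrightarrow> i = j"
proof -
  have *: False if "u \<in> layer i" "u \<in> layer j" "i < j" for i j
    using that basin_spine_mono[of "Suc i" j u] unfolding layer_def by auto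
  assume "u \<in> layer i" "u \<in> layer j"
  then show "i = j" using *[of i j] *[of j i] by (cases i j rule: linorder_cases) auto
qed

lemma layer_cover: "L = basin d0 \<union> (\<Union>j. layer j)"
proof
  show "basin d0 \<union> (\<Union>j. layer j) \<subseteq> L" unfolding layer_def basin_def by blast
  show "L \<subseteq> basin d0 \<union> (\<Union>j. layer j)"
  proof
    fix u assume u: "u \<in> L"
    obtain a b where ab: "(g ^^ a) u = (g ^^ b) d0" using orbit u d0 by blast
    have "b \<le> b * n" using n by simp
    then have "(g ^^ (b * n - b)) ((g ^^ b) d0) = d0 + b * P" by (simp add: spine_power flip: funpow_plus)
    then have "(g ^^ (b * n - b + a)) u = d0 + b * P" using ab by (simp add: funpow_plus)
    then have ex: "u \<in> basin (d0 + b * P)" using basinI u by blast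
    define j where "j = (LEAST j. u \<in> basin (d0 + j * P))"
    have j: "u \<in> basin (d0 + j * P)" unfolding j_def using ex by (rule LeastI)
    have least: "u \<notin> basin (d0 + k * P)" if "k < j" for k using not_less_Least that unfolding j_def by blast
    show "u \<in> basin d0 \<union> (\<Union>j. layer j)"
    proof (cases j)
      case 0
      then show ?thesis using j by simp
    next
      case (Suc k)
      then show ?thesis using j least[of k] unfolding layer_def by auto
    qed
  qed
qed

end

section \<open>Trunk and spine\<close>

locale outward_high_columns = outward_columns L g P M Q d0 n + high_columns L g P M Q N
  for L :: "nat set" and g P M Q d0 n N
begin

text \<open>Constant and inward columns both lead into \<open>low\<close>, and from there into
  \<open>d0\<close>. So branches never enter the layers, and all inward components end up attached
  to the trunk.\<close>

lemma peak_basin: "peak c \<Longrightarrow> c \<in> basin d0"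
proof -
  assume c: "peak c"
  have "\<exists>i. (g ^^ i) c \<in> low"
  proof (cases "const_at g P c")
    case True
    then have "g c \<in> low" using const_low peakD[OF c] by simp
    then show ?thesis by (intro exI[of _ 1]) simp
  next
    case False
    then have "inward_at g P c" using c unfolding peak_def good_def by blast
    then show ?thesis using inward_hits_low peakD(1)[OF c] by blast
  qed
  then obtain i where "(g ^^ i) c \<in> low" by blast
  moreover from this obtain m where "(g ^^ m) ((g ^^ i) c) = d0" using low_d0 by blast
  ultimately have "(g ^^ i) c \<in> basin d0" using basinI by (auto simp: low_def)
  then show ?thesis using basin_iter peakD(1)[OF c] by blast
qed

text \<open>Used with \<open>k = 0\<close> for the trunk and with \<open>k = n\<close> for the first
  layer. As for the pieces, \<open>hit\<close> bounds \<open>u\<close> by a special vertex; within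
  \<open>base\<close> a large special vertex could only be outward, and it would lie on the spine
  beyond the point it flows into.\<close>

lemma finite_basin_base:
  assumes k: "k \<le> n"
  shows "finite (basin ((g ^^ k) d0) \<inter> base)"
proof -
  let ?e = "(g ^^ k) d0"
  let ?S = "P + (\<Sum>k<n. (g ^^ k) d0)"
  have "u \<le> ?e + M + P + N + ?S + Q" if u: "u \<in> basin ?e \<inter> base" for u
  proof -
    have uL: "u \<in> L" and np: "\<And>i. \<not> peak ((g ^^ i) u)" using u base_iff by blast+
    obtain s where s: "(g ^^ s) u = ?e" using u unfolding basin_def by blast
    obtain i where i: "(g ^^ i) u < M + P \<or> const_at g P ((g ^^ i) u) \<or>
                inward_at g P ((g ^^ i) u) \<or> outward_at g P ((g ^^ i) u)"
      and iQ: "\<And>k. k \<le> i \<Longrightarrow> u \<le> (g ^^ k) u + Q" using hit[OF uL] by blast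
    show ?thesis
    proof (cases "s \<le> i")
      case True
      then show ?thesis using iQ[of s] s by simp
    next
      case False
      define v where "v = (g ^^ i) u"
      have vL: "v \<in> L" unfolding v_def using iter_closed uL .
      have sv: "(g ^^ (s - i)) v = ?e" using s False by (simp add: v_def flip: funpow_plus)
      have "v < M + P + N + ?S"
      proof (rule ccontr)
        assume big: "\<not> v < M + P + N + ?S"
        have "\<not> const_at g P v \<and> \<not> inward_at g P v"
          using np[of i] big vL unfolding v_def[symmetric] peak_def good_def by auto
        then have "outward_at g P v" using i big unfolding v_def by auto
        then obtain t where t: "t \<ge> n" "v = (g ^^ t) d0" using outward_on_spine[OF vL] big by auto
        \<comment> \<open>\<open>v\<close> flows into \<open>?e\<close> in \<open>s - i > 0\<close>
          steps, and \<open>?e\<close> leads back to \<open>v\<close> along the spine.\<close>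
        have "(g ^^ (t - k)) ?e = v" using t k by (simp flip: funpow_plus)
        then have "(g ^^ (s - i + (t - k))) ?e = ?e" using sv by (simp add: funpow_plus)
        then show False using acyclic[OF iter_closed[OF d0], of "s - i + (t - k)"] False by simp
      qed
      then show ?thesis using iQ[of i] unfolding v_def by simp
    qed
  qed
  then have "basin ?e \<inter> base \<subseteq> {..?e + M + P + N + ?S + Q}" by auto
  then show ?thesis using finite_subset by blast
qed

lemma d0_base: "d0 \<in> base"
  using base_iff d0 spine_not_good unfolding peak_def by blast

lemma layer_base: "layer j \<subseteq> base"
proof
  fix u assume u: "u \<in> layer j"
  then have uL: "u \<in> L" unfolding layer_def basin_def by blast
  have "\<not> peak ((g ^^ i) u)" for i
  proof
    assume "peak ((g ^^ i) u)"
    then have "u \<in> basin d0" using peak_basin basin_iter uL by blast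
    then have "u \<in> basin (d0 + 0 * P)" by simp
    then have "u \<in> basin (d0 + j * P)" using basin_spine_mono by blast
    then show False using u unfolding layer_def by blast
  qed
  then show "u \<in> base" using base_iff uL by blast
qed

lemma finite_layer: "finite (layer 0)"
proof -
  have "(g ^^ n) d0 = d0 + P" using d0_step[of 0] by simp
  then have "layer 0 \<subseteq> basin ((g ^^ n) d0) \<inter> base" using layer_base[of 0] by (auto simp: layer_def)
  then show ?thesis using finite_basin_base[of n] finite_subset by blast
qed

definition trunk :: "nat set" where "trunk = basin d0 \<inter> base"

lemma trunk_tree: "inward_rooted_finite_tree trunk {(u, g u) | u. u \<in> trunk - {d0}} d0"
proof (rule inward_rooted_finite_tree_parent)
  show "finite trunk" using finite_basin_base[of 0] by (simp add: trunk_def)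
  show "d0 \<in> trunk" using basin_self[OF d0] d0_base by (simp add: trunk_def)
  show "g v \<in> trunk" if "v \<in> trunk - {d0}" for v
    using that basin_g base_closed by (auto simp: trunk_def)
  show "\<exists>m. (g ^^ m) v = d0" if "v \<in> trunk" for v
    using that by (auto simp: trunk_def basin_def)
qed

abbreviation "spine_tree \<equiv> insert d0 (layer 0)"
text \<open>No edge leaves \<open>d0 + P\<close> here: this vertex is the \<open>t0\<close> of the
  next copy, which contributes the translate of the edge leaving \<open>d0\<close>.\<close>

abbreviation "spine_edges \<equiv> {(u, g u) | u. u \<in> spine_tree - {d0 + P}}"

lemma d0_not_layer: "d0 \<notin> layer j"
  using basin_spine_mono[of 0 j d0] basin_self[OF d0] unfolding layer_def by auto

lemma d0P_layer: "d0 + P \<in> layer 0"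
proof -
  have "d0 + P \<in> L" using iter_closed[OF d0, of n] d0_step[of 0] by simp
  then have "d0 + P \<in> basin (d0 + P)" using basin_self by blast
  moreover have "d0 + P \<notin> basin d0" using spine_descent[of _ 0] unfolding basin_def by auto
  ultimately show ?thesis unfolding layer_def by simp
qed

lemma spine_parent:
  assumes "v \<in> spine_tree - {d0 + P}"
  shows "g v \<in> layer 0" "shift_at g P v"
proof -
  have "g v \<in> layer 0 \<and> shift_at g P v"
  proof (cases "v = d0")
    case True
    have "g d0 \<notin> basin d0"
    proof
      assume "g d0 \<in> basin d0"
      then obtain m where "(g ^^ m) (g d0) = d0" unfolding basin_def by blast
      then have "(g ^^ Suc m) d0 = d0" by (simp add: funpow_swap1)
      then show False using acyclic[OF d0] by blast
    qed
    moreover have "d0 \<in> basin (d0 + P)" using basinI[OF d0, of n] d0_step[of 0] by simp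
    then have "g d0 \<in> basin (d0 + P)" using basin_g P_pos by simp
    moreover have "shift_at g P d0" using spine_clean[of 0 1] unfolding clean_def by simp
    ultimately show ?thesis using True by (simp add: layer_def)
  next
    case False
    then have v: "v \<in> layer 0" "v \<noteq> d0 + P" using assms by auto
    then obtain m where m: "(g ^^ m) v = d0 + Suc 0 * P" unfolding layer_def basin_def by blast
    note cl = layer_clean[OF v(1) m]
    have "m \<noteq> 0" using m v(2) by (intro notI) simp
    then have "shift_at g P v" using cl(1) unfolding clean_def by (auto dest: spec[of _ 0])
    moreover have "g v \<in> basin (d0 + P)" using v basin_g unfolding layer_def by simp
    moreover have "g v \<notin> basin d0" using v(1) basin_iter[of 1 v d0] cl(3) unfolding layer_def by auto
    ultimately show ?thesis by (simp add: layer_def)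
  qed
  then show "g v \<in> layer 0" "shift_at g P v" by blast+
qed

lemma spine_template:
  "template spine_tree spine_edges d0 (d0 + P)" "oriented_towards spine_edges (d0 + P)"
proof -
  have tree: "inward_rooted_finite_tree spine_tree spine_edges (d0 + P)"
  proof (rule inward_rooted_finite_tree_parent)
    show "finite spine_tree" using finite_layer by simp
    show "d0 + P \<in> spine_tree" using d0P_layer by simp
    show "g v \<in> spine_tree" if "v \<in> spine_tree - {d0 + P}" for v using spine_parent(1)[OF that] by simp
    show "\<exists>m. (g ^^ m) v = d0 + P" if v: "v \<in> spine_tree" for v
    proof (cases "v = d0")
      case True
      then show ?thesis using d0_step[of 0] by (intro exI[of _ n]) simp
    next
      case False
      then show ?thesis using v unfolding layer_def basin_def by auto
    qed
  qed
  then show "oriented_towards spine_edges (d0 + P)" unfolding inward_rooted_finite_tree_def by blast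
  have "{w. (d0, w) \<in> spine_edges \<union> spine_edges\<inverse>} = {g d0}"
  proof -
    have "g w \<noteq> d0" if "w \<in> spine_tree - {d0 + P}" for w
      using spine_parent(1)[OF that] d0_not_layer[of 0] by auto
    then show ?thesis using P_pos by auto
  qed
  then have "leaf spine_edges d0" unfolding leaf_def by simp
  then show "template spine_tree spine_edges d0 (d0 + P)"
    using tree unfolding template_def inward_rooted_finite_tree_def by simp
qed

abbreviation "spine_graph \<equiv> S_graph spine_tree spine_edges d0 (d0 + P)"

lemma spine_srep:
  "\<exists>j' w. srep d0 (d0 + P) (j, v) = (j', w) \<and> v + j * P = w + j' * P"
  using P_pos by (cases "v = d0"; cases j) (simp_all add: srep_simps)

lemma spine_graph_vertices: "fst spine_graph = insert (0, d0) {(j, v) | j v. v \<in> layer 0}"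
proof -
  have "spine_tree - {d0} = layer 0" using d0_not_layer[of 0] by blast
  then show ?thesis using S_graph_vertices[of d0 spine_tree "d0 + P"] d0P_layer by simp
qed

lemma spine_graph_edge:
  assumes "u \<in> spine_tree - {d0 + P}"
  shows "(srep d0 (d0 + P) (j, u), srep d0 (d0 + P) (j, g u)) \<in> snd spine_graph"
  unfolding S_graph_def snd_conv using assms by blast

lemma shape2_columns:
  assumes \<phi>: "bij_betw \<phi> L X" and f: "\<And>u. u \<in> L \<Longrightarrow> g u \<in> L \<and> f (\<phi> u) = \<phi> (g u)"
  shows "shape2 X f"
proof -
  let ?E = "{(u, g u) | u. u \<in> trunk - {d0}}"
  let ?B = "attach_all (trunk, ?E) {0} (\<lambda>_. spine_graph) (\<lambda>_. (0, d0)) (\<lambda>_. d0)"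
  define \<chi> :: "nat \<times> nat \<Rightarrow> nat" where "\<chi> = (\<lambda>(j, v). v + j * P)"
  have \<chi>_srep: "\<chi> (srep d0 (d0 + P) (j, v)) = v + j * P" for j v
    using spine_srep[of j v] by (auto simp: \<chi>_def)
  have d0_trunk: "d0 \<in> trunk" using trunk_tree unfolding inward_rooted_finite_tree_def by blast
  have trunk_step: "g u \<in> trunk" if "u \<in> trunk - {d0}" for u
    using that basin_g base_closed by (auto simp: trunk_def)
  have verts: "fst spine_graph - {(0, d0)} = {(j, v) | j v. v \<in> layer 0}"
    using spine_graph_vertices d0_not_layer[of 0] by auto
  have "represents g (trunk \<union> (\<Union>i\<in>{0::nat}. \<Union>j. layer j)) ?B (case_sum (\<lambda>v. v) (\<lambda>(i, v). \<chi> v))"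
  proof (rule represents_attach_all)
    show "bij_betw (\<lambda>v. v) (fst (trunk, ?E)) trunk" by (simp add: bij_betw_def)
    show "a \<in> fst (trunk, ?E) \<and> b \<in> fst (trunk, ?E) \<and> g a = b" if "(a, b) \<in> snd (trunk, ?E)" for a b
      using that trunk_step[of a] by auto
    show "(\<exists>b. (a, b) \<in> snd (trunk, ?E)) \<or> (\<exists>i\<in>{0::nat}. d0 = a \<and> (\<exists>b. ((0, d0), b) \<in> snd spine_graph))"
      if a: "a \<in> fst (trunk, ?E)" for a
    proof (cases "a = d0")
      case True
      \<comment> \<open>The root of the trunk has no outgoing edge in the trunk; its edge is the
        first one of the spine.\<close>
      have "((0, d0), srep d0 (d0 + P) (0, g d0)) \<in> snd spine_graph"
        using spine_graph_edge[of d0 0] P_pos by (simp add: srep_simps)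
      then show ?thesis using True by blast
    next
      case False
      then show ?thesis using a by auto
    qed
    show "inj_on \<chi> (fst spine_graph - {(0, d0)})"
    proof (rule inj_onI)
      fix x y assume xy: "x \<in> fst spine_graph - {(0, d0)}" "y \<in> fst spine_graph - {(0, d0)}" "\<chi> x = \<chi> y"
      obtain j v where x: "x = (j, v)" "v \<in> layer 0" using xy(1) unfolding verts by blast
      obtain j' v' where y: "y = (j', v')" "v' \<in> layer 0" using xy(2) unfolding verts by blast
      have eq: "v + j * P = v' + j' * P" using xy(3) x(1) y(1) by (simp add: \<chi>_def)
      have "v + j * P \<in> layer j" "v' + j' * P \<in> layer j'" using layer_iff x(2) y(2) by blast+
      then have "j = j'" using layer_disjoint eq by simp
      then show "x = y" using eq x(1) y(1) by simp
    qed
    show "\<chi> ` (fst spine_graph - {(0, d0)}) = (\<Union>j. layer j)"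
    proof -
      have "\<chi> ` {(j, v) | j v. v \<in> layer 0} = {u. \<exists>j. \<exists>v\<in>layer 0. u = v + j * P}"
        unfolding \<chi>_def by force
      also have "\<dots> = (\<Union>j. layer j)" using layer_iff by blast
      finally show ?thesis unfolding verts .
    qed
    have "layer j \<inter> basin d0 = {}" for j using basin_spine_mono[of 0 j] unfolding layer_def by auto
    then show "trunk \<inter> (\<Union>j. layer j) = {}" unfolding trunk_def by blast
    show "a \<in> fst spine_graph \<and> b \<in> fst spine_graph \<and> g (\<chi> a) = \<chi> b" if ab: "(a, b) \<in> snd spine_graph" for a b
    proof -
      obtain j u where u: "u \<in> spine_tree - {d0 + P}" "a = srep d0 (d0 + P) (j, u)" "b = srep d0 (d0 + P) (j, g u)"
        using ab unfolding S_graph_def by auto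
      have "u \<in> spine_tree" "g u \<in> spine_tree" using u(1) spine_parent(1)[OF u(1)] by auto
      then have "a \<in> fst spine_graph" "b \<in> fst spine_graph" unfolding u(2,3) S_graph_def fst_conv by blast+
      moreover have "g (u + j * P) = g u + j * P" using spine_parent(2)[OF u(1)] unfolding shift_at_def by blast
      ultimately show ?thesis unfolding u(2,3) \<chi>_srep by blast
    qed
    show "\<exists>b. (a, b) \<in> snd spine_graph" if a: "a \<in> fst spine_graph" "a \<noteq> (0, d0)" for a
    proof -
      obtain j v where v: "a = (j, v)" "v \<in> layer 0" using a verts by blast
      show ?thesis
      proof (cases "v = d0 + P")
        case True
        \<comment> \<open>The last vertex of copy \<open>j\<close> is the first of copy
          \<open>Suc j\<close> and takes its outgoing edge from there.\<close>
        then have "a = srep d0 (d0 + P) (Suc j, d0)" using v(1) P_pos by (simp add: srep_simps)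
        moreover have "d0 \<in> spine_tree - {d0 + P}" using P_pos by simp
        ultimately show ?thesis using spine_graph_edge[of d0 "Suc j"] by metis
      next
        case False
        have "v \<noteq> d0" using v(2) d0_not_layer[of 0] by metis
        then have "a = srep d0 (d0 + P) (j, v)" using v(1) by (simp add: srep_simps)
        moreover have "v \<in> spine_tree - {d0 + P}" using v(2) False by simp
        ultimately show ?thesis using spine_graph_edge[of v j] by metis
      qed
    qed
  qed (use d0_trunk in \<open>auto simp: \<chi>_def\<close>)
  moreover have "trunk \<union> (\<Union>i\<in>{0::nat}. \<Union>j. layer j) = base"
  proof
    show "trunk \<union> (\<Union>i\<in>{0::nat}. \<Union>j. layer j) \<subseteq> base" unfolding trunk_def using layer_base by blast
    show "base \<subseteq> trunk \<union> (\<Union>i\<in>{0::nat}. \<Union>j. layer j)"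
    proof
      fix u assume u: "u \<in> base"
      then have "u \<in> basin d0 \<union> (\<Union>j. layer j)" using base_iff layer_cover by simp
      then show "u \<in> trunk \<union> (\<Union>i\<in>{0::nat}. \<Union>j. layer j)" unfolding trunk_def using u by blast
    qed
  qed
  ultimately have "represents g base ?B (case_sum (\<lambda>v. v) (\<lambda>(i, v). \<chi> v))" by simp
  from attach_heads[OF this] obtain G \<Psi> where G: "attach_inward_comps ?B G" "represents g L G \<Psi>" by blast
  have iso: "graph_iso (map_graph X f) G" using graph_iso_if_represents[OF G(2) \<phi>] f by blast
  have "d0 \<noteq> d0 + P" using P_pos by simp
  then show ?thesis
    unfolding shape2_def outwardly_oriented_def
    using G(1) iso trunk_tree spine_template
    by (intro exI[of _ trunk] exI[of _ ?E] exI[of _ d0] exI[of _ spine_tree] exI[of _ spine_edges]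
        exI[of _ d0] exI[of _ "d0 + P"] exI[of _ G] conjI)
qed

end

section \<open>Choice of the spine and the case distinction\<close>

context columns
begin

lemma exists_outward_columns:
  assumes acyclic: "\<And>u i. u \<in> L \<Longrightarrow> 0 < i \<Longrightarrow> (g ^^ i) u \<noteq> u"
  shows "\<exists>d0 n. outward_columns L g P M Q d0 n"
proof -
  obtain v where v: "v \<in> L" "outward_at g P v" using exists_outward[OF acyclic] by blast
  then obtain n where n: "0 < n" "\<And>j. (g ^^ n) (v + j * P) = v + Suc j * P"
    unfolding outward_at_def by blast
  have vn: "(g ^^ (j * n)) v = v + j * P" for j
  proof (induction j)
    case (Suc j)
    have "(g ^^ (Suc j * n)) v = (g ^^ n) ((g ^^ (j * n)) v)" by (simp add: funpow_plus)
    then show ?case using Suc n by simp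
  qed simp
  have "\<exists>a b. (g ^^ a) l = (g ^^ b) v" if "l \<in> low" for l using orbit that v(1) by (auto simp: low_def)
  then obtain \<alpha> \<beta> where ab: "\<And>l. l \<in> low \<Longrightarrow> (g ^^ \<alpha> l) l = (g ^^ \<beta> l) v" by metis
  have "finite (\<beta> ` low)" using finite_low by simp
  then obtain J where J: "\<And>l. l \<in> low \<Longrightarrow> \<beta> l < J" unfolding finite_nat_set_iff_bounded by blast
  \<comment> \<open>Each vertex of \<open>low\<close> meets the orbit of \<open>v\<close> after
    fewer than \<open>J\<close> steps of that orbit, and \<open>v + J * P\<close> comes
    \<open>J * n\<close> steps after \<open>v\<close>, so it lies beyond all these meeting
    points.\<close>
  define d0 where "d0 = v + J * P"
  have "outward_columns L g P M Q d0 n"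
  proof unfold_locales
    show "(g ^^ i) u \<noteq> u" if "u \<in> L" "0 < i" for u i using acyclic that .
    show "d0 \<in> L" using iter_closed[OF v(1), of "J * n"] vn by (simp add: d0_def)
    show "0 < n" by (rule n(1))
    show "(g ^^ n) (d0 + j * P) = d0 + Suc j * P" for j
      using n(2)[of "J + j"] by (simp add: d0_def algebra_simps)
    show "\<exists>m>0. (g ^^ m) l = d0" if l: "l \<in> low" for l
    proof (intro exI conjI)
      have "J \<le> J * n" using n(1) by simp
      then have lt: "\<beta> l < J * n" using J[OF l] by linarith
      then show "0 < J * n - \<beta> l + \<alpha> l" by simp
      have "(g ^^ (J * n - \<beta> l + \<alpha> l)) l = (g ^^ (J * n - \<beta> l)) ((g ^^ \<beta> l) v)" using ab[OF l] by (simp add: funpow_plus)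
      also have "\<dots> = (g ^^ (J * n)) v" using lt by (simp flip: funpow_plus)
      finally show "(g ^^ (J * n - \<beta> l + \<alpha> l)) l = d0" by (simp add: vn d0_def)
    qed
  qed
  then show ?thesis by blast
qed

lemma shape1_or_shape2:
  assumes \<phi>: "bij_betw \<phi> L X" and f: "\<And>u. u \<in> L \<Longrightarrow> g u \<in> L \<and> f (\<phi> u) = \<phi> (g u)"
  shows "shape1 X f \<or> shape2 X f"
proof (cases "\<exists>z\<in>L. \<exists>i>0. (g ^^ i) z = z")
  case True
  then obtain z i where z: "z \<in> L" "0 < i" "(g ^^ i) z = z" by blast
  define n where "n = (LEAST n. 0 < n \<and> (g ^^ n) z = z)"
  have "0 < n \<and> (g ^^ n) z = z" unfolding n_def by (rule LeastI[of _ i]) (use z in blast)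
  moreover have "(g ^^ k) z \<noteq> z" if "0 < k" "k < n" for k
    using not_less_Least[of k "\<lambda>n. 0 < n \<and> (g ^^ n) z = z"] that unfolding n_def by blast
  ultimately interpret cyclic_columns L g P M Q z n using z(1) by unfold_locales auto
  show ?thesis using shape1_columns[OF \<phi>, of f] f by blast
next
  case False
  then have "\<exists>d0 n. outward_columns L g P M Q d0 n" by (intro exists_outward_columns) blast
  then obtain d0 n where "outward_columns L g P M Q d0 n" by blast
  then interpret outward_columns L g P M Q d0 n .
  obtain N where N: "high_columns L g P M Q N" using exists_high by blast
  interpret high_columns L g P M Q N by (rule N)
  interpret outward_high_columns L g P M Q d0 n N by unfold_locales
  show ?thesis using shape2_columns[OF \<phi>, of f] f by blast
qed

end

section \<open>Decomposition of a presentable map\<close>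

text \<open>Unless a small vertex or a constant column comes up within \<open>q\<close> steps, two
  of the first \<open>q + 1\<close> vertices agree modulo \<open>q\<close>. The steps between them
  commute with translation by \<open>q\<close>, so the whole column of the first is shifted along
  itself. Each step drops by less than \<open>q\<close>, whence the bound
  \<open>q * q\<close>.\<close>

lemma orbit_hits_special:
  assumes pL: "periodic_set q L" and pR: "periodic_rel q (\<lambda>m n. m \<in> L \<and> n = g m)" and q: "0 < q"
    and gL: "\<And>u. u \<in> L \<Longrightarrow> g u \<in> L"
    and orbit: "\<And>u v. u \<in> L \<Longrightarrow> v \<in> L \<Longrightarrow> \<exists>m n. (g ^^ m) u = (g ^^ n) v"
    and u: "u \<in> L" and P: "P = fact q * q"
  shows "\<exists>i. ((g ^^ i) u < 2 * q + P \<or> const_at g P ((g ^^ i) u) \<or>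
           inward_at g P ((g ^^ i) u) \<or> outward_at g P ((g ^^ i) u)) \<and> (\<forall>k\<le>i. u \<le> (g ^^ k) u + q * q)"
proof -
  define bad where "bad k \<longleftrightarrow> (g ^^ k) u < 2 * q + P \<or> const_at g P ((g ^^ k) u)" for k
  have uL: "(g ^^ k) u \<in> L" for k using u gL by (induction k) auto
  have shift: "(\<forall>j. g ((g ^^ k) u + j * q) = g ((g ^^ k) u) + j * q) \<and>
      (g ^^ k) u < g ((g ^^ k) u) + q \<and> g ((g ^^ k) u) < (g ^^ k) u + q" if "\<not> bad k" for k
  proof -
    have "\<not> (\<forall>j. g ((g ^^ k) u + j * q) = g ((g ^^ k) u))"
    proof
      assume a: "\<forall>j. g ((g ^^ k) u + j * q) = g ((g ^^ k) u)"
      have "g ((g ^^ k) u + j * P) = g ((g ^^ k) u)" for j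
        using a[rule_format, of "j * fact q"] by (simp add: P algebra_simps)
      then show False using that by (simp add: bad_def const_at_def)
    qed
    moreover have "2 * q \<le> (g ^^ k) u" using that by (simp add: bad_def)
    ultimately show ?thesis using periodic_graph_columns[OF pL pR q uL[of k]] by blast
  qed
  have dist: "u \<le> (g ^^ k) u + k * q \<and> (g ^^ k) u \<le> u + k * q" if "\<And>l. l < k \<Longrightarrow> \<not> bad l" for k
    using that
  proof (induction k)
    case (Suc k)
    then have "u \<le> (g ^^ k) u + k * q \<and> (g ^^ k) u \<le> u + k * q" by simp
    then show ?case using shift[of k] Suc.prems[of k] by simp
  qed simp
  have dist': "u \<le> (g ^^ k) u + q * q" if "\<And>l. l < k \<Longrightarrow> \<not> bad l" "k \<le> q" for k
  proof -
    have "k * q \<le> q * q" using that(2) by simp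
    then show ?thesis using dist[of k] that(1) by (meson add_left_mono order_trans)
  qed
  show ?thesis
  proof (cases "\<exists>k\<le>q. bad k")
    case True
    define i where "i = (LEAST k. bad k)"
    obtain k where k: "k \<le> q" "bad k" using True by blast
    have i: "bad i" "i \<le> q" unfolding i_def using LeastI[of bad, OF k(2)] Least_le[of bad, OF k(2)] k(1) by auto
    have "\<not> bad l" if "l < i" for l using not_less_Least that unfolding i_def by blast
    then have "u \<le> (g ^^ k) u + q * q" if "k \<le> i" for k using dist'[of k] that i(2) by simp
    then show ?thesis using i(1) unfolding bad_def by blast
  next
    case False
    then have nb: "\<not> bad k" if "k \<le> q" for k using that by blast
    have "\<not> inj_on (\<lambda>k. (g ^^ k) u mod q) {..q}"
    proof
      assume "inj_on (\<lambda>k. (g ^^ k) u mod q) {..q}"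
      then have "card {..q} \<le> card {..<q}" by (rule card_inj_on_le) (use q in auto)
      then show False by simp
    qed
    then obtain i j where ij: "i < j" "j \<le> q" "(g ^^ i) u mod q = (g ^^ j) u mod q"
      unfolding inj_on_def by (metis atMost_iff linorder_neqE_nat)
    define v where "v = (g ^^ i) u"
    define n where "n = j - i"
    have n: "0 < n" "n \<le> q" using ij by (auto simp: n_def)
    have gn: "(g ^^ k) v = (g ^^ (k + i)) u" for k by (simp add: v_def funpow_plus)
    have up: "(g ^^ k) (v + l * q) = (g ^^ k) v + l * q" if "k \<le> n" for k l
      using that
    proof (induction k)
      case (Suc k)
      then have "\<not> bad (k + i)" using nb[of "k + i"] ij by (simp add: n_def)
      then show ?case using Suc shift[of "k + i"] by (simp add: gn)
    qed simp
    have vL: "v + l * q \<in> L" for l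
    proof (induction l)
      case 0
      then show ?case using uL by (simp add: v_def)
    next
      case (Suc l)
      have "q \<le> v + l * q" using nb[of i] ij unfolding bad_def v_def[symmetric] by linarith
      then have "v + l * q + q \<in> L" using pL Suc unfolding periodic_set_def by blast
      then show ?case by (simp add: add_ac)
    qed
    have cong: "(g ^^ n) v mod q = v mod q" using ij gn[of n] by (simp add: v_def n_def)
    have close: "v \<le> (g ^^ n) v + n * q \<and> (g ^^ n) v \<le> v + n * q"
    proof -
      have "v \<le> (g ^^ k) v + k * q \<and> (g ^^ k) v \<le> v + k * q" if "k \<le> n" for k
        using that
      proof (induction k)
        case (Suc k)
        then have "\<not> bad (k + i)" using nb[of "k + i"] ij by (simp add: n_def)
        then show ?case using Suc shift[of "k + i"] by (simp add: gn)
      qed simp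
      then show ?thesis by blast
    qed
    have special: "inward_at g P v \<or> outward_at g P v"
    proof (cases "(g ^^ n) v" v rule: linorder_cases)
      case equal
      \<comment> \<open>A return without shift would make every point of the column periodic. In a
        single orbit all of them would lie on the cycle of \<open>v\<close>, which is
        finite.\<close>
      have "v + l * q \<in> (\<lambda>k. (g ^^ k) v) ` {..<n}" for l
      proof -
        have per: "(g ^^ n) (v + l * q) = v + l * q" using up[of n l] equal by simp
        obtain a b where ab: "(g ^^ a) (v + l * q) = (g ^^ b) v" using orbit[OF vL[of l] vL[of 0]] by auto
        have "v + l * q = (g ^^ (n * a)) (v + l * q)" using funpow_mod_eq[OF per, of "n * a"] by simp
        also have "\<dots> = (g ^^ (n * a - a)) ((g ^^ a) (v + l * q))" using n(1) by (simp flip: funpow_plus)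
        also have "\<dots> = (g ^^ (n * a - a + b)) v" using ab by (simp add: funpow_plus)
        also have "\<dots> = (g ^^ ((n * a - a + b) mod n)) v" using funpow_mod_eq[OF equal] by simp
        finally show ?thesis using n(1) by auto
      qed
      then have "range (\<lambda>l. v + l * q) \<subseteq> (\<lambda>k. (g ^^ k) v) ` {..<n}" by blast
      moreover have "inj (\<lambda>l. v + l * q)" using q by (auto simp: inj_def)
      ultimately have False using finite_imageD infinite_UNIV_nat finite_subset finite_imageI finite_lessThan by metis
      then show ?thesis ..
    next
      case less
      then have "q dvd v - (g ^^ n) v" using cong by (metis less_imp_le mod_eq_dvd_iff_nat)
      then obtain k where "v - (g ^^ n) v = q * k" by (elim dvdE)
      then have k: "(g ^^ n) v + k * q = v" using less by (simp add: mult.commute)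
      have "k \<noteq> 0" using k less by (intro notI) simp
      \<comment> \<open>The displacement is at most \<open>q\<close> per step, so
        \<open>k \<le> n \<le> q\<close> and \<open>k\<close> divides \<open>fact q\<close>.\<close>
      moreover have "k * q \<le> n * q" using close k by linarith
      then have "k \<le> n" using q by simp
      ultimately have "k dvd fact q" using n by (intro dvd_fact) auto
      then obtain r where r: "fact q = k * r" by (elim dvdE)
      have r0: "0 < r" using r fact_nonzero[of q, where 'a = nat] by (intro gr0I) auto
      have step: "(g ^^ n) (v + (l + k) * q) = v + l * q" for l
        using up[of n "l + k"] k by (simp add: algebra_simps)
      have iter: "(g ^^ (s * n)) (v + (l + s * k) * q) = v + l * q" for s l
      proof (induction s)
        case (Suc s)
        have e: "Suc s * n = s * n + n" "l + Suc s * k = l + s * k + k" by simp_all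
        have "(g ^^ (Suc s * n)) (v + (l + Suc s * k) * q) = (g ^^ (s * n)) ((g ^^ n) (v + (l + s * k + k) * q))"
          unfolding e funpow_plus ..
        then show ?case using step[of "l + s * k"] Suc by simp
      qed simp
      \<comment> \<open>With \<open>fact q = k * r\<close>, repeating the return \<open>r\<close>
        times lowers by \<open>r * k * q\<close>, which is exactly \<open>P\<close>.\<close>
      have "(g ^^ (r * n)) (v + Suc j * P) = v + j * P" for j
        using iter[of r "j * fact q"] by (simp add: P r algebra_simps)
      then show ?thesis unfolding inward_at_def using r0 n(1) by (metis nat_0_less_mult_iff)
    next
      case greater
      then have "q dvd (g ^^ n) v - v" using cong by (metis less_imp_le mod_eq_dvd_iff_nat)
      then obtain k where "(g ^^ n) v - v = q * k" by (elim dvdE)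
      then have k: "(g ^^ n) v = v + k * q" using greater by (simp add: mult.commute)
      have "k \<noteq> 0" using k greater by (intro notI) simp
      moreover have "k * q \<le> n * q" using close k by linarith
      then have "k \<le> n" using q by simp
      ultimately have "k dvd fact q" using n by (intro dvd_fact) auto
      then obtain r where r: "fact q = k * r" by (elim dvdE)
      have r0: "0 < r" using r fact_nonzero[of q, where 'a = nat] by (intro gr0I) auto
      have step: "(g ^^ n) (v + l * q) = v + (l + k) * q" for l
        using up[of n l] k by (simp add: algebra_simps)
      have iter: "(g ^^ (s * n)) (v + l * q) = v + (l + s * k) * q" for s l
      proof (induction s)
        case (Suc s)
        have "(g ^^ (Suc s * n)) (v + l * q) = (g ^^ n) ((g ^^ (s * n)) (v + l * q))" by (simp add: funpow_plus)
        then show ?case using step[of "l + s * k"] Suc by (simp add: algebra_simps)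
      qed simp
      have "(g ^^ (r * n)) (v + j * P) = v + Suc j * P" for j
        using iter[of r "j * fact q"] by (simp add: P r algebra_simps)
      then show ?thesis unfolding outward_at_def using r0 n(1) by (metis nat_0_less_mult_iff)
    qed
    have "u \<le> (g ^^ k) u + q * q" if "k \<le> i" for k
      using dist'[of k] nb that ij by simp
    then show ?thesis using special unfolding v_def by blast
  qed
qed

text \<open>\<open>2 * q\<close> is the bound from which columns of step \<open>q\<close> are
  uniform, and a column constant or shifted for the step \<open>q\<close> stays so for the multiple
  \<open>fact q * q\<close>.\<close>

lemma columns_if_periodic:
  assumes pL: "periodic_set q L" and pR: "periodic_rel q (\<lambda>m n. m \<in> L \<and> n = g m)" and q: "0 < q"
    and gL: "\<And>u. u \<in> L \<Longrightarrow> g u \<in> L" and ne: "L \<noteq> {}"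
    and orbit: "\<And>u v. u \<in> L \<Longrightarrow> v \<in> L \<Longrightarrow> \<exists>m n. (g ^^ m) u = (g ^^ n) v"
  shows "columns L g (fact q * q) (2 * q) (q * q)"
proof
  show "0 < fact q * q" using q by simp
  show "g u \<in> L" if "u \<in> L" for u using gL that .
  show "\<exists>m n. (g ^^ m) u = (g ^^ n) v" if "u \<in> L" "v \<in> L" for u v using orbit that .
  show "L \<noteq> {}" by (rule ne)
  show "u + fact q * q \<in> L \<longleftrightarrow> u \<in> L" if u: "2 * q \<le> u" for u
  proof -
    have "u + j * q \<in> L \<longleftrightarrow> u \<in> L" for j
    proof (induction j)
      case (Suc j)
      have "q \<le> u + j * q" using u by simp
      then have "u + j * q + q \<in> L \<longleftrightarrow> u + j * q \<in> L" using pL unfolding periodic_set_def by blast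
      then show ?case using Suc by (simp add: add_ac)
    qed simp
    then show ?thesis by blast
  qed
  show "shift_at g (fact q * q) u \<or> const_at g (fact q * q) u \<and> g u < 2 * q" if u: "u \<in> L" "2 * q \<le> u" for u
    using periodic_graph_columns[OF pL pR q u]
  proof
    assume a: "(\<forall>j. g (u + j * q) = g u + j * q) \<and> u < g u + q \<and> g u < u + q"
    have "g (u + j * (fact q * q)) = g u + j * (fact q * q)" for j
      using a[THEN conjunct1, rule_format, of "j * fact q"] by (simp add: mult.assoc)
    then show ?thesis unfolding shift_at_def by blast
  next
    assume a: "(\<forall>j. g (u + j * q) = g u) \<and> g u < q"
    have "g (u + j * (fact q * q)) = g u" for j
      using a[THEN conjunct1, rule_format, of "j * fact q"] by (simp add: mult.assoc)
    then show ?thesis unfolding const_at_def using a by auto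
  qed
  show "\<exists>i. ((g ^^ i) u < 2 * q + fact q * q \<or> const_at g (fact q * q) ((g ^^ i) u) \<or>
           inward_at g (fact q * q) ((g ^^ i) u) \<or> outward_at g (fact q * q) ((g ^^ i) u)) \<and>
           (\<forall>k\<le>i. u \<le> (g ^^ k) u + q * q)" if "u \<in> L" for u
    using orbit_hits_special[OF pL pR q gL orbit that refl] .
qed

theorem theorem7p2:
  fixes X :: "'x set" and f :: "'x \<Rightarrow> 'x"
  assumes "\<forall>x\<in>X. f x \<in> X"
    and "single_orbit X f"
  shows "unary_FA_presentable X f \<longleftrightarrow> shape1 X f \<or> shape2 X f"
proof
  have fX: "\<And>x. x \<in> X \<Longrightarrow> f x \<in> X" using assms(1) by blast
  show "unary_FA_presentable X f" if "shape1 X f \<or> shape2 X f"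
    using that presentable_if_shape1 presentable_if_shape2 fX by blast
  assume pres: "unary_FA_presentable X f"
  obtain L g q \<phi> where q: "0 < q" and \<phi>: "bij_betw \<phi> L X"
    and g: "\<And>u. u \<in> L \<Longrightarrow> g u \<in> L \<and> f (\<phi> u) = \<phi> (g u)"
    and pL: "periodic_set q L" and pR: "periodic_rel q (\<lambda>m n. m \<in> L \<and> n = g m)"
    by (rule presentableE[OF pres fX]) (assumption, rule that)
  have iter: "(g ^^ m) u \<in> L \<and> (f ^^ m) (\<phi> u) = \<phi> ((g ^^ m) u)" if "u \<in> L" for m u
    using that g by (induction m) auto
  have "columns L g (fact q * q) (2 * q) (q * q)"
  proof (rule columns_if_periodic[OF pL pR q])
    show "L \<noteq> {}" using assms(2) \<phi> unfolding single_orbit_def bij_betw_def by blast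
    show "\<exists>m n. (g ^^ m) u = (g ^^ n) v" if uv: "u \<in> L" "v \<in> L" for u v
    proof -
      have "\<phi> u \<in> X" "\<phi> v \<in> X" using uv \<phi> by (auto simp: bij_betw_def)
      then obtain m n where "(f ^^ m) (\<phi> u) = (f ^^ n) (\<phi> v)"
        using assms(2) unfolding single_orbit_def by blast
      then have "\<phi> ((g ^^ m) u) = \<phi> ((g ^^ n) v)" using iter uv by simp
      then have "(g ^^ m) u = (g ^^ n) v"
        using \<phi> iter[OF uv(1), of m] iter[OF uv(2), of n] by (auto simp: bij_betw_def dest: inj_onD)
      then show ?thesis by blast
    qed
  qed (use g in blast)
  then interpret columns L g "fact q * q" "2 * q" "q * q" .
  show "shape1 X f \<or> shape2 X f" using shape1_or_shape2[OF \<phi>, of f] g by blast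
qed

end
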